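(* Let $r$ be any set of rank conditions with dimension vector $(e_0,\dots,e_n)$. Then, as rational functions in the indeterminates $a^i_j$, \[ \frac{\mathfrak G_{\widehat z(r)}(\breve a;a)}{\mathfrak G_{\widehat z(e)}(\breve a;a)}=\sum_{(w_1,\dots,w_n)}(-1)^{\ell(w_1)+\dots+\ell(w_n)-d(r)}\,G_{w_1}(a^1;a^0)\,G_{w_2}(a^2;a^1)\cdots G_{w_n}(a^n;a^{n-1}), \] where the sum is over all KMS-factorizations $(w_1,\dots,w_n)$ for $r$.
   Context: Rank conditions: fix $n\ge1$. A set of rank conditions is a family $r=\{r_{ij}\}_{0\le i\le j\le n}$ of non-negative integers with $r_{ij}\le\min(r_{i,j-1},r_{i+1,j})$ for $0\le i<j\le n$ and $r_{ij}+r_{i-1,j+1}\ge r_{i-1,j}+r_{i,j+1}$ for $0<i\le j<n$. Dimension vector $e_i=r_{ii}$. Extend by $r_{ij}=e_j+\dots+e_i$ for $j\le i$, and $r_{ij}=0$ if $i<0$ or $j>n$. $N=e_0+\dots+e_n$, $d(r)=\sum_{0\le i<j\le n}(r_{i,j-1}-r_{ij})(r_{i+1,j}-r_{ij})$. Permutations: $S_k$ on $\{1,\dots,k\}$, embedded in $S_{k+1}$ by fixing larger integers; $(uv)(p)=u(v(p))$; $s_i=(i,i+1)$; $\ell$ = length; $w_0^{(k)}$ the longest element of $S_k$. Absolute Hecke product: in the degenerate Hecke algebra (free algebra on $s_1,s_2,\dots$ modulo $s_is_j=s_js_i$ for $|i-j|\ge2$, braid relations, $s_i^2=-s_i$, with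 basis of permutations via reduced words), a product of permutations $u_1\cdots u_k$ equals $\pm w$ for a unique permutation $w$, denoted $u_1\cdot u_2\cdots u_k$. For $0\le i<n$, $0<j\le n$, $W_{ij}\in S_{r_{i+1,j-1}}$: $W_{ij}(p)=p+r_{i,j-1}-r_{ij}$ if $r_{ij}<p\le r_{i+1,j}$; $=p-r_{i+1,j}+r_{ij}$ if $r_{i+1,j}<p\le r_{i+1,j}+r_{i,j-1}-r_{ij}$; $=p$ otherwise. $z(r)=\prod_{j=1}^n\prod_{i=0}^{n-1}W_{ij}=(W_{01}\cdots W_{n-1,1})\cdots(W_{0n}\cdots W_{n-1,n})$ and $\widehat z(r)=w_0^{(N)}z(r)^{-1}w_0^{(N)}$. With $r^e_{ij}=\min(e_i,\dots,e_j)$, $\widehat z(e)=\widehat z(r^e)$. For $1\le j\le n-1$, $\delta_j\in S_{r_{n,j-1}}$: $\delta_j(p)=p$ for $p\le e_j$, $p+e_{j-1}$ for $e_j<p\le r_{nj}$, $p-r_{n,j+1}$ for $r_{nj}<p\le r_{n,j-1}$. A KMS-factorization for $r$ is $(w_1,\dots,w_n)$ with $w_i\in S_{e_{i-1}+e_i}$ and $w_1\cdot\delta_1\cdot w_2\cdots\delta_{n-1}\cdot w_n=z(r)$. Grothendieck polynomials: for $w\in S_N$, $\mathfrak G_w(a_1..a_N;b_1..b_N)$ is determined by $\mathfrak G_{w_0^{(N)}}=\prod_{p+q\le N}(1-b_p/a_q)$ and, when $w(i)<w(i+1)$, $(a_i-a_{i+1})\mathfrak G_w(a;b)=a_i\mathfrak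 G_{ws_i}(a;b)-a_{i+1}\mathfrak G_{ws_i}(a_{s_i};b)$ ($a_{s_i}$: $a_i,a_{i+1}$ swapped). Stable version: $G_w(a_1..a_q;b_1..b_p)=\mathfrak G_{1^m\times w}(a_1,..,a_q,1,..,1;b_1,..,b_p,1,..,1)$ for any $m\ge\max(p,q)$, where $1^m\times w$ fixes $1..m$ and sends $j>m$ to $w(j-m)+m$. Variables: $a^i=(a^i_1,\dots,a^i_{e_i})$ for $0\le i\le n$; $a=(a^0,\dots,a^n)$, $\breve a=(a^n,\dots,a^0)$ are the concatenated length-$N$ sequences (each block in its own order); $\mathfrak G_w(\breve a;a)$ is $\mathfrak G_w$ with the first argument list replaced by $\breve a$ and the second by $a$. $G_{w_i}(a^i;a^{i-1})$ uses $q=e_i$, $p=e_{i-1}$. *)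

theory Defs
  imports
    "HOL-Combinatorics.Permutations"
    "HOL-Library.Poly_Mapping"
    "HOL-Library.Nat_Bijection"
    "HOL-Computational_Algebra.Fraction_Field"
begin

section \<open>Permutations\<close>

text \<open>
  \<open>S\<^sub>k\<close> is the set of \<open>w :: nat \<Rightarrow> nat\<close> with \<open>w permutes {1..k}\<close>. Such functions fix every
  other natural number, so the inclusion of \<open>S\<^sub>k\<close> in \<open>S\<^sub>k\<^sub>+\<^sub>1\<close> is implicit; products
  are compositions and \<open>s\<^sub>i\<close> is \<open>transpose i (Suc i)\<close> with \<open>i \<ge> 1\<close>.
\<close>

definition finite_perm :: "(nat \<Rightarrow> nat) \<Rightarrow> bool" where
  "finite_perm w \<longleftrightarrow> (\<exists>k. w permutes {1..k})"

definition perm_prod :: "(nat \<Rightarrow> nat) list \<Rightarrow> nat \<Rightarrow> nat" where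
  "perm_prod us = foldr (\<circ>) us id"

definition perm_length :: "(nat \<Rightarrow> nat) \<Rightarrow> nat" where
  "perm_length w = card {(p, q). p < q \<and> w q < w p}"

definition longest_perm :: "nat \<Rightarrow> nat \<Rightarrow> nat" where
  "longest_perm k p = (if 1 \<le> p \<and> p \<le> k then k + 1 - p else p)"

definition shift_perm :: "nat \<Rightarrow> (nat \<Rightarrow> nat) \<Rightarrow> nat \<Rightarrow> nat" where
  "shift_perm m w j = (if j \<le> m then j else w (j - m) + m)"

definition reduced_word :: "nat list \<Rightarrow> (nat \<Rightarrow> nat) \<Rightarrow> bool" where
  "reduced_word is w \<longleftrightarrow>
     (\<forall>i\<in>set is. 1 \<le> i) \<and> perm_prod (map (\<lambda>i. transpose i (Suc i)) is) = w \<and>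
     length is = perm_length w"


section \<open>The degenerate Hecke algebra\<close>

text \<open>
  The free monoid is written additively, so that \<open>free_word \<Rightarrow>\<^sub>0 int\<close>, with the convolution
  product of \<open>Poly_Mapping\<close>, is its monoid ring, i.e. the free associative \<open>\<int>\<close>-algebra.
\<close>

datatype free_word = Word (letters: "nat list")

instantiation free_word :: monoid_add
begin

definition zero_free_word :: free_word where
  "0 = Word []"

definition plus_free_word :: "free_word \<Rightarrow> free_word \<Rightarrow> free_word" where
  "u + v = Word (letters u @ letters v)"

instance
  by standard (simp_all add: zero_free_word_def plus_free_word_def)

end

type_synonym free_algebra = "free_word \<Rightarrow>\<^sub>0 int"

text \<open>
  The generators are \<open>s\<^sub>1, s\<^sub>2, \<dots>\<close>; the letter \<open>k\<close> stands for \<open>s\<^sub>k\<^sub>+\<^sub>1\<close>, so that every letter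
  is used. Accordingly \<open>hecke_s i\<close> is only meant for \<open>i \<ge> 1\<close>.
\<close>

definition hecke_s :: "nat \<Rightarrow> free_algebra" where
  "hecke_s i = Poly_Mapping.single (Word [i - 1]) 1"

inductive_set hecke_ideal :: "free_algebra set" where
  commute: "1 \<le> i \<Longrightarrow> i + 2 \<le> j \<Longrightarrow> hecke_s i * hecke_s j - hecke_s j * hecke_s i \<in> hecke_ideal"
| braid: "1 \<le> i \<Longrightarrow>
    hecke_s i * hecke_s (i + 1) * hecke_s i - hecke_s (i + 1) * hecke_s i * hecke_s (i + 1)
      \<in> hecke_ideal"
| quadratic: "1 \<le> i \<Longrightarrow> hecke_s i * hecke_s i + hecke_s i \<in> hecke_ideal"
| diff: "x \<in> hecke_ideal \<Longrightarrow> y \<in> hecke_ideal \<Longrightarrow> x - y \<in> hecke_ideal"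
| mult: "x \<in> hecke_ideal \<Longrightarrow> c * x * d \<in> hecke_ideal"

text \<open>Equality in the degenerate Hecke algebra, the quotient of the free algebra.\<close>

definition hecke_eq :: "free_algebra \<Rightarrow> free_algebra \<Rightarrow> bool" where
  "hecke_eq x y \<longleftrightarrow> x - y \<in> hecke_ideal"

text \<open>
  A representative of the basis element of a finite permutation; modulo \<open>hecke_ideal\<close> it does not
  depend on the reduced word.
\<close>

definition hecke_basis :: "(nat \<Rightarrow> nat) \<Rightarrow> free_algebra" where
  "hecke_basis w = prod_list (map hecke_s (SOME is. reduced_word is w))"

definition abs_hecke_prod :: "(nat \<Rightarrow> nat) list \<Rightarrow> nat \<Rightarrow> nat" where
  "abs_hecke_prod us =
     (THE w. finite_perm w \<and>
       (hecke_eq (prod_list (map hecke_basis us)) (hecke_basis w) \<or>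
        hecke_eq (prod_list (map hecke_basis us)) (- hecke_basis w)))"


section \<open>Rank conditions and Zelevinsky permutations\<close>

text \<open>
  Only the values \<open>r i j\<close> with \<open>i \<le> j \<le> n\<close> belong to the family of rank conditions.
\<close>

definition rank_conditions :: "nat \<Rightarrow> (nat \<Rightarrow> nat \<Rightarrow> nat) \<Rightarrow> bool" where
  "rank_conditions n r \<longleftrightarrow>
     (\<forall>i j. i < j \<and> j \<le> n \<longrightarrow> r i j \<le> min (r i (j - 1)) (r (i + 1) j)) \<and>
     (\<forall>i j. 0 < i \<and> i \<le> j \<and> j < n \<longrightarrow>
        r i j + r (i - 1) (j + 1) \<ge> r (i - 1) j + r i (j + 1))"

definition dim_vec :: "(nat \<Rightarrow> nat \<Rightarrow> nat) \<Rightarrow> nat \<Rightarrow> nat" where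
  "dim_vec r i = r i i"

definition total_dim :: "nat \<Rightarrow> (nat \<Rightarrow> nat) \<Rightarrow> nat" where
  "total_dim n e = (\<Sum>i=0..n. e i)"

text \<open>
  The extension of \<open>r\<close> to further indices. Negative \<open>i\<close> never occur below.
\<close>

definition ext_rank :: "nat \<Rightarrow> (nat \<Rightarrow> nat \<Rightarrow> nat) \<Rightarrow> nat \<Rightarrow> nat \<Rightarrow> nat" where
  "ext_rank n r i j =
     (if j > n then 0 else if j \<le> i then (\<Sum>k=j..i. dim_vec r k) else r i j)"

definition rank_codim :: "nat \<Rightarrow> (nat \<Rightarrow> nat \<Rightarrow> nat) \<Rightarrow> nat" where
  "rank_codim n r =
     (\<Sum>j=0..n. \<Sum>i\<in>{0..<j}. (r i (j - 1) - r i j) * (r (i + 1) j - r i j))"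

definition generic_rank :: "(nat \<Rightarrow> nat) \<Rightarrow> nat \<Rightarrow> nat \<Rightarrow> nat" where
  "generic_rank e i j = Min (e ` {i..j})"

definition W_perm :: "nat \<Rightarrow> (nat \<Rightarrow> nat \<Rightarrow> nat) \<Rightarrow> nat \<Rightarrow> nat \<Rightarrow> nat \<Rightarrow> nat" where
  "W_perm n r i j p =
     (let R = ext_rank n r in
      if R i j < p \<and> p \<le> R (i + 1) j
        then p + (R i (j - 1) - R i j)
      else if R (i + 1) j < p \<and> p \<le> R (i + 1) j + (R i (j - 1) - R i j)
        then (p - R (i + 1) j) + R i j
      else p)"

definition zel_perm :: "nat \<Rightarrow> (nat \<Rightarrow> nat \<Rightarrow> nat) \<Rightarrow> nat \<Rightarrow> nat" where
  "zel_perm n r =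
     perm_prod (concat (map (\<lambda>j. map (\<lambda>i. W_perm n r i j) [0..<n]) [1..<n + 1]))"

definition zel_perm_hat :: "nat \<Rightarrow> (nat \<Rightarrow> nat \<Rightarrow> nat) \<Rightarrow> nat \<Rightarrow> nat" where
  "zel_perm_hat n r =
     (let w0 = longest_perm (total_dim n (dim_vec r)) in w0 \<circ> inv (zel_perm n r) \<circ> w0)"

definition delta_perm :: "nat \<Rightarrow> (nat \<Rightarrow> nat \<Rightarrow> nat) \<Rightarrow> nat \<Rightarrow> nat \<Rightarrow> nat" where
  "delta_perm n r j p =
     (let R = ext_rank n r; e = dim_vec r in
      if p \<le> e j then p
      else if p \<le> R n j then p + e (j - 1)
      else if p \<le> R n (j - 1) then p - R n (j + 1)
      else p)"

text \<open>The tuple \<open>(w\<^sub>1, \<dots>, w\<^sub>n)\<close> is the list \<open>ws\<close>, with \<open>w\<^sub>i\<close> equal to \<open>ws ! (i - 1)\<close>.\<close>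

definition KMS_factorizations :: "nat \<Rightarrow> (nat \<Rightarrow> nat \<Rightarrow> nat) \<Rightarrow> (nat \<Rightarrow> nat) list set" where
  "KMS_factorizations n r =
     {ws. length ws = n \<and>
          (\<forall>i\<in>{1..n}. (ws ! (i - 1)) permutes {1..dim_vec r (i - 1) + dim_vec r i}) \<and>
          abs_hecke_prod
            (concat (map (\<lambda>j. [ws ! (j - 1), delta_perm n r j]) [1..<n]) @ [ws ! (n - 1)])
          = zel_perm n r}"


section \<open>Rational functions and substitution\<close>

text \<open>
  The field of rational functions with integer (equivalently, rational) coefficients in
  indeterminates \<open>X\<^sub>c\<^sub>,\<^sub>p\<close> with \<open>c, p \<in> \<nat>\<close>. The pairs \<open>(c, p)\<close> are encoded as natural numbers,
  since the integral domain instance of \<open>Poly_Mapping\<close> requires linearly ordered indeterminates.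
\<close>

type_synonym mpoly = "(nat \<Rightarrow>\<^sub>0 nat) \<Rightarrow>\<^sub>0 int"
type_synonym ratfun = "mpoly fract"

definition indet :: "nat \<Rightarrow> nat \<Rightarrow> ratfun" where
  "indet c p =
     Fract (Poly_Mapping.single (Poly_Mapping.single (prod_encode (c, p)) 1) 1) 1"

definition poly_subst :: "(nat \<Rightarrow> nat \<Rightarrow> 'k) \<Rightarrow> mpoly \<Rightarrow> 'k::field" where
  "poly_subst \<phi> f =
     (\<Sum>m\<in>Poly_Mapping.keys f. of_int (Poly_Mapping.lookup f m) *
        (\<Prod>v\<in>Poly_Mapping.keys m. case_prod \<phi> (prod_decode v) ^ Poly_Mapping.lookup m v))"

text \<open>
  Substitution of \<open>\<phi> c p\<close> for \<open>X\<^sub>c\<^sub>,\<^sub>p\<close> in a rational function. It is meaningful whenever the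
  function can be written with a denominator that does not vanish under the substitution.
\<close>

definition rat_subst :: "(nat \<Rightarrow> nat \<Rightarrow> 'k) \<Rightarrow> ratfun \<Rightarrow> 'k::field" where
  "rat_subst \<phi> F =
     (THE y. \<exists>f g. F = Fract f g \<and> poly_subst \<phi> g \<noteq> 0 \<and> y = poly_subst \<phi> f / poly_subst \<phi> g)"


section \<open>Grothendieck polynomials\<close>

text \<open>
  The generic Grothendieck polynomials live in the variables \<open>a\<^sub>p = X\<^sub>0\<^sub>,\<^sub>p\<close> and \<open>b\<^sub>p = X\<^sub>1\<^sub>,\<^sub>p\<close>
  with \<open>p \<ge> 1\<close>.
\<close>

abbreviation avar :: "nat \<Rightarrow> ratfun" where "avar p \<equiv> indet 0 p"
abbreviation bvar :: "nat \<Rightarrow> ratfun" where "bvar p \<equiv> indet 1 p"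

definition ab_subst :: "(nat \<Rightarrow> 'k) \<Rightarrow> (nat \<Rightarrow> 'k) \<Rightarrow> ratfun \<Rightarrow> 'k::field" where
  "ab_subst \<alpha> \<beta> = rat_subst (\<lambda>c p. if c = 0 then \<alpha> p else \<beta> p)"

definition is_grothendieck_family :: "nat \<Rightarrow> ((nat \<Rightarrow> nat) \<Rightarrow> ratfun) \<Rightarrow> bool" where
  "is_grothendieck_family N \<GG> \<longleftrightarrow>
     \<GG> (longest_perm N) = (\<Prod>(p, q)\<in>{(p, q). 1 \<le> p \<and> 1 \<le> q \<and> p + q \<le> N}. 1 - bvar p / avar q) \<and>
     (\<forall>w i. w permutes {1..N} \<and> 1 \<le> i \<and> i < N \<and> w i < w (i + 1) \<longrightarrow>
        (let s = transpose i (i + 1) in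
         (avar i - avar (i + 1)) * \<GG> w =
           avar i * \<GG> (w \<circ> s) - avar (i + 1) * ab_subst (\<lambda>p. avar (s p)) bvar (\<GG> (w \<circ> s))))"

text \<open>The family is unique on \<open>S\<^sub>N\<close>, and unconstrained elsewhere.\<close>

definition grothendieck :: "nat \<Rightarrow> (nat \<Rightarrow> nat) \<Rightarrow> ratfun" where
  "grothendieck N w = (THE f. \<exists>\<GG>. is_grothendieck_family N \<GG> \<and> \<GG> w = f)"

text \<open>
  For \<open>w \<in> S\<^sub>N\<close>, the value of the Grothendieck polynomial at lists of \<open>N\<close> arguments each.
\<close>

definition grothendieck_at :: "nat \<Rightarrow> (nat \<Rightarrow> nat) \<Rightarrow> 'k list \<Rightarrow> 'k list \<Rightarrow> 'k::field" where
  "grothendieck_at N w as bs =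
     ab_subst (\<lambda>p. as ! (p - 1)) (\<lambda>p. bs ! (p - 1)) (grothendieck N w)"

text \<open>
  For \<open>w \<in> S\<^sub>k\<close>, so that \<open>1\<^sup>m \<times> w \<in> S\<^sub>m\<^sub>+\<^sub>k\<close>. The value is the same for every
  \<open>m\<close> at least the maximum of \<open>q\<close> and \<open>p\<close>; the least such \<open>m\<close> is used.
\<close>

definition stable_grothendieck :: "nat \<Rightarrow> (nat \<Rightarrow> nat) \<Rightarrow> 'k list \<Rightarrow> 'k list \<Rightarrow> 'k::field" where
  "stable_grothendieck k w as bs =
     (let q = length as; p = length bs; m = max q p in
      grothendieck_at (m + k) (shift_perm m w)
        (as @ replicate (m + k - q) 1) (bs @ replicate (m + k - p) 1))"


section \<open>Variables attached to a dimension vector\<close>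

definition var_block :: "(nat \<Rightarrow> nat) \<Rightarrow> nat \<Rightarrow> ratfun list" where
  "var_block e i = map (\<lambda>j. indet i j) [1..<e i + 1]"

definition all_vars :: "nat \<Rightarrow> (nat \<Rightarrow> nat) \<Rightarrow> ratfun list" where
  "all_vars n e = concat (map (var_block e) [0..<n + 1])"

definition all_vars_rev :: "nat \<Rightarrow> (nat \<Rightarrow> nat) \<Rightarrow> ratfun list" where
  "all_vars_rev n e = concat (map (var_block e) (rev [0..<n + 1]))"

end

theory Submission
  imports Defs
begin

text \<open>
  In the ring spanned by the finite permutations under the Demazure product, with idempotents
  \<open>\<tau>\<^sub>k\<close>, put \<open>h\<^sub>k(c) = 1 + (c - 1) \<tau>\<^sub>k\<close>. By the Yang-Baxter equation
  \<open>\<GG>\<^sub>w\<close> is, up to the sign of \<open>w\<close>, the coefficient at \<open>w\<close> of a triangular word in the elements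
  \<open>h\<^sub>p\<^sub>+\<^sub>q(b\<^sub>p / a\<^sub>q)\<close>, and \<open>G\<^sub>w\<close> comes from a stable word \<open>H\<close> that ignores the fixed initial letters.

  Cut the triangle along the blocks of variables. At \<open>z\<close>-hat of \<open>r\<close> the rank function
  forces a crossing in every box whose two blocks are not adjacent or equal; the triangles of equal
  blocks are trivial; what remains, read backwards, is
  \<open>\<Prod>\<^sub>i G\<^sub>i \<delta>\<^sub>i\<^sub>+\<^sub>1\<close> with one rectangle \<open>G\<^sub>i\<close> for each pair of adjacent blocks,
  times a product of the factors \<open>b\<^sub>p / a\<^sub>q - 1\<close> that depends on \<open>e\<close> only.
  Each \<open>H\<^sub>i\<close> is \<open>G\<^sub>i\<close> times outer factors. In \<open>\<Prod>\<^sub>i H\<^sub>i \<delta>\<^sub>i\<^sub>+\<^sub>1\<close> these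
  cancel or move to the two ends, where they do not affect the coefficient at \<open>z(r)\<close>, since
  \<open>z(r)\<close> and its inverse increase on the blocks. Expanding every \<open>H\<^sub>i\<close> gives the sum over the
  KMS-factorizations. For generic ranks \<open>z(e) = \<delta>\<^sub>1 \<cdots> \<delta>\<^sub>n\<^sub>-\<^sub>1\<close>, and comparing
  rank functions shows that the only KMS-factorization is the trivial one.
\<close>

subsection \<open>Reduced words and the Demazure product\<close>

text \<open>Exchanging two neighbouring variables multiplies the triangular word by a single letter.
  Read at a descent, this is the recursion for Grothendieck polynomials, which is why they are
  coefficients of the word. A letter with scalar part 1 is invisible at a permutation that ascends
  at its place; stabilization and the removal of outer factors both rest on this. A crossing is
  forced for Bruhat reasons: a box without a crossing keeps an entry of the rank function positive
  where that of z-hat is 0. The set of forced boxes, their scalars and one part of the sign depend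
  on e only and cancel in the quotient. What depends on r is the permutation at which the
  coefficient is taken, together with the parity d(r). The main obstacle is that the staircase
  yields rectangles of crossings with staggered rows, whereas stable polynomials come from rows that
  all start at the same letter. The difference consists of outer triangles, and the two triangles in
  the same variables are mutually inverse. Words are read backwards because z-hat is conjugate to
  the inverse of z(r); this also reverses every block of variables, which the symmetry of the stable
  words repairs.\<close>

text \<open>The letter \<open>k\<close> stands for \<open>s\<^sub>k\<^sub>+\<^sub>1\<close>.\<close>

definition adj :: "nat \<Rightarrow> nat \<Rightarrow> nat" where
  "adj k = transpose (Suc k) (Suc (Suc k))"

lemma adj_simps [simp]:
  "adj k (Suc k) = Suc (Suc k)" "adj k (Suc (Suc k)) = Suc k"
  by (simp_all add: adj_def)

lemma adj_other [simp]: "p \<noteq> Suc k \<Longrightarrow> p \<noteq> Suc (Suc k) \<Longrightarrow> adj k p = p"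
  by (simp add: adj_def)

lemma adj_apply: "adj k p = (if p = Suc k then Suc (Suc k) else if p = Suc (Suc k) then Suc k else p)"
  by simp

lemma adj_invol [simp]: "adj k (adj k p) = p" "adj k \<circ> adj k = id"
  by (simp_all add: adj_def)

lemma comp_adj_adj [simp]: "w \<circ> adj k \<circ> adj k = w"
  by (simp add: comp_assoc)

lemma adj_permutes: "Suc k < m \<Longrightarrow> adj k permutes {1..m}"
  by (simp add: adj_def permutes_swap_id)

lemma inv_adj [simp]: "inv (adj k) = adj k"
  by (simp add: adj_def)

lemma bij_adj [simp]: "bij (adj k)" "inj (adj k)"
  by (simp_all add: adj_def)

lemma finite_perm_adj [simp]: "finite_perm (adj k)"
  unfolding finite_perm_def using adj_permutes[of k "Suc (Suc k)"] by blast

lemma permutes_interval_mono: "w permutes {1..m} \<Longrightarrow> m \<le> m' \<Longrightarrow> w permutes {1..m'::nat}"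
  by (erule permutes_subset) auto

lemma finite_perm_comp: assumes "finite_perm u" "finite_perm v" shows "finite_perm (u \<circ> v)"
proof -
  obtain a b where "u permutes {1..a}" "v permutes {1..b}"
    using assms by (auto simp: finite_perm_def)
  then have "u permutes {1..max a b}" "v permutes {1..max a b}"
    using permutes_interval_mono by (meson max.cobounded1 max.cobounded2)+
  then show ?thesis unfolding finite_perm_def using permutes_compose by blast
qed

lemma finite_perm_id [simp]: "finite_perm id"
  by (auto simp: finite_perm_def)

lemma finite_perm_inv: "finite_perm w \<Longrightarrow> finite_perm (inv w)"
  unfolding finite_perm_def using permutes_inv by blast

lemma finite_perm_bij: "finite_perm w \<Longrightarrow> bij w"
  unfolding finite_perm_def using permutes_bij by blast

lemma finite_perm_inj: "finite_perm w \<Longrightarrow> inj w"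
  using finite_perm_bij bij_is_inj by blast

lemma finite_perm_comp_adj_iff [simp]: "finite_perm (w \<circ> adj k) \<longleftrightarrow> finite_perm w"
  using finite_perm_comp[OF _ finite_perm_adj, of w k] finite_perm_comp[OF _ finite_perm_adj, of "w \<circ> adj k" k]
  by auto

lemma inversions_finite: assumes "finite_perm w" shows "finite {(p, q). p < q \<and> w q < w p}"
proof -
  obtain m where m: "w permutes {1..m}" using assms by (auto simp: finite_perm_def)
  have *: "q \<le> m" if "p < q" "w q < w p" for p q
  proof (rule ccontr)
    assume "\<not> q \<le> m"
    then have "w q = q" using m by (auto simp: permutes_def)
    have "w p \<le> max p m"
      using m permutes_in_image[OF m, of p] permutes_not_in[OF m, of p] by (cases "p \<in> {1..m}") auto
    then show False using that \<open>w q = q\<close> \<open>\<not> q \<le> m\<close> by auto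
  qed
  have "{(p, q). p < q \<and> w q < w p} \<subseteq> {..m} \<times> {..m}"
    using * by force
  then show ?thesis using finite_subset by blast
qed

text \<open>Applying s_k to both entries of a pair carries inversions to inversions, and (k + 1, k +
  2) is the only new one.\<close>

lemma perm_length_ascent:
  assumes "finite_perm w" "w (Suc k) < w (Suc (Suc k))"
  shows "perm_length (w \<circ> adj k) = Suc (perm_length w)"
proof -
  let ?I = "\<lambda>w. {(p, q). p < q \<and> (w::nat\<Rightarrow>nat) q < w p}"
  let ?f = "map_prod (adj k) (adj k)"
  have "?I (w \<circ> adj k) = insert (Suc k, Suc (Suc k)) (?f ` ?I w)"
  proof (intro equalityI subsetI)
    fix x assume "x \<in> ?I (w \<circ> adj k)"
    then obtain p q where x: "x = (p, q)" "p < q" "w (adj k q) < w (adj k p)" by auto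
    show "x \<in> insert (Suc k, Suc (Suc k)) (?f ` ?I w)"
    proof (cases "x = (Suc k, Suc (Suc k))")
      case False
      then have "adj k p < adj k q" using x by (auto simp: adj_apply)
      then have "(adj k p, adj k q) \<in> ?I w" using x by auto
      moreover have "x = ?f (adj k p, adj k q)" using x by simp
      ultimately show ?thesis by blast
    qed auto
  next
    fix x assume "x \<in> insert (Suc k, Suc (Suc k)) (?f ` ?I w)"
    then consider "x = (Suc k, Suc (Suc k))" | p q where "x = (adj k p, adj k q)" "p < q" "w q < w p" by auto
    then show "x \<in> ?I (w \<circ> adj k)"
    proof cases
      case 1 then show ?thesis using assms by auto
    next
      case 2
      then have "\<not> (p = Suc k \<and> q = Suc (Suc k))" using assms by auto
      then have "adj k p < adj k q" using 2 by (auto simp: adj_apply)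
      then show ?thesis using 2 by auto
    qed
  qed
  moreover have "(Suc k, Suc (Suc k)) \<notin> ?f ` ?I w"
  proof
    assume "(Suc k, Suc (Suc k)) \<in> ?f ` ?I w"
    then obtain p q where "Suc k = adj k p" "Suc (Suc k) = adj k q" "p < q" by auto
    then have "p = adj k (Suc k)" "q = adj k (Suc (Suc k))" "p < q" by (metis adj_invol(1))+
    then show False by simp
  qed
  moreover have "card (?f ` ?I w) = card (?I w)"
    by (intro card_image inj_onI) (auto dest: arg_cong[where f="adj k"], (metis adj_invol(1))+)
  ultimately show ?thesis
    using inversions_finite[OF assms(1)] by (simp add: perm_length_def)
qed

lemma perm_length_descent:
  assumes "finite_perm w" "w (Suc (Suc k)) < w (Suc k)"
  shows "perm_length w = Suc (perm_length (w \<circ> adj k))"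
  using perm_length_ascent[of "w \<circ> adj k" k] assms by simp

lemma finite_perm_neq: "finite_perm w \<Longrightarrow> w p = w q \<longleftrightarrow> p = q"
  using finite_perm_inj inj_eq by metis

lemma perm_length_id [simp]: "perm_length id = 0"
  by (simp add: perm_length_def) (metis (mono_tags, lifting) card.empty empty_Collect_eq case_prod_conv not_less_iff_gr_or_eq surj_pair)

lemma finite_perm_0: "finite_perm w \<Longrightarrow> w 0 = 0"
  unfolding finite_perm_def by (auto intro: permutes_not_in)

text \<open>A strictly increasing map lies above the identity, and so does its inverse. The fixed
  point 0 supplies the comparison of positions 0 and 1.\<close>

lemma no_descent_id:
  assumes "finite_perm w" "\<And>k. w (Suc k) < w (Suc (Suc k))"
  shows "w = id"
proof -
  have s: "strict_mono w"
    unfolding strict_mono_Suc_iff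
  proof
    fix p show "w p < w (Suc p)"
    proof (cases p)
      case 0
      then show ?thesis
        using finite_perm_neq[OF assms(1), of 0 1] finite_perm_0[OF assms(1)] by auto
    qed (use assms in auto)
  qed
  have "inv w (w p) = p" for p using finite_perm_inj[OF assms(1)] by simp
  moreover have "strict_mono (inv w)"
    by (metis finite_perm_bij[OF assms(1)] s strict_monoI strict_mono_less bij_inv_eq_iff)
  ultimately show ?thesis
    using strict_mono_imp_increasing[OF s] strict_mono_imp_increasing[of "inv w"]
    by (intro ext) (metis id_apply le_antisym)
qed

lemma ex_descent: assumes "finite_perm w" "w \<noteq> id" obtains k where "w (Suc (Suc k)) < w (Suc k)"
  using no_descent_id[OF assms(1)] assms by (metis finite_perm_neq n_not_Suc_n nat_neq_iff)

section \<open>Words and reduced words\<close>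

definition wprod :: "nat list \<Rightarrow> nat \<Rightarrow> nat" where
  "wprod ks = perm_prod (map adj ks)"

lemma wprod_simps [simp]: "wprod [] = id" "wprod (k # ks) = adj k \<circ> wprod ks"
  "wprod (ks @ ls) = wprod ks \<circ> wprod ls"
proof -
  show "wprod [] = id" "wprod (k # ks) = adj k \<circ> wprod ks" for k ks
    by (simp_all add: wprod_def perm_prod_def)
  then show "wprod (ks @ ls) = wprod ks \<circ> wprod ls" by (induction ks) (auto simp: comp_assoc)
qed

lemma finite_perm_wprod [simp]: "finite_perm (wprod ks)"
proof (induction ks)
  case Nil
  show "finite_perm (wprod [])" by simp
next
  case (Cons k ks)
  then show "finite_perm (wprod (k # ks))" using finite_perm_comp by simp
qed

lemma inv_wprod: "inv (wprod ks) = wprod (rev ks)"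
proof (induction ks)
  case (Cons k ks)
  then show "inv (wprod (k # ks)) = wprod (rev (k # ks))"
    using o_inv_distrib[OF bij_adj(1) finite_perm_bij[OF finite_perm_wprod]] by simp
next
  case Nil
  show "inv (wprod []) = wprod (rev [])" by simp
qed

lemma perm_length_wprod_le: "perm_length (wprod ks) \<le> length ks"
proof (induction ks rule: rev_induct)
  case (snoc k ks)
  have "perm_length (wprod ks \<circ> adj k) \<le> Suc (perm_length (wprod ks))"
    using perm_length_ascent[of "wprod ks" k] perm_length_descent[of "wprod ks" k]
    by (metis Suc_n_not_le_n finite_perm_neq finite_perm_wprod le_SucI le_refl linorder_neqE_nat n_not_Suc_n nat_le_linear)
  then show "perm_length (wprod (ks @ [k])) \<le> length (ks @ [k])" using snoc by simp
next
  case Nil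
  show "perm_length (wprod []) \<le> length []" by simp
qed

definition redword :: "nat list \<Rightarrow> (nat \<Rightarrow> nat) \<Rightarrow> bool" where
  "redword ks w \<longleftrightarrow> wprod ks = w \<and> length ks = perm_length w"

text \<open>A letter changes the length by exactly one, and no word is shorter than the length of
  its product; so a reduced word ends in k only at a descent. Most inductions over words remove the
  last letter in this way.\<close>

lemma redword_snoc_iff:
  "redword (ks @ [k]) w \<longleftrightarrow> redword ks (w \<circ> adj k) \<and> w (Suc (Suc k)) < w (Suc k)"
proof
  assume a: "redword (ks @ [k]) w"
  then have w: "wprod ks \<circ> adj k = w" "Suc (length ks) = perm_length w" by (auto simp: redword_def)
  have p: "wprod ks = w \<circ> adj k" using w by (metis comp_adj_adj)
  have fw: "finite_perm w" using w by auto
  show "redword ks (w \<circ> adj k) \<and> w (Suc (Suc k)) < w (Suc k)"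
  proof (cases "w (Suc (Suc k)) < w (Suc k)")
    case True
    then show ?thesis using perm_length_descent[OF fw True] w p by (auto simp: redword_def)
  next
    case False
    then have "w (Suc k) < w (Suc (Suc k))" using finite_perm_neq[OF fw] by (metis n_not_Suc_n linorder_neqE_nat)
    then show ?thesis using perm_length_ascent[OF fw] perm_length_wprod_le[of ks] w p by simp
  qed
next
  assume a: "redword ks (w \<circ> adj k) \<and> w (Suc (Suc k)) < w (Suc k)"
  then have "finite_perm (w \<circ> adj k)" by (metis finite_perm_wprod redword_def)
  then have "finite_perm w" by simp
  then show "redword (ks @ [k]) w" using a perm_length_descent[of w k] by (auto simp: redword_def)
qed

lemma redword_exists: "finite_perm w \<Longrightarrow> \<exists>ks. redword ks w"
proof (induction "perm_length w" arbitrary: w rule: less_induct)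
  case less
  show ?case
  proof (cases "w = id")
    case True
    then show ?thesis by (intro exI[of _ "[]"]) (simp add: redword_def)
  next
    case False
    then obtain k where k: "w (Suc (Suc k)) < w (Suc k)" using ex_descent less by blast
    then obtain ks where "redword ks (w \<circ> adj k)"
      using less perm_length_descent[OF less.prems k] by fastforce
    then show ?thesis using k redword_snoc_iff by blast
  qed
qed

lemma redword_finite_perm: "redword ks w \<Longrightarrow> finite_perm w"
  by (auto simp: redword_def)

lemma perm_length_0_iff: "finite_perm w \<Longrightarrow> perm_length w = 0 \<longleftrightarrow> w = id"
  using redword_exists[of w] by (auto simp: redword_def)



section \<open>The Demazure action and the relations between words\<close>

definition dstep :: "(nat \<Rightarrow> nat) \<Rightarrow> nat \<Rightarrow> nat \<Rightarrow> nat" where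
  "dstep w k = (if w (Suc k) < w (Suc (Suc k)) then w \<circ> adj k else w)"

definition act :: "nat list \<Rightarrow> (nat \<Rightarrow> nat) \<Rightarrow> nat \<Rightarrow> nat" where
  "act ks w = foldl dstep w ks"

abbreviation dem :: "nat list \<Rightarrow> nat \<Rightarrow> nat" where
  "dem ks \<equiv> act ks id"

lemma act_simps [simp]: "act [] w = w" "act (k # ks) w = act ks (dstep w k)"
  "act (ks @ ls) w = act ls (act ks w)"
  by (simp_all add: act_def)

lemma finite_perm_dstep: "finite_perm w \<Longrightarrow> finite_perm (dstep w k)"
  by (simp add: dstep_def)

lemma finite_perm_act: "finite_perm w \<Longrightarrow> finite_perm (act ks w)"
  by (induction ks arbitrary: w) (auto intro: finite_perm_dstep)

lemma dstep_idem: "dstep (dstep w k) k = dstep w k"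
  by (auto simp: dstep_def)

lemma adj_comm: "k + 2 \<le> l \<Longrightarrow> adj k \<circ> adj l = adj l \<circ> adj k"
  by (auto simp: adj_apply fun_eq_iff)

lemma adj_braid: "adj k \<circ> adj (Suc k) \<circ> adj k = adj (Suc k) \<circ> adj k \<circ> adj (Suc k)"
  by (auto simp: adj_apply fun_eq_iff)

lemma dstep_comm: "k + 2 \<le> l \<Longrightarrow> dstep (dstep w k) l = dstep (dstep w l) k"
  using adj_comm[of k l] by (auto simp: dstep_def fun_eq_iff)

lemma dstep_braid: "dstep (dstep (dstep w k) (Suc k)) k = dstep (dstep (dstep w (Suc k)) k) (Suc k)"
  using adj_braid[of k] by (auto simp: dstep_def comp_assoc fun_eq_iff adj_apply)

text \<open>The congruence of the 0-Hecke monoid. It transports facts about reduced words to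
  arbitrary words.\<close>

inductive weq :: "nat list \<Rightarrow> nat list \<Rightarrow> bool" where
  weq_refl: "weq ks ks"
| weq_sym: "weq ks ls \<Longrightarrow> weq ls ks"
| weq_trans: "weq ks ls \<Longrightarrow> weq ls ms \<Longrightarrow> weq ks ms"
| weq_ctx: "weq ks ls \<Longrightarrow> weq (as @ ks @ bs) (as @ ls @ bs)"
| weq_idem: "weq [k, k] [k]"
| weq_comm: "k + 2 \<le> l \<Longrightarrow> weq [k, l] [l, k]"
| weq_braid: "weq [k, Suc k, k] [Suc k, k, Suc k]"

lemma weq_act: "weq ks ls \<Longrightarrow> act ks w = act ls w"
proof (induction arbitrary: w rule: weq.induct)
  case (weq_comm k l)
  then show ?case using dstep_comm by simp
qed (simp_all add: dstep_idem dstep_braid)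

lemma weq_append: "weq ks ks' \<Longrightarrow> weq ls ls' \<Longrightarrow> weq (ks @ ls) (ks' @ ls')"
  using weq_ctx[of ks ks' "[]" ls] weq_ctx[of ls ls' ks' "[]"] weq_trans by fastforce

text \<open>Reversal turns each defining relation into itself or its converse.\<close>

lemma weq_rev: "weq ks ls \<Longrightarrow> weq (rev ks) (rev ls)"
proof (induction rule: weq.induct)
  case (weq_comm k l)
  then show ?case using weq_sym[OF weq.weq_comm] by simp
qed (auto simp: weq_refl weq_idem weq_braid weq_ctx intro: weq_sym weq_trans)

lemma dem_redword: "redword ks w \<Longrightarrow> dem ks = w"
proof (induction ks arbitrary: w rule: rev_induct)
  case Nil then show ?case by (simp add: redword_def)
next
  case (snoc k ks)
  then have "dem ks = w \<circ> adj k" "w (Suc (Suc k)) < w (Suc k)" unfolding redword_snoc_iff by blast+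
  then show "dem (ks @ [k]) = w" by (simp add: dstep_def)
qed

text \<open>Matsumoto's theorem. If two reduced words of w end in k and l, both letters are descents
  of w; hence w has reduced words ending in either expression of the longest element of the subgroup
  generated by s_k and s_l. One relation links these two, and induction links them to the given
  words.\<close>

lemma matsumoto: "redword ks w \<Longrightarrow> redword ls w \<Longrightarrow> weq ks ls"
proof (induction "perm_length w" arbitrary: ks ls w rule: less_induct)
  case less
  have fw: "finite_perm w" using less redword_finite_perm by blast
  show ?case
  proof (cases "w = id")
    case True
    then show ?thesis using less by (auto simp: redword_def weq_refl)
  next
    case False
    then have "ks \<noteq> []" "ls \<noteq> []" using less perm_length_0_iff[OF fw] by (auto simp: redword_def)
    then obtain ks' ls' k l where kl: "ks = ks' @ [k]" "ls = ls' @ [l]" by (metis rev_exhaust)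
    then have r: "redword ks' (w \<circ> adj k)" "w (Suc (Suc k)) < w (Suc k)"
      "redword ls' (w \<circ> adj l)" "w (Suc (Suc l)) < w (Suc l)" using less by (auto simp: redword_snoc_iff)
    \<comment> \<open>The variables are bound anew because the fact is also applied with the two
      words exchanged.\<close>
    have far: "weq (ks' @ [k]) (ls' @ [l])"
      if "k + 2 \<le> l" and r: "redword ks' (w \<circ> adj k)" "w (Suc (Suc k)) < w (Suc k)"
      "redword ls' (w \<circ> adj l)" "w (Suc (Suc l)) < w (Suc l)" for k l ks' ls'
    proof -
      have s: "perm_length (w \<circ> adj k) < perm_length w" "perm_length (w \<circ> adj l) < perm_length w"
        using perm_length_descent[OF fw] r by (metis lessI)+
      obtain us where us: "redword us (w \<circ> adj k \<circ> adj l)"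
        using redword_exists[of "w \<circ> adj k \<circ> adj l"] fw by auto
      have "redword (us @ [l]) (w \<circ> adj k)" using us r that by (auto simp: redword_snoc_iff)
      then have 1: "weq ks' (us @ [l])" using less.hyps[OF s(1) r(1)] by blast
      have "redword (us @ [k]) (w \<circ> adj l)" using us r that adj_comm[OF that(1)] by (auto simp: redword_snoc_iff comp_assoc)
      then have 2: "weq ls' (us @ [k])" using less.hyps[OF s(2) r(3)] by blast
      have "weq (ks' @ [k]) (us @ [l, k])" using weq_append[OF 1 weq_refl[of "[k]"]] by simp
      moreover have "weq (us @ [l, k]) (us @ [k, l])" using weq_append[OF weq_refl weq_sym[OF weq_comm[OF that(1)]]] .
      moreover have "weq (us @ [k, l]) (ls' @ [l])" using weq_append[OF weq_sym[OF 2] weq_refl[of "[l]"]] by simp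
      ultimately show ?thesis using weq_trans by blast
    qed
    have near: "weq (ks' @ [k]) (ls' @ [l])"
      if "l = Suc k" and r: "redword ks' (w \<circ> adj k)" "w (Suc (Suc k)) < w (Suc k)"
      "redword ls' (w \<circ> adj l)" "w (Suc (Suc l)) < w (Suc l)" for k l ks' ls'
    proof -
      have s: "perm_length (w \<circ> adj k) < perm_length w" "perm_length (w \<circ> adj l) < perm_length w"
        using perm_length_descent[OF fw] r by (metis lessI)+
      obtain us where us: "redword us (w \<circ> adj k \<circ> adj l \<circ> adj k)"
        using redword_exists[of "w \<circ> adj k \<circ> adj l \<circ> adj k"] fw by auto
      have "redword (us @ [k, l]) (w \<circ> adj k)"
        using us r that redword_snoc_iff[of "us @ [k]" l] redword_snoc_iff[of us k] by simp
      then have 1: "weq ks' (us @ [k, l])" using less.hyps[OF s(1) r(1)] by blast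
      have "w \<circ> adj k \<circ> adj l \<circ> adj k = w \<circ> adj l \<circ> adj k \<circ> adj l"
        using adj_braid[of k] that by (simp add: comp_assoc)
      then have "redword (us @ [l, k]) (w \<circ> adj l)"
        using us r that redword_snoc_iff[of "us @ [l]" k] redword_snoc_iff[of us l] by simp
      then have 2: "weq ls' (us @ [l, k])" using less.hyps[OF s(2) r(3)] by blast
      have "weq (ks' @ [k]) (us @ [k, l, k])" using weq_append[OF 1 weq_refl[of "[k]"]] by simp
      moreover have "weq (us @ [k, l, k]) (us @ [l, k, l])" using weq_append[OF weq_refl weq_braid] that by blast
      moreover have "weq (us @ [l, k, l]) (ls' @ [l])" using weq_append[OF weq_sym[OF 2] weq_refl[of "[l]"]] by simp
      ultimately show ?thesis using weq_trans by blast
    qed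
    consider "k = l" | "k + 2 \<le> l" | "l + 2 \<le> k" | "l = Suc k" | "k = Suc l" by linarith
    then show ?thesis
    proof cases
      case 1
      then have "weq ks' ls'" using less.hyps[OF _ r(1)] r perm_length_descent[OF fw r(2)] by simp
      then show ?thesis using kl 1 weq_append[OF _ weq_refl] by blast
    next
      case 2 then show ?thesis using far r kl by blast
    next
      case 3 then show ?thesis using far r kl weq_sym by blast
    next
      case 4 then show ?thesis using near r kl by blast
    next
      case 5 then show ?thesis using near r kl weq_sym by blast
    qed
  qed
qed

definition rw :: "(nat \<Rightarrow> nat) \<Rightarrow> nat list" where
  "rw w = (SOME ks. redword ks w)"

lemma redword_rw: "finite_perm w \<Longrightarrow> redword (rw w) w"
  unfolding rw_def using redword_exists by (rule someI_ex)

text \<open>Every word can be reduced by the relations to a reduced word of its Demazure product, so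
  this product is a complete invariant of the congruence.\<close>

lemma weq_rw: "weq ks (rw (dem ks))"
proof (induction ks rule: rev_induct)
  case Nil
  have "redword [] id" by (simp add: redword_def)
  then show "weq [] (rw (dem []))" using matsumoto redword_rw[of id] by simp
next
  case (snoc k ks)
  let ?w = "dem ks"
  have fw: "finite_perm ?w" by (simp add: finite_perm_act)
  have 1: "weq (ks @ [k]) (rw ?w @ [k])" using weq_append[OF snoc weq_refl] .
  show "weq (ks @ [k]) (rw (dem (ks @ [k])))"
  proof (cases "?w (Suc k) < ?w (Suc (Suc k))")
    case True
    then have "redword (rw ?w @ [k]) (?w \<circ> adj k)" using redword_rw[OF fw] by (simp add: redword_snoc_iff)
    then have 2: "weq (rw ?w @ [k]) (rw (?w \<circ> adj k))" using matsumoto redword_rw redword_finite_perm by blast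
    have "weq (ks @ [k]) (rw (?w \<circ> adj k))" by (rule weq_trans[OF 1 2])
    moreover have "dstep ?w k = ?w \<circ> adj k" using True by (simp add: dstep_def)
    ultimately show ?thesis by simp
  next
    case False
    \<comment> \<open>At a descent the product has a reduced word that already ends in k, and
      idempotence absorbs the additional letter.\<close>
    then have d: "?w (Suc (Suc k)) < ?w (Suc k)" using finite_perm_neq[OF fw] by (metis n_not_Suc_n linorder_neqE_nat)
    obtain us where "redword us (?w \<circ> adj k)" using fw redword_exists by (metis finite_perm_comp_adj_iff)
    then have us: "redword (us @ [k]) ?w" using d redword_snoc_iff by blast
    then have 2: "weq (us @ [k]) (rw ?w)" using matsumoto redword_rw[OF fw] by blast
    have 3: "weq (rw ?w @ [k]) ((us @ [k]) @ [k])" using weq_append[OF weq_sym[OF 2] weq_refl] .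
    have 4: "weq ((us @ [k]) @ [k]) (us @ [k])" using weq_append[OF weq_refl[of us] weq_idem] by simp
    have "weq (ks @ [k]) (rw ?w)"
      by (rule weq_trans[OF 1 weq_trans[OF 3 weq_trans[OF 4 2]]])
    moreover have "dstep ?w k = ?w" using d by (simp add: dstep_def)
    ultimately show ?thesis by simp
  qed
qed

lemma dem_eq_weq: "dem ks = dem ls \<longleftrightarrow> weq ks ls"
proof
  assume "dem ks = dem ls"
  then have "weq (rw (dem ks)) ls" using weq_sym[OF weq_rw[of ls]] by simp
  then show "weq ks ls" by (rule weq_trans[OF weq_rw])
qed (rule weq_act)

lemma dem_rw: "finite_perm w \<Longrightarrow> dem (rw w) = w"
  using dem_redword redword_rw by blast

text \<open>Inversion preserves length, so the reversal of a reduced word is reduced. Any other word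
  is first reduced, and the relations used are reversed along with it.\<close>

lemma dem_rev: "dem (rev ks) = inv (dem ks)"
proof -
  have r: "redword (rw (dem ks)) (dem ks)" by (intro redword_rw) (simp add: finite_perm_act)
  have le: "perm_length (inv w) \<le> perm_length w" if "finite_perm w" for w
    using redword_rw[OF that] perm_length_wprod_le[of "rev (rw w)"] by (auto simp: redword_def inv_wprod[symmetric])
  have l: "perm_length (inv w) = perm_length w" if "finite_perm w" for w
    using le[OF that] le[OF finite_perm_inv[OF that]] finite_perm_bij[OF that] by (simp add: inv_inv_eq)
  have "redword (rev (rw (dem ks))) (inv (dem ks))"
    using r l[OF redword_finite_perm[OF r]] by (auto simp: redword_def inv_wprod[symmetric])
  then have "dem (rev (rw (dem ks))) = inv (dem ks)" by (rule dem_redword)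
  moreover have "weq (rev ks) (rev (rw (dem ks)))" using weq_rev weq_rw by blast
  ultimately show ?thesis using weq_act by metis
qed

section \<open>The Demazure monoid\<close>

typedef hperm = "{w. finite_perm w}" morphisms of_hperm to_hperm
  by (rule exI[of _ id]) simp

lemma finite_perm_of_hperm [simp]: "finite_perm (of_hperm u)"
  using of_hperm[of u] by simp

lemma of_to_hperm [simp]: "finite_perm w \<Longrightarrow> of_hperm (to_hperm w) = w"
  by (simp add: to_hperm_inverse)

lemma to_of_hperm [simp]: "to_hperm (of_hperm u) = u"
  by (rule of_hperm_inverse)

lemma to_hperm_eq_iff: "finite_perm v \<Longrightarrow> finite_perm w \<Longrightarrow> to_hperm v = to_hperm w \<longleftrightarrow> v = w"
  by (metis of_to_hperm)

lemma act_rw_dem: "act (rw (dem ks)) w = act ks w"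
  using weq_act[OF weq_rw[of ks], of w] by simp

text \<open>The Demazure product, written additively so that \<open>Poly_Mapping\<close> provides its monoid ring, the
  degenerate Hecke algebra with generators \<open>-s\<^sub>i\<close>.\<close>

instantiation hperm :: monoid_add
begin

definition zero_hperm :: hperm where "0 = to_hperm id"

definition plus_hperm :: "hperm \<Rightarrow> hperm \<Rightarrow> hperm" where
  "u + v = to_hperm (act (rw (of_hperm v)) (of_hperm u))"

instance
proof
  fix u v w :: hperm
  have p: "of_hperm (u + v) = dem (rw (of_hperm u) @ rw (of_hperm v))" for u v
    by (simp add: plus_hperm_def finite_perm_act dem_rw)
  have "act (rw (of_hperm (v + w))) (of_hperm u) = act (rw (of_hperm v) @ rw (of_hperm w)) (of_hperm u)"
    unfolding p by (rule act_rw_dem)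
  then show "(u + v) + w = u + (v + w)"
    unfolding plus_hperm_def[of "u + v" w] plus_hperm_def[of u "v + w"]
    by (simp add: plus_hperm_def[of u v] finite_perm_act)
  have "rw id = []" using redword_rw[of id] by (simp add: redword_def)
  then show "u + 0 = u" by (simp add: plus_hperm_def zero_hperm_def)
  show "0 + u = u" by (simp add: plus_hperm_def zero_hperm_def dem_rw)
qed

end

definition tau :: "nat \<Rightarrow> hperm" where
  "tau k = to_hperm (adj k)"

lemma of_hperm_0 [simp]: "of_hperm 0 = id"
  by (simp add: zero_hperm_def)

lemma of_hperm_add: "of_hperm (u + v) = act (rw (of_hperm v)) (of_hperm u)"
  by (simp add: plus_hperm_def finite_perm_act)

lemma add_to_hperm_dem: "u + to_hperm (dem ks) = to_hperm (act ks (of_hperm u))"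
  by (simp add: plus_hperm_def finite_perm_act act_rw_dem)

lemma dem_single: "dem [k] = adj k"
  by (simp add: dstep_def)

lemma add_tau: "u + tau k = to_hperm (dstep (of_hperm u) k)"
  using add_to_hperm_dem[of u "[k]"] by (simp add: dem_single tau_def del: act_simps) simp

text \<open>Left multiplication is right multiplication seen through inversion, since reversing a
  word inverts its Demazure product.\<close>

lemma tau_add: "tau k + u = to_hperm (inv (dstep (inv (of_hperm u)) k))"
proof -
  let ?r = "rw (of_hperm u)"
  have "tau k + u = to_hperm (act ?r (adj k))"
    by (simp add: plus_hperm_def tau_def)
  also have "act ?r (adj k) = dem (k # ?r)"
    using dem_single[of k] by simp
  also have "\<dots> = dem (rev (rev ?r @ [k]))" by simp
  also have "\<dots> = inv (dem (rev ?r @ [k]))" by (rule dem_rev)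
  also have "dem (rev ?r @ [k]) = dstep (inv (of_hperm u)) k"
    using dem_rev[of ?r] by (simp add: dem_rw)
  finally show ?thesis .
qed

lemma tau_idem: "tau k + tau k = tau k"
  using add_tau[of "tau k" k] by (simp add: tau_def dstep_def)

lemma tau_word: "sum_list (map tau ks) = to_hperm (dem ks)"
proof (induction ks rule: rev_induct)
  case Nil
  show "sum_list (map tau []) = to_hperm (dem [])" by (simp add: zero_hperm_def)
next
  case (snoc k ks)
  have "sum_list (map tau ks) = to_hperm (dem ks)" by (rule snoc)
  then show "sum_list (map tau (ks @ [k])) = to_hperm (dem (ks @ [k]))"
    using add_tau[of "to_hperm (dem ks)" k] finite_perm_act[of id ks] by simp
qed

lemma tau_comm: assumes "k + 2 \<le> l" shows "tau k + tau l = tau l + tau k"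
proof -
  have "dem [k, l] = dem [l, k]" by (rule weq_act) (rule weq_comm[OF assms])
  then show ?thesis using tau_word[of "[k, l]"] tau_word[of "[l, k]"] by (simp del: act_simps)
qed

lemma tau_braid: "tau k + tau (Suc k) + tau k = tau (Suc k) + tau k + tau (Suc k)"
proof -
  have "dem [k, Suc k, k] = dem [Suc k, k, Suc k]" by (rule weq_act) (rule weq_braid)
  then show ?thesis using tau_word[of "[k, Suc k, k]"] tau_word[of "[Suc k, k, Suc k]"]
    by (simp del: act_simps add: add.assoc)
qed

section \<open>Words in the monoid ring\<close>

type_synonym 'k hecke = "hperm \<Rightarrow>\<^sub>0 'k"

abbreviation const :: "'k \<Rightarrow> ('k::field) hecke" where "const c \<equiv> Poly_Mapping.single 0 c"

text \<open>Both coefficients are kept free: a forced crossing has scalar part 0, and a box without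
  crossing has coefficient 0 at \<open>tau k\<close>.\<close>

definition lett :: "nat \<times> 'k \<times> 'k \<Rightarrow> ('k::field) hecke" where
  "lett = (\<lambda>(k, a, b). const a + Poly_Mapping.single (tau k) b)"

definition gprod :: "(nat \<times> 'k \<times> 'k) list \<Rightarrow> ('k::field) hecke" where
  "gprod L = prod_list (map lett L)"

lemma gprod_simps [simp]: "gprod [] = 1" "gprod (x # L) = lett x * gprod L"
  "gprod (L @ M) = gprod L * gprod M"
  by (simp_all add: gprod_def)

lemma gprod_concat: "gprod (concat (map f xs)) = prod_list (map (\<lambda>x. gprod (f x)) xs)"
  by (induction xs) auto

lemma poly_mapping_add_induct [case_names zero single add]:
  assumes "P 0" "\<And>k c. P (Poly_Mapping.single k c)" "\<And>f g. P f \<Longrightarrow> P g \<Longrightarrow> P (f + g)"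
  shows "P (f :: 'a \<Rightarrow>\<^sub>0 'b::comm_monoid_add)"
proof (induction f rule: Poly_Mapping.update_induct)
  case (update f a b)
  then have "Poly_Mapping.update a b f = f + Poly_Mapping.single a b"
    by (intro poly_mapping_eqI) (auto simp: lookup_update lookup_add lookup_single in_keys_iff when_def)
  then show ?case using assms update by simp
qed (rule assms)

lemma const_mult_commute: "const c * f = f * const c"
  by (induction f rule: poly_mapping_add_induct)
    (auto simp: mult_single algebra_simps)

lemma lookup_const_mult: "Poly_Mapping.lookup (const c * f) w = c * Poly_Mapping.lookup f w"
  by (induction f rule: poly_mapping_add_induct)
    (auto simp: mult_single algebra_simps lookup_add lookup_single when_def)

subsection \<open>Yang-Baxter words\<close>

text \<open>Because \<open>tau k\<close> is idempotent, this normalization makes the parameter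
  multiplicative; in particular \<open>h k (1 / c)\<close> is the inverse of \<open>h k c\<close>
  for nonzero c.\<close>

definition h :: "nat \<Rightarrow> 'k \<Rightarrow> ('k::field) hecke" where
  "h k c = lett (k, 1, c - 1)"

lemma when_of_bool: "(c when P) = c * (of_bool P :: 'k::field)"
  by (simp add: when_def)

lemma h_mult: "h k c * h k d = h k (c * d)"
  unfolding h_def lett_def
  by (intro poly_mapping_eqI)
    (simp add: distrib_left distrib_right mult_single tau_idem lookup_add lookup_single when_of_bool,
     simp add: algebra_simps)

lemma h_1 [simp]: "h k 1 = 1"
  by (simp add: h_def lett_def)

text \<open>The Yang-Baxter equation in multiplicative form. Once the braid relation has identified
  the two longest products, both sides agree coefficient by coefficient.\<close>

lemma h_ybe: "h k s * h (Suc k) (s * u) * h k u = h (Suc k) u * h k (s * u) * h (Suc k) (s :: 'k::field)"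
proof -
  have b: "tau k + (tau (Suc k) + tau k) = tau (Suc k) + (tau k + tau (Suc k))"
    using tau_braid[of k] by (simp add: add.assoc)
  show ?thesis
    unfolding h_def lett_def
    by (intro poly_mapping_eqI)
      (simp add: distrib_left distrib_right mult_single tau_idem lookup_add lookup_single when_of_bool b add.assoc,
       simp add: algebra_simps)
qed

lemma lett_commute:
  assumes "k + 2 \<le> l \<or> l + 2 \<le> k"
  shows "lett (k, a, b) * lett (l, c, d) = lett (l, c, d) * lett (k, a, b)"
proof -
  have b: "tau k + tau l = tau l + tau k" using assms tau_comm by metis
  show ?thesis unfolding lett_def
    by (simp add: distrib_left distrib_right mult_single b algebra_simps)
qed

lemma commute_prod_list:
  fixes x :: "'a::monoid_mult"
  assumes "\<And>y. y \<in> set ys \<Longrightarrow> x * y = y * x"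
  shows "x * prod_list ys = prod_list ys * x"
  using assms by (induction ys) (auto simp: mult.assoc[symmetric], simp add: mult.assoc)

lemma gprod_commute:
  assumes "\<And>x y. x \<in> set L \<Longrightarrow> y \<in> set M \<Longrightarrow> fst x + 2 \<le> fst y \<or> fst y + 2 \<le> fst x"
  shows "gprod L * gprod M = gprod M * gprod L"
proof -
  have "lett x * lett y = lett y * lett x" if "x \<in> set L" "y \<in> set M" for x y
  proof -
    obtain k a b l c d where "x = (k, a, b)" "y = (l, c, d)" by (metis prod_cases3)
    then show ?thesis using assms[OF that] lett_commute[of k l] by simp
  qed
  then have "lett x * gprod M = gprod M * lett x" if "x \<in> set L" for x
    unfolding gprod_def using that by (intro commute_prod_list) (metis (no_types, lifting) imageE list.set_map)
  then show ?thesis unfolding gprod_def[of L] by (intro commute_prod_list[symmetric]) auto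
qed

text \<open>This disentangles an interleaved product: each V has to pass only those U that stand to
  its right, which is what \<open>sorted_wrt\<close> expresses.\<close>

lemma prod_list_mult_split:
  fixes U V :: "'b \<Rightarrow> 'a::monoid_mult"
  assumes "sorted_wrt (\<lambda>x y. V x * U y = U y * V x) xs"
  shows "prod_list (map (\<lambda>x. U x * V x) xs) = prod_list (map U xs) * prod_list (map V xs)"
  using assms
proof (induction xs)
  case (Cons x xs)
  then have "V x * prod_list (map U xs) = prod_list (map U xs) * V x"
    by (intro commute_prod_list) auto
  with Cons show ?case by (simp add: mult.assoc) (simp add: mult.assoc[symmetric])
qed simp

lemma prod_list_rev:
  fixes f :: "'b \<Rightarrow> 'a::monoid_mult"
  assumes "\<And>x y. x \<in> set xs \<Longrightarrow> y \<in> set xs \<Longrightarrow> f x * f y = f y * f x"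
  shows "prod_list (map f (rev xs)) = prod_list (map f xs)"
  using assms
proof (induction xs)
  case (Cons x xs)
  have "f x * prod_list (map f xs) = prod_list (map f xs) * f x"
    using Cons.prems by (intro commute_prod_list) auto
  with Cons show ?case by simp
qed simp

section \<open>Coefficients at permutations\<close>

definition coef :: "('k::field) hecke \<Rightarrow> (nat \<Rightarrow> nat) \<Rightarrow> 'k" where
  "coef f w = Poly_Mapping.lookup f (to_hperm w)"

lemma coef_add: "coef (f + g) w = coef f w + coef g w"
  by (simp add: coef_def lookup_add)

lemma coef_const_mult: "coef (const c * f) w = c * coef f w"
  by (simp add: coef_def lookup_const_mult)

lemma coef_single: "finite_perm w \<Longrightarrow> coef (Poly_Mapping.single u c) w = (if of_hperm u = w then c else 0)"
  by (auto simp: coef_def lookup_single when_def)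

lemma coef_1: "finite_perm w \<Longrightarrow> coef 1 w = (if w = id then 1 else 0)"
  using coef_single[of w 0 1] by auto

lemma coef_eqI: "(\<And>w. finite_perm w \<Longrightarrow> coef f w = coef g w) \<Longrightarrow> f = g"
  unfolding coef_def by (intro poly_mapping_eqI) (metis finite_perm_of_hperm to_of_hperm)

text \<open>A product with \<open>tau k\<close> always descends at k. So only the scalar part
  contributes at an ascent, while at a descent \<open>tau k\<close> sends both w and w s_k to
  w.\<close>

lemma coef_mult_lett:
  assumes w: "finite_perm w"
  shows "coef (f * lett (k, a, b)) w =
    (if w (Suc k) < w (Suc (Suc k)) then a * coef f w else (a + b) * coef f w + b * coef f (w \<circ> adj k))"
proof -
  define w' where "w' = w \<circ> adj k"
  have fw: "finite_perm w'" using w by (simp add: w'_def finite_perm_comp)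
  show ?thesis unfolding w'_def[symmetric]
proof (induction f rule: poly_mapping_add_induct)
  case zero
  then show ?case by (simp add: coef_def)
next
  case (add f g)
  then show ?case by (auto simp: coef_add distrib_right algebra_simps)
next
  case (single u c)
  let ?u = "of_hperm u"
  have ne: "w \<noteq> w'" using finite_perm_neq[OF w, of "Suc k" "Suc (Suc k)"]
    unfolding w'_def by (metis adj_simps(1) comp_apply n_not_Suc_n)
  have un: "?u (Suc k) \<noteq> ?u (Suc (Suc k))" using finite_perm_neq by simp
  have wn: "w (Suc k) \<noteq> w (Suc (Suc k))" using finite_perm_neq w by simp
  have eq: "dstep ?u k = w \<longleftrightarrow> w (Suc (Suc k)) < w (Suc k) \<and> (?u = w \<or> ?u = w')"
  proof
    assume "dstep ?u k = w"
    then show "w (Suc (Suc k)) < w (Suc k) \<and> (?u = w \<or> ?u = w')"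
      using un unfolding dstep_def w'_def by (auto split: if_splits)
  next
    assume "w (Suc (Suc k)) < w (Suc k) \<and> (?u = w \<or> ?u = w')"
    then show "dstep ?u k = w" unfolding dstep_def w'_def by auto
  qed
  have "coef (Poly_Mapping.single u c * lett (k, a, b)) w
      = (if ?u = w then c * a else 0) + (if dstep ?u k = w then c * b else 0)"
    using w by (simp add: lett_def distrib_left mult_single coef_add coef_single add_tau finite_perm_dstep)
  then show ?case
    using w ne wn unfolding eq by (auto simp: coef_single fw algebra_simps)
qed
qed

text \<open>The mirror image, in which the descents are those of the inverse.\<close>

lemma coef_lett_mult:
  assumes w: "finite_perm w"
  shows "coef (lett (k, a, b) * f) w =
    (if inv w (Suc k) < inv w (Suc (Suc k)) then a * coef f w else (a + b) * coef f w + b * coef f (adj k \<circ> w))"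
proof -
  define w' where "w' = adj k \<circ> w"
  have fw: "finite_perm w'" using w by (simp add: w'_def finite_perm_comp)
  show ?thesis unfolding w'_def[symmetric]
proof (induction f rule: poly_mapping_add_induct)
  case zero
  then show ?case by (simp add: coef_def)
next
  case (add f g)
  then show ?case by (auto simp: coef_add distrib_left algebra_simps)
next
  case (single u c)
  let ?u = "of_hperm u"
  let ?v = "inv w" and ?t = "inv ?u"
  have bw: "bij w" "bij ?u" using w finite_perm_bij by auto
  have fv: "finite_perm ?v" "finite_perm ?t" using w finite_perm_inv by auto
  have ne: "w \<noteq> w'"
  proof
    assume "w = w'"
    then have "w = adj k \<circ> w" by (simp add: w'_def)
    then have "w (inv w (Suc k)) = adj k (w (inv w (Suc k)))" by (metis comp_apply)
    then show False using bw by (simp add: surj_f_inv_f bij_is_surj)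
  qed
  have un: "?t (Suc k) \<noteq> ?t (Suc (Suc k))" using finite_perm_neq fv by simp
  have wn: "?v (Suc k) \<noteq> ?v (Suc (Suc k))" using finite_perm_neq fv by simp
  have inv_eq: "inv p = w \<longleftrightarrow> p = ?v" if "bij p" for p using that bw by (metis inv_inv_eq)
  have t: "?u = w \<longleftrightarrow> ?t = ?v" "?u = w' \<longleftrightarrow> ?t = ?v \<circ> adj k"
    using bw unfolding w'_def by (metis inv_inv_eq, metis bij_adj(1) inv_adj inv_inv_eq o_inv_distrib bij_comp)
  have eq: "inv (dstep ?t k) = w \<longleftrightarrow> ?v (Suc (Suc k)) < ?v (Suc k) \<and> (?u = w \<or> ?u = w')"
    unfolding t inv_eq[OF finite_perm_bij[OF finite_perm_dstep[OF fv(2)]]]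
  proof
    assume d: "dstep ?t k = ?v"
    show "?v (Suc (Suc k)) < ?v (Suc k) \<and> (?t = ?v \<or> ?t = ?v \<circ> adj k)"
    proof (cases "?t (Suc k) < ?t (Suc (Suc k))")
      case True
      then have v: "?v = ?t \<circ> adj k" using d by (simp add: dstep_def)
      show ?thesis unfolding v using True by simp
    qed (use d un in \<open>auto simp: dstep_def\<close>)
  next
    assume "?v (Suc (Suc k)) < ?v (Suc k) \<and> (?t = ?v \<or> ?t = ?v \<circ> adj k)"
    then show "dstep ?t k = ?v" unfolding dstep_def by auto
  qed
  have "coef (lett (k, a, b) * Poly_Mapping.single u c) w
      = (if ?u = w then a * c else 0) + (if inv (dstep ?t k) = w then b * c else 0)"
    using w fv by (simp add: lett_def distrib_right mult_single coef_add coef_single tau_add finite_perm_dstep finite_perm_inv)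
  then show ?case
    using w ne wn unfolding eq by (auto simp: coef_single fw algebra_simps finite_perm_comp)
qed
qed

section \<open>Rows and columns of letters\<close>

definition hl :: "nat \<Rightarrow> 'k \<Rightarrow> nat \<times> 'k \<times> ('k::field)" where
  "hl k c = (k, 1, c - 1)"

lemma fst_hl [simp]: "fst (hl k c) = k"
  by (simp add: hl_def)

lemma lett_hl [simp]: "lett (hl k c) = h k c"
  by (simp add: hl_def h_def)

text \<open>The one-variable generating functions of Fomin and Kirillov in multiplicative form.
  \<open>Bw\<close> has the letters in the opposite order with inverted parameter, so that the two
  are mutually inverse.\<close>

definition Aw :: "nat \<Rightarrow> nat \<Rightarrow> 'k \<Rightarrow> ('k::field) hecke" where
  "Aw i m y = gprod (map (\<lambda>k. hl k y) [i..<m])"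

definition Bw :: "nat \<Rightarrow> nat \<Rightarrow> 'k \<Rightarrow> ('k::field) hecke" where
  "Bw i m x = gprod (map (\<lambda>k. hl k (1 / x)) (rev [i..<m]))"

lemma AB_ge [simp]: "m \<le> i \<Longrightarrow> Aw i m y = 1" "m \<le> i \<Longrightarrow> Bw i m x = 1"
  by (simp_all add: Aw_def Bw_def)

lemma AB_rec: "i < m \<Longrightarrow> Aw i m y = h i y * Aw (Suc i) m y" "i < m \<Longrightarrow> Bw i m x = Bw (Suc i) m x * h i (1 / x)"
  by (simp_all add: Aw_def Bw_def upt_rec[of i m])

lemma Aw_Suc: "i \<le> m \<Longrightarrow> Aw i (Suc m) y = Aw i m y * h m y"
  by (simp add: Aw_def)

lemma AB_split:
  assumes "i \<le> j" "j \<le> m"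
  shows "Aw i m y = Aw i j y * Aw j m y" "Bw i m x = Bw j m x * Bw i j x"
proof -
  have "[i..<m] = [i..<j] @ [j..<m]" using assms by (metis le_Suc_ex upt_add_eq_append)
  then show "Aw i m y = Aw i j y * Aw j m y" "Bw i m x = Bw j m x * Bw i j x"
    by (simp_all add: Aw_def Bw_def)
qed

lemma AB_cancel: assumes "x \<noteq> 0" shows "Aw i m x * Bw i m x = 1" "Bw i m x * Aw i m x = 1"
proof -
  have "Aw i m x * Bw i m x = 1 \<and> Bw i m x * Aw i m x = 1"
  proof (induction "m - i" arbitrary: i)
    case (Suc d)
    then have IH: "Aw (Suc i) m x * Bw (Suc i) m x = 1" "Bw (Suc i) m x * Aw (Suc i) m x = 1"
      by auto
    have "i < m" using Suc by simp
    have "Aw i m x * Bw i m x = h i x * (Aw (Suc i) m x * Bw (Suc i) m x) * h i (1 / x)"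
      using \<open>i < m\<close> by (simp add: AB_rec mult.assoc)
    moreover have "Bw i m x * Aw i m x = Bw (Suc i) m x * (h i (1 / x) * h i x) * Aw (Suc i) m x"
      using \<open>i < m\<close> by (simp add: AB_rec mult.assoc)
    ultimately show ?case using IH assms by (simp add: h_mult)
  qed simp
  then show "Aw i m x * Bw i m x = 1" "Bw i m x * Aw i m x = 1" by auto
qed

lemma h_gprod: "h k c = gprod [hl k c]"
  by simp

lemma gprod_idx_commute:
  assumes "fst ` set L \<subseteq> I" "fst ` set M \<subseteq> J" "\<And>k l. k \<in> I \<Longrightarrow> l \<in> J \<Longrightarrow> k + 2 \<le> l \<or> l + 2 \<le> k"
  shows "gprod L * gprod M = gprod M * gprod L"
  using assms by (intro gprod_commute) blast

lemma AB_commute: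
  assumes "m + 1 \<le> i \<or> k + 1 \<le> j"
  shows "Aw i k y * Aw j m z = Aw j m z * Aw i k y" "Bw i k y * Bw j m z = Bw j m z * Bw i k y"
    "Aw i k y * Bw j m z = Bw j m z * Aw i k y" "Bw i k y * Aw j m z = Aw j m z * Bw i k y"
  unfolding Aw_def Bw_def
  using assms by (auto intro!: gprod_idx_commute[of _ "{i..<k}" _ "{j..<m}"] simp: hl_def)

lemma h_AB_commute:
  assumes "k + 2 \<le> i \<or> m < k"
  shows "h k c * Aw i m z = Aw i m z * h k c" "h k c * Bw i m z = Bw i m z * h k c"
  unfolding Aw_def Bw_def h_gprod
  using assms by (auto intro!: gprod_idx_commute[of _ "{k}" _ "{i..<m}"] simp: hl_def simp del: gprod_simps)

text \<open>A letter beyond the alphabet counts as 1; this cuts rectangles of crossings down to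
  triangles.\<close>

definition hm :: "nat \<Rightarrow> nat \<Rightarrow> 'k \<Rightarrow> ('k::field) hecke" where
  "hm m k c = (if k < m then h k c else 1)"

text \<open>A row meets a column in exactly one crossing. The outer letters \<open>h j y\<close> and
  \<open>h j (1 / x)\<close> pass the crossing of the shorter row and column by the Yang-Baxter
  equation, and both factors lose their letter j.\<close>

lemma AB_exchange: "Aw j m y * Bw j m x = Bw (Suc j) m x * hm m j (y / x) * Aw (Suc j) m y"
proof (induction "m - j" arbitrary: j)
  case (Suc d)
  then have "j < m" and IH: "Aw (Suc j) m y * Bw (Suc j) m x =
      Bw (Suc (Suc j)) m x * hm m (Suc j) (y / x) * Aw (Suc (Suc j)) m y" by auto
  let ?B = "Bw (Suc (Suc j)) m x" and ?A = "Aw (Suc (Suc j)) m y"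
  have c: "h j y * ?B = ?B * h j y" "?A * h j (1 / x) = h j (1 / x) * ?A"
    by (rule h_AB_commute, simp, rule h_AB_commute(1)[symmetric], simp)
  have "Aw j m y * Bw j m x = h j y * (Aw (Suc j) m y * Bw (Suc j) m x) * h j (1 / x)"
    using \<open>j < m\<close> by (simp add: AB_rec mult.assoc)
  also have "\<dots> = (h j y * ?B) * hm m (Suc j) (y / x) * (?A * h j (1 / x))"
    unfolding IH by (simp add: mult.assoc)
  also have "\<dots> = ?B * (h j y * hm m (Suc j) (y / x) * h j (1 / x)) * ?A"
    unfolding c by (simp add: mult.assoc)
  also have "\<dots> = Bw (Suc j) m x * hm m j (y / x) * Aw (Suc j) m y"
  proof (cases "Suc j < m")
    case True
    have y: "h j y * h (Suc j) (y * (1 / x)) * h j (1 / x)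
        = h (Suc j) (1 / x) * h j (y * (1 / x)) * h (Suc j) y" by (rule h_ybe)
    have "?B * (h j y * hm m (Suc j) (y / x) * h j (1 / x)) * ?A
        = ?B * (h j y * h (Suc j) (y * (1 / x)) * h j (1 / x)) * ?A"
      using True by (simp add: hm_def)
    also have "\<dots> = (?B * h (Suc j) (1 / x)) * h j (y / x) * (h (Suc j) y * ?A)"
      unfolding y by (simp add: mult.assoc)
    finally show ?thesis using True \<open>j < m\<close> by (simp add: hm_def AB_rec[of "Suc j"])
  next
    case False
    then show ?thesis using \<open>j < m\<close> by (simp add: hm_def h_mult)
  qed
  finally show ?case .
qed (simp add: hm_def)

text \<open>Two rows of different lengths trade their parameters at the price of one letter at the
  end. Multiplying by the missing letter of the shorter row turns this into commutativity of equally
  long rows.\<close>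

lemma Aw_swap:
  assumes "i \<le> k" "y' \<noteq> 0"
  shows "Aw i (Suc k) y * Aw i k y' = Aw i (Suc k) y' * Aw i k y * h k (y / y')"
  using assms(1)
proof (induction k rule: dec_induct)
  case base
  then show ?case using assms by (simp add: Aw_Suc h_mult)
next
  case (step k)
  have c: "h (Suc k) z * Aw i k z' = Aw i k z' * h (Suc k) z" for z z'
    using h_AB_commute[of "Suc k" i k] by simp
  have y: "h k (y / y') * h (Suc k) (y / y' * y') * h k y' = h (Suc k) y' * h k (y / y' * y') * h (Suc k) (y / y')"
    by (rule h_ybe)
  have "Aw i (Suc (Suc k)) y * Aw i (Suc k) y' = Aw i (Suc k) y * (h (Suc k) y * Aw i k y') * h k y'"
    using step by (simp add: Aw_Suc mult.assoc)
  also have "\<dots> = (Aw i (Suc k) y * Aw i k y') * h (Suc k) y * h k y'"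
    unfolding c by (simp add: mult.assoc)
  also have "\<dots> = Aw i (Suc k) y' * Aw i k y * (h k (y / y') * h (Suc k) (y / y' * y') * h k y')"
    unfolding step.IH using assms by (simp add: mult.assoc)
  also have "\<dots> = Aw i (Suc k) y' * (Aw i k y * h (Suc k) y') * h k y * h (Suc k) (y / y')"
    unfolding y using assms by (simp add: mult.assoc)
  also have "\<dots> = Aw i (Suc (Suc k)) y' * Aw i (Suc k) y * h (Suc k) (y / y')"
    unfolding c[symmetric] using step by (simp add: Aw_Suc mult.assoc)
  finally show ?case .
qed

lemma Aw_comm: assumes "y' \<noteq> 0" shows "Aw i m y * Aw i m y' = Aw i m y' * Aw i m y"
proof (cases "i < m")
  case True
  then obtain k where m: "m = Suc k" "i \<le> k" by (metis less_Suc_eq_le old.nat.exhaust not_less0)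
  have "Aw i m y * Aw i m y' = Aw i (Suc k) y * Aw i k y' * h k y'"
    using m by (simp add: Aw_Suc mult.assoc)
  also have "\<dots> = Aw i (Suc k) y' * Aw i k y * (h k (y / y') * h k y')"
    unfolding Aw_swap[OF m(2) assms] by (simp add: mult.assoc)
  also have "\<dots> = Aw i m y' * Aw i m y"
    using m assms by (simp add: h_mult Aw_Suc mult.assoc)
  finally show ?thesis .
qed simp

text \<open>Inverses of commuting elements commute.\<close>

lemma Bw_comm:
  assumes "x \<noteq> 0" "x' \<noteq> 0"
  shows "Bw i m x * Bw i m x' = Bw i m x' * Bw i m x"
proof -
  let ?A = "Aw i m x" and ?A' = "Aw i m x'" and ?B = "Bw i m x" and ?B' = "Bw i m x'"
  have "?B * ?B' = ?B * ?B' * (?A * (?A' * ?B') * ?B)"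
    using AB_cancel[OF assms(1)] AB_cancel[OF assms(2)] by simp
  also have "\<dots> = ?B * ?B' * (?A * ?A') * ?B' * ?B" by (simp add: mult.assoc)
  also have "\<dots> = ?B * (?B' * ?A') * ?A * ?B' * ?B"
    unfolding Aw_comm[OF assms(2)] by (simp add: mult.assoc)
  also have "\<dots> = ?B' * ?B" using AB_cancel[OF assms(1)] AB_cancel[OF assms(2)] by simp
  finally show ?thesis .
qed

section \<open>Rectangles and triangles of crossings\<close>

definition Arow :: "nat \<Rightarrow> nat \<Rightarrow> nat \<Rightarrow> (nat \<Rightarrow> 'k) \<Rightarrow> ('k::field) hecke" where
  "Arow d m p y = prod_list (map (\<lambda>i. Aw (d + i) m (y i)) (rev [0..<p]))"

definition Bcol :: "nat \<Rightarrow> nat \<Rightarrow> nat \<Rightarrow> (nat \<Rightarrow> 'k) \<Rightarrow> ('k::field) hecke" where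
  "Bcol d m q x = prod_list (map (\<lambda>j. Bw (d + j) m (x j)) [0..<q])"

definition hrow :: "nat \<Rightarrow> nat \<Rightarrow> nat \<Rightarrow> 'k \<Rightarrow> (nat \<Rightarrow> 'k) \<Rightarrow> ('k::field) hecke" where
  "hrow d m q y x = prod_list (map (\<lambda>j. hm m (d + j) (y / x j)) [0..<q])"

definition grid :: "nat \<Rightarrow> nat \<Rightarrow> nat \<Rightarrow> nat \<Rightarrow> (nat \<Rightarrow> 'k) \<Rightarrow> (nat \<Rightarrow> 'k) \<Rightarrow> ('k::field) hecke" where
  "grid d m p q y x = prod_list (map (\<lambda>i. hrow (d + i) m q (y i) x) (rev [0..<p]))"

lemma hm_AB_commute:
  assumes "k + 2 \<le> i"
  shows "hm m' k c * Aw i m z = Aw i m z * hm m' k c" "hm m' k c * Bw i m z = Bw i m z * hm m' k c"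
  using h_AB_commute[of k i m] assms by (auto simp: hm_def)

lemma hrow_AB_commute:
  assumes "d + q + 1 \<le> i"
  shows "Aw i m z * hrow d m' q y x = hrow d m' q y x * Aw i m z"
    "Bw i m z * hrow d m' q y x = hrow d m' q y x * Bw i m z"
  unfolding hrow_def using assms
  by (auto intro!: commute_prod_list hm_AB_commute[symmetric])

lemma row_pass:
  "Aw i m y * Bcol i m q x = Bcol (Suc i) m q x * hrow i m q y x * Aw (i + q) m y"
proof (induction q)
  case (Suc q)
  have "Aw i m y * Bcol i m (Suc q) x = (Aw i m y * Bcol i m q x) * Bw (i + q) m (x q)"
    by (simp add: Bcol_def mult.assoc)
  also have "\<dots> = Bcol (Suc i) m q x * hrow i m q y x * (Aw (i + q) m y * Bw (i + q) m (x q))"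
    unfolding Suc by (simp add: mult.assoc)
  also have "\<dots> = Bcol (Suc i) m q x * (hrow i m q y x * Bw (Suc (i + q)) m (x q)) *
      hm m (i + q) (y / x q) * Aw (Suc (i + q)) m y"
    unfolding AB_exchange by (simp add: mult.assoc)
  also have "\<dots> = Bcol (Suc i) m (Suc q) x * hrow i m (Suc q) y x * Aw (i + Suc q) m y"
    unfolding hrow_AB_commute(2)[of i q "Suc (i + q)" m, symmetric, simplified]
    by (simp add: Bcol_def hrow_def mult.assoc)
  finally show ?case .
qed (simp add: Bcol_def hrow_def)

text \<open>Every row crosses every column once. The crossings collect in the middle, and the
  shortened rows and columns leave on the opposite sides.\<close>

lemma Arow_Bcol:
  "Arow d m p y * Bcol d m q x = Bcol (d + p) m q x * grid d m p q y x * Arow (d + q) m p y"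
proof (induction p)
  case (Suc p)
  let ?A = "Aw (d + p) m (y p)" and ?A' = "Aw (d + p + q) m (y p)"
  have c: "?A' * grid d m p q y x = grid d m p q y x * ?A'"
    unfolding grid_def by (intro commute_prod_list) (auto simp: hrow_AB_commute)
  have "Arow d m (Suc p) y * Bcol d m q x = ?A * (Arow d m p y * Bcol d m q x)"
    by (simp add: Arow_def mult.assoc)
  also have "\<dots> = (?A * Bcol (d + p) m q x) * grid d m p q y x * Arow (d + q) m p y"
    unfolding Suc by (simp add: mult.assoc)
  also have "\<dots> = Bcol (Suc (d + p)) m q x * hrow (d + p) m q (y p) x * (?A' * grid d m p q y x) * Arow (d + q) m p y"
    unfolding row_pass by (simp add: mult.assoc)
  also have "\<dots> = Bcol (d + Suc p) m q x * grid d m (Suc p) q y x * Arow (d + q) m (Suc p) y"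
    unfolding c by (simp add: grid_def Arow_def mult.assoc ac_simps(2)[of q p] add.assoc)
  finally show ?case .
qed (simp add: Arow_def grid_def)

lemma prod_list_cancel:
  fixes f g :: "'b \<Rightarrow> 'a::monoid_mult"
  assumes "\<And>x. x \<in> set xs \<Longrightarrow> f x * g x = 1"
  shows "prod_list (map f (rev xs)) * prod_list (map g xs) = 1"
    "prod_list (map f xs) * prod_list (map g (rev xs)) = 1"
proof -
  show "prod_list (map f (rev xs)) * prod_list (map g xs) = 1" using assms
  proof (induction xs)
    case (Cons x xs)
    have "prod_list (map f (rev (x # xs))) * prod_list (map g (x # xs))
      = prod_list (map f (rev xs)) * (f x * g x) * prod_list (map g xs)" by (simp add: mult.assoc)
    then show ?case using Cons by simp
  qed simp
  show "prod_list (map f xs) * prod_list (map g (rev xs)) = 1" using assms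
  proof (induction xs)
    case (Cons x xs)
    have "prod_list (map f (x # xs)) * prod_list (map g (rev (x # xs)))
      = f x * (prod_list (map f xs) * prod_list (map g (rev xs))) * g x" by (simp add: mult.assoc)
    then show ?case using Cons by simp
  qed simp
qed

lemma Arow_Bcol_cancel: "(\<And>i. i < p \<Longrightarrow> x i \<noteq> 0) \<Longrightarrow> Arow d m p x * Bcol d m p x = 1"
  unfolding Arow_def Bcol_def by (rule prod_list_cancel) (simp add: AB_cancel)

lemma Bcol_1 [simp]: "m \<le> d \<Longrightarrow> Bcol d m q x = 1"
proof -
  assume "m \<le> d"
  then have "map (\<lambda>j. Bw (d + j) m (x j)) [0..<q] = map (\<lambda>_. 1) [0..<q]" by simp
  then show ?thesis unfolding Bcol_def by (simp add: map_replicate_const prod_list_replicate)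
qed

lemma Arow_1 [simp]: "m \<le> d \<Longrightarrow> Arow d m q x = 1"
proof -
  assume "m \<le> d"
  then have "map (\<lambda>j. Aw (d + j) m (x j)) (rev [0..<q]) = map (\<lambda>_. 1) (rev [0..<q])" by simp
  then show ?thesis unfolding Arow_def by (simp add: map_replicate_const prod_list_replicate)
qed

text \<open>Here the alphabet is exhausted, so the rows and columns that leave the rectangle are
  empty.\<close>

lemma grid_triangle: "m \<le> d + p \<Longrightarrow> m \<le> d + q \<Longrightarrow> grid d m p q y x = Arow d m p y * Bcol d m q x"
  unfolding Arow_Bcol by simp

text \<open>The staircase word of the double Grothendieck polynomials, with X for the variables a
  and Y for b. In this factored form X occurs only in the columns, so an exchange of variables in X
  can be studied there.\<close>

definition tri :: "nat \<Rightarrow> (nat \<Rightarrow> 'k) \<Rightarrow> (nat \<Rightarrow> 'k) \<Rightarrow> ('k::field) hecke" where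
  "tri N X Y = Arow 0 (N - 1) N Y * Bcol 0 (N - 1) N X"

lemma tri_grid: "tri N X Y = grid 0 (N - 1) N N Y X"
  unfolding tri_def by (subst grid_triangle) auto

text \<open>Exchanging two neighbouring variables costs one letter on the right. On the level of
  coefficients this is the defining recursion of Grothendieck polynomials.\<close>

lemma tri_swap:
  assumes "Suc i < N" "X i \<noteq> 0" "X (Suc i) \<noteq> 0"
  shows "tri N X Y * h i (X i / X (Suc i)) = tri N (X \<circ> transpose i (Suc i)) Y"
proof -
  let ?m = "N - 1" and ?x = "X i" and ?x' = "X (Suc i)" and ?X = "X \<circ> transpose i (Suc i)"
  have im: "i < ?m" using assms by simp
  have l: "[0..<N] = [0..<i] @ [i, Suc i] @ [Suc (Suc i)..<N]"
    using assms upt_add_eq_append[of 0 i "N - i"] by (simp add: upt_rec[of i] upt_rec[of "Suc i"])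
  let ?P = "\<lambda>X. prod_list (map (\<lambda>j. Bw j ?m (X j)) [0..<i])"
  let ?Q = "\<lambda>X. prod_list (map (\<lambda>j. Bw j ?m (X j)) [Suc (Suc i)..<N])"
  have PQ: "?P ?X = ?P X" "?Q ?X = ?Q X"
    by (rule arg_cong[where f = prod_list], rule map_cong, simp_all)+
  have B: "Bcol 0 ?m N Z = ?P Z * Bw i ?m (Z i) * Bw (Suc i) ?m (Z (Suc i)) * ?Q Z" for Z
    unfolding Bcol_def l by (simp add: mult.assoc)
  have c: "h i (?x / ?x') * ?Q X = ?Q X * h i (?x / ?x')"
    by (intro commute_prod_list) (auto simp: h_AB_commute)
  \<comment> \<open>The factor \<open>h i (1 / ?x')\<close> completes the second column to the
    length of the first. The two columns then commute, and \<open>h i ?x\<close> removes the last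
    letter of the one that comes to stand on the right.\<close>
  have e: "Bw i ?m ?x * Bw (Suc i) ?m ?x' * h i (?x / ?x') = Bw i ?m ?x' * Bw (Suc i) ?m ?x"
  proof -
    have "h i (?x / ?x') = h i (1 / ?x') * h i ?x" by (simp add: h_mult)
    then have "Bw i ?m ?x * Bw (Suc i) ?m ?x' * h i (?x / ?x') = Bw i ?m ?x * (Bw (Suc i) ?m ?x' * h i (1 / ?x')) * h i ?x"
      by (simp add: mult.assoc)
    also have "\<dots> = (Bw i ?m ?x * Bw i ?m ?x') * h i ?x" using im by (simp add: AB_rec(2)[of i])
    also have "\<dots> = Bw i ?m ?x' * (Bw (Suc i) ?m ?x * (h i (1 / ?x) * h i ?x))"
      unfolding Bw_comm[OF assms(2,3)] using AB_rec(2)[OF im, of ?x] by (simp add: mult.assoc)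
    finally show ?thesis using assms by (simp add: h_mult)
  qed
  have "Bcol 0 ?m N X * h i (?x / ?x') = ?P X * (Bw i ?m ?x * Bw (Suc i) ?m ?x') * (?Q X * h i (?x / ?x'))"
    unfolding B by (simp add: mult.assoc)
  also have "\<dots> = ?P X * (Bw i ?m ?x * Bw (Suc i) ?m ?x' * h i (?x / ?x')) * ?Q X"
    unfolding c[symmetric] by (simp add: mult.assoc)
  also have "\<dots> = Bcol 0 ?m N ?X" unfolding e B PQ by (simp add: mult.assoc)
  finally show ?thesis unfolding tri_def by (simp add: mult.assoc)
qed

section \<open>Stable words\<close>

definition Hst :: "nat \<Rightarrow> nat \<Rightarrow> nat \<Rightarrow> (nat \<Rightarrow> 'k) \<Rightarrow> (nat \<Rightarrow> 'k) \<Rightarrow> ('k::field) hecke" where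
  "Hst m p q y x = prod_list (map (\<lambda>i. Aw 0 m (y i)) (rev [0..<p])) * prod_list (map (\<lambda>j. Bw 0 m (x j)) [0..<q])"

text \<open>What the rows of \<open>Hst\<close> have in excess of staggered ones; \<open>Mw\<close>
  is the same for the columns.\<close>

definition Lw :: "nat \<Rightarrow> (nat \<Rightarrow> 'k) \<Rightarrow> ('k::field) hecke" where
  "Lw p y = prod_list (map (\<lambda>i. Aw 0 i (y i)) (rev [0..<p]))"

definition Mw :: "nat \<Rightarrow> (nat \<Rightarrow> 'k) \<Rightarrow> ('k::field) hecke" where
  "Mw q x = prod_list (map (\<lambda>j. Bw 0 j (x j)) [0..<q])"

lemma Mw_Lw: "(\<And>i. i < p \<Longrightarrow> x i \<noteq> 0) \<Longrightarrow> Mw p x * Lw p x = 1"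
  unfolding Mw_def Lw_def by (rule prod_list_cancel) (simp add: AB_cancel)

text \<open>Row i is cut at the letter i. An upper part commutes with every lower part of smaller
  index, because their letters differ by at least two; so the lower parts gather at the outer ends,
  and what remains is a staggered product of rows and columns.\<close>

lemma Hst_factor:
  assumes "p \<le> m + 1" "q \<le> m + 1"
  shows "Hst m p q y x = Lw p y * Bcol p m q x * grid 0 m p q y x * Arow q m p y * Mw q x"
proof -
  have "map (\<lambda>i. Aw 0 m (y i)) (rev [0..<p]) = map (\<lambda>i. Aw 0 i (y i) * Aw i m (y i)) (rev [0..<p])"
    using assms by (auto simp: AB_split(1)[of 0 _ m])
  moreover have "prod_list (map (\<lambda>i. Aw 0 i (y i) * Aw i m (y i)) (rev [0..<p])) = Lw p y * Arow 0 m p y"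
    unfolding Lw_def Arow_def add_0
  proof (rule prod_list_mult_split)
    have "sorted_wrt (>) (rev [0..<p])" by (simp add: sorted_wrt_rev)
    then show "sorted_wrt (\<lambda>x z. Aw x m (y x) * Aw 0 z (y z) = Aw 0 z (y z) * Aw x m (y x)) (rev [0..<p])"
      by (rule sorted_wrt_mono_rel[rotated]) (auto intro: AB_commute)
  qed
  moreover have "map (\<lambda>j. Bw 0 m (x j)) [0..<q] = map (\<lambda>j. Bw j m (x j) * Bw 0 j (x j)) [0..<q]"
    using assms by (auto simp: AB_split(2)[of 0 _ m])
  moreover have "prod_list (map (\<lambda>j. Bw j m (x j) * Bw 0 j (x j)) [0..<q]) = Bcol 0 m q x * Mw q x"
    unfolding Mw_def Bcol_def add_0
  proof (rule prod_list_mult_split)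
    have "sorted_wrt (<) [0..<q]" by simp
    then show "sorted_wrt (\<lambda>z w. Bw 0 z (x z) * Bw w m (x w) = Bw w m (x w) * Bw 0 z (x z)) [0..<q]"
      by (rule sorted_wrt_mono_rel[rotated]) (auto intro: AB_commute)
  qed
  ultimately have "prod_list (map (\<lambda>i. Aw 0 m (y i)) (rev [0..<p])) = Lw p y * Arow 0 m p y"
    "prod_list (map (\<lambda>j. Bw 0 m (x j)) [0..<q]) = Bcol 0 m q x * Mw q x"
    by (simp_all only:)
  then have "Hst m p q y x = Lw p y * (Arow 0 m p y * Bcol 0 m q x) * Mw q x"
    by (simp add: Hst_def mult.assoc)
  then show ?thesis unfolding Arow_Bcol by (simp add: mult.assoc)
qed

lemma map_rev_upt: "map (\<lambda>i. f (p - 1 - i)) [0..<p] = map f (rev [0..<p])"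
  by (rule nth_equalityI) (auto simp: rev_nth)

text \<open>Rows without stagger commute with each other, and so do columns; hence the stable word
  is symmetric in each set of variables.\<close>

lemma Hst_rev:
  assumes "\<And>i. i < p \<Longrightarrow> y i \<noteq> 0" "\<And>j. j < q \<Longrightarrow> x j \<noteq> 0"
  shows "Hst m p q (\<lambda>i. y (p - 1 - i)) (\<lambda>j. x (q - 1 - j)) = Hst m p q y x"
proof -
  have A: "prod_list (map f (rev [0..<p])) = prod_list (map f [0..<p])"
    if "\<And>i j. i < p \<Longrightarrow> j < p \<Longrightarrow> f i * f j = f j * f i" for f :: "nat \<Rightarrow> 'a hecke" and p
    using that by (intro prod_list_rev) auto
  have "prod_list (map (\<lambda>i. Aw 0 m (y (p - 1 - i))) (rev [0..<p])) = prod_list (map (\<lambda>i. Aw 0 m (y (p - 1 - i))) [0..<p])"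
    by (rule A) (auto intro!: Aw_comm assms)
  also have "\<dots> = prod_list (map (\<lambda>i. Aw 0 m (y i)) (rev [0..<p]))"
    by (subst map_rev_upt[of "\<lambda>i. Aw 0 m (y i)"]) simp
  finally have 1: "prod_list (map (\<lambda>i. Aw 0 m (y (p - 1 - i))) (rev [0..<p])) = \<dots>" .
  have "prod_list (map (\<lambda>j. Bw 0 m (x (q - 1 - j))) [0..<q]) = prod_list (map (\<lambda>j. Bw 0 m (x j)) (rev [0..<q]))"
    by (subst map_rev_upt[of "\<lambda>i. Bw 0 m (x i)"]) simp
  also have "\<dots> = prod_list (map (\<lambda>j. Bw 0 m (x j)) [0..<q])"
    by (rule A) (auto intro!: Bw_comm assms)
  finally show ?thesis unfolding Hst_def 1 by simp
qed

section \<open>Extension of monoid homomorphisms to monoid rings\<close>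

definition lift :: "('a \<Rightarrow> 'r) \<Rightarrow> ('a::monoid_add \<Rightarrow>\<^sub>0 int) \<Rightarrow> 'r::ring_1" where
  "lift \<phi> f = (\<Sum>m\<in>Poly_Mapping.keys f. of_int (Poly_Mapping.lookup f m) * \<phi> m)"

lemma lift_add: "lift \<phi> (f + g) = lift \<phi> f + lift \<phi> g"
  unfolding lift_def
  using setsum_keys_plus_distrib[of "\<lambda>k c. of_int c * \<phi> k" f g] by (simp add: distrib_right)

lemma lift_0 [simp]: "lift \<phi> 0 = 0"
  by (simp add: lift_def)

lemma lift_single: "lift \<phi> (Poly_Mapping.single m c) = of_int c * \<phi> m"
  by (cases "c = 0") (simp_all add: lift_def)

lemma lift_diff: "lift \<phi> (f - g) = lift \<phi> f - lift \<phi> g"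
  using lift_add[of \<phi> "f - g" g] by (simp add: algebra_simps)

lemma lift_uminus: "lift \<phi> (- f) = - lift \<phi> f"
  using lift_diff[of \<phi> 0 f] by simp

context
  fixes \<phi> :: "'a::monoid_add \<Rightarrow> 'r::ring_1"
  assumes zero: "\<phi> 0 = 1" and plus: "\<And>a b. \<phi> (a + b) = \<phi> a * \<phi> b"
begin

lemma lift_1: "lift \<phi> 1 = 1"
  using lift_single[of \<phi> 0 1] zero by simp

lemma lift_mult: "lift \<phi> (f * g) = lift \<phi> f * lift \<phi> g"
proof (induction f rule: poly_mapping_add_induct)
  case (single m c)
  show ?case
  proof (induction g rule: poly_mapping_add_induct)
    case (single n d)
    have "\<phi> m * of_int d = of_int d * \<phi> m" by (simp add: mult_of_int_commute)
    then have "of_int c * \<phi> m * (of_int d * \<phi> n) = of_int c * of_int d * (\<phi> m * \<phi> n)"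
      by (metis mult.assoc)
    then show ?case by (simp add: mult_single lift_single plus)
  qed (simp_all add: lift_add distrib_left)
qed (simp_all add: lift_add distrib_right)

end

subsection \<open>The absolute Hecke product\<close>

text \<open>For the negated generators the quadratic relation says that they are idempotent, so
  these words obey the relations of \<open>weq\<close> without any signs.\<close>

definition hw :: "nat list \<Rightarrow> free_algebra" where
  "hw ks = prod_list (map (\<lambda>k. - hecke_s (Suc k)) ks)"

lemma hw_simps [simp]: "hw [] = 1" "hw (k # ks) = - hecke_s (Suc k) * hw ks" "hw (ks @ ls) = hw ks * hw ls"
  by (simp_all add: hw_def)

lemma hecke_ideal_0: "0 \<in> hecke_ideal"
  using hecke_ideal.diff[OF hecke_ideal.braid[of 1] hecke_ideal.braid[of 1]] by simp

lemma hecke_ideal_uminus: "x \<in> hecke_ideal \<Longrightarrow> - x \<in> hecke_ideal"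
  using hecke_ideal.diff[OF hecke_ideal_0] by fastforce

lemma hecke_ideal_add: "x \<in> hecke_ideal \<Longrightarrow> y \<in> hecke_ideal \<Longrightarrow> x + y \<in> hecke_ideal"
  using hecke_ideal.diff[of x "- y"] hecke_ideal_uminus[of y] by simp

lemma weq_hecke_eq: "weq ks ls \<Longrightarrow> hecke_eq (hw ks) (hw ls)"
proof (induction rule: weq.induct)
  case (weq_refl ks)
  then show ?case by (simp add: hecke_eq_def hecke_ideal_0)
next
  case (weq_sym ks ls)
  then show ?case unfolding hecke_eq_def using hecke_ideal_uminus by (metis minus_diff_eq)
next
  case (weq_trans ks ls ms)
  then show ?case unfolding hecke_eq_def using hecke_ideal_add by fastforce
next
  case (weq_ctx ks ls as bs)
  then have "hw as * (hw ks - hw ls) * hw bs \<in> hecke_ideal"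
    by (simp add: hecke_eq_def hecke_ideal.mult)
  then show ?case by (simp add: hecke_eq_def algebra_simps)
next
  case (weq_idem k)
  then show ?case using hecke_ideal.quadratic[of "Suc k"] by (simp add: hecke_eq_def)
next
  case (weq_comm k l)
  then show ?case using hecke_ideal.commute[of "Suc k" "Suc l"] by (simp add: hecke_eq_def)
next
  case (weq_braid k)
  then show ?case using hecke_ideal_uminus[OF hecke_ideal.braid[of "Suc k"]]
    by (simp add: hecke_eq_def mult.assoc)
qed

text \<open>This detects elements outside the ideal: it kills the ideal, but sends the basis
  elements, up to sign, to distinct monomials of the Demazure ring.\<close>

definition ev :: "free_algebra \<Rightarrow> hperm \<Rightarrow>\<^sub>0 int" where
  "ev = lift (\<lambda>u. prod_list (map (\<lambda>l. - Poly_Mapping.single (tau l) 1) (letters u)))"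

lemma ev_hom: "ev (f * g) = ev f * ev g" "ev 1 = 1" "ev (f - g) = ev f - ev g" "ev (- f) = - ev f"
  "ev (f + g) = ev f + ev g"
proof -
  let ?\<phi> = "\<lambda>u. prod_list (map (\<lambda>l. - Poly_Mapping.single (tau l) (1::int)) (letters u))"
  have *: "?\<phi> 0 = 1" "?\<phi> (a + b) = ?\<phi> a * ?\<phi> b" for a b
    by (simp_all add: zero_free_word_def plus_free_word_def)
  show "ev (f * g) = ev f * ev g" unfolding ev_def by (rule lift_mult) (rule *)+
  show "ev 1 = 1" unfolding ev_def by (rule lift_1) (rule *)+
qed (simp_all add: ev_def lift_diff lift_uminus lift_add)

lemma ev_hecke_s: "ev (hecke_s (Suc k)) = - Poly_Mapping.single (tau k) 1"
  by (simp add: ev_def hecke_s_def lift_single)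

lemma ev_hecke_s': "1 \<le> i \<Longrightarrow> ev (hecke_s i) = - Poly_Mapping.single (tau (i - 1)) 1"
  using ev_hecke_s[of "i - 1"] by simp

lemma ev_ideal: "x \<in> hecke_ideal \<Longrightarrow> ev x = 0"
proof (induction rule: hecke_ideal.induct)
  case (commute i j)
  then have "i - 1 + 2 \<le> j - 1" by simp
  then show ?case using commute tau_comm[of "i - 1" "j - 1"] by (simp add: ev_hom ev_hecke_s' mult_single)
next
  case (braid i)
  then show ?case using tau_braid[of "i - 1"] by (simp add: ev_hom ev_hecke_s' mult_single)
next
  case (quadratic i)
  then show ?case by (simp add: ev_hom ev_hecke_s' mult_single tau_idem)
qed (simp_all add: ev_hom)

lemma ev_hw: "ev (hw ks) = Poly_Mapping.single (to_hperm (dem ks)) 1"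
proof -
  have "ev (hw ks) = Poly_Mapping.single (sum_list (map tau ks)) 1"
    by (induction ks) (simp_all add: ev_hom ev_hecke_s mult_single)
  then show ?thesis by (simp add: tau_word)
qed

lemma hw_eq: "hw ks = (- 1) ^ length ks * prod_list (map (\<lambda>k. hecke_s (Suc k)) ks)"
proof (induction ks)
  case (Cons k ks)
  have "(- 1) ^ n * x = x * (- 1) ^ n" for n and x :: free_algebra
    by (cases "even n") simp_all
  from this[of "length ks" "hecke_s (Suc k)"] show ?case using Cons by (simp add: mult.assoc[symmetric])
qed simp

lemma transpose_adj: "1 \<le> i \<Longrightarrow> transpose i (Suc i) = adj (i - 1)"
  by (simp add: adj_def)

lemma hecke_basis_hw:
  assumes "finite_perm w"
  obtains ks where "redword ks w" "hecke_basis w = hw ks \<or> hecke_basis w = - hw ks"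
proof -
  obtain ls where ls: "redword ls w" using redword_exists[OF assms] by blast
  have w: "wprod (map (\<lambda>i. i - 1) is) = perm_prod (map (\<lambda>i. transpose i (Suc i)) is)"
    if "\<forall>i\<in>set is. 1 \<le> i" for "is"
    using that by (simp add: wprod_def transpose_adj cong: map_cong)
  have "reduced_word (map Suc ls) w"
    using ls w[of "map Suc ls"] unfolding reduced_word_def redword_def
    by (simp add: comp_def)
  then have "reduced_word (SOME is. reduced_word is w) w" by (rule someI)
  moreover define js where "js = (SOME is. reduced_word is w)"
  ultimately have r: "reduced_word js w" by simp
  define ks where "ks = map (\<lambda>i. i - 1) js"
  have "redword ks w" using r w[of js] by (simp add: ks_def redword_def reduced_word_def)
  moreover have "map (\<lambda>k. hecke_s (Suc k)) ks = map hecke_s js"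
    using r by (auto simp: ks_def reduced_word_def)
  then have "hecke_basis w = prod_list (map (\<lambda>k. hecke_s (Suc k)) ks)"
    by (simp add: hecke_basis_def js_def)
  then have "hecke_basis w = hw ks \<or> hecke_basis w = - hw ks"
    by (cases "even (length ks)") (simp_all add: hw_eq)
  ultimately show ?thesis using that by blast
qed

lemma hecke_eq_uminus: "hecke_eq x y \<Longrightarrow> hecke_eq (- x) (- y)"
  unfolding hecke_eq_def using hecke_ideal_uminus by fastforce

text \<open>Existence holds since words with equal Demazure product are congruent modulo the ideal;
  uniqueness since \<open>ev\<close> separates the basis elements.\<close>

lemma abs_hecke_prod_eq:
  assumes "\<And>u. u \<in> set us \<Longrightarrow> finite_perm u"
  shows "abs_hecke_prod us = of_hperm (sum_list (map to_hperm us))"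
proof -
  let ?P = "prod_list (map hecke_basis us)" and ?u = "of_hperm (sum_list (map to_hperm us))"
  have "\<exists>ks. dem ks = ?u \<and> (?P = hw ks \<or> ?P = - hw ks)"
    using assms
  proof (induction us)
    case Nil
    then show ?case by (intro exI[of _ "[]"]) simp
  next
    case (Cons u us)
    then have "\<exists>ks. dem ks = of_hperm (sum_list (map to_hperm us)) \<and>
      (prod_list (map hecke_basis us) = hw ks \<or> prod_list (map hecke_basis us) = - hw ks)"
      by (intro Cons.IH) simp
    then obtain ks where ks: "dem ks = of_hperm (sum_list (map to_hperm us))"
      "prod_list (map hecke_basis us) = hw ks \<or> prod_list (map hecke_basis us) = - hw ks" by blast
    have fu: "finite_perm u" using Cons by simp
    obtain ls where ls: "redword ls u" "hecke_basis u = hw ls \<or> hecke_basis u = - hw ls"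
      using hecke_basis_hw[OF fu] by blast
    have "dem (ls @ ks) = act ks u" using dem_redword[OF ls(1)] by simp
    also have "\<dots> = of_hperm (to_hperm u + sum_list (map to_hperm us))"
      using add_to_hperm_dem[of "to_hperm u" ks] fu ks(1) by (simp add: finite_perm_act)
    finally have "dem (ls @ ks) = of_hperm (sum_list (map to_hperm (u # us)))" by simp
    moreover have "prod_list (map hecke_basis (u # us)) = hw (ls @ ks) \<or>
      prod_list (map hecke_basis (u # us)) = - hw (ls @ ks)" using ks(2) ls(2) by auto
    ultimately show ?case by blast
  qed
  then obtain ks where ks: "dem ks = ?u" "?P = hw ks \<or> ?P = - hw ks" by blast
  have fu: "finite_perm ?u" by simp
  obtain ls where ls: "redword ls ?u" "hecke_basis ?u = hw ls \<or> hecke_basis ?u = - hw ls"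
    using hecke_basis_hw[OF fu] by blast
  have "hecke_eq (hw ks) (hw ls)"
    using weq_hecke_eq ks dem_redword[OF ls(1)] dem_eq_weq by metis
  then have ex: "hecke_eq ?P (hecke_basis ?u) \<or> hecke_eq ?P (- hecke_basis ?u)"
    using ks(2) ls(2) hecke_eq_uminus by (metis minus_minus)
  show ?thesis unfolding abs_hecke_prod_def
  proof (rule the_equality)
    show "finite_perm ?u \<and> (hecke_eq ?P (hecke_basis ?u) \<or> hecke_eq ?P (- hecke_basis ?u))"
      using ex by simp
  next
    fix w assume w: "finite_perm w \<and> (hecke_eq ?P (hecke_basis w) \<or> hecke_eq ?P (- hecke_basis w))"
    then obtain ms where ms: "redword ms w" "hecke_basis w = hw ms \<or> hecke_basis w = - hw ms"
      using hecke_basis_hw by blast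
    have "ev ?P = ev (hecke_basis w) \<or> ev ?P = ev (- hecke_basis w)"
      using w ev_ideal[of "?P - hecke_basis w"] ev_ideal[of "?P - - hecke_basis w"]
      unfolding hecke_eq_def by (auto simp only: ev_hom right_minus_eq)
    then have "ev (hw ks) = ev (hw ms) \<or> ev (hw ks) = - ev (hw ms)"
      using ks(2) ms(2) by (metis ev_hom(4) minus_minus)
    \<comment> \<open>Passing to supports discards the sign and keeps the permutation.\<close>
    then have "Poly_Mapping.keys (ev (hw ks)) = Poly_Mapping.keys (ev (hw ms))"
      by (auto simp: keys_minus)
    then have "to_hperm (dem ks) = to_hperm (dem ms)" by (simp add: ev_hw)
    then have "to_hperm ?u = to_hperm w" using ks dem_redword[OF ms(1)] by simp
    then show "w = ?u" using w by (simp add: to_hperm_eq_iff del: to_of_hperm)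
  qed
qed

subsection \<open>Substitution\<close>

definition monom_val :: "(nat \<Rightarrow> nat \<Rightarrow> 'k) \<Rightarrow> (nat \<Rightarrow>\<^sub>0 nat) \<Rightarrow> 'k::field" where
  "monom_val \<phi> m = (\<Prod>v\<in>Poly_Mapping.keys m. case_prod \<phi> (prod_decode v) ^ Poly_Mapping.lookup m v)"

lemma monom_val_superset:
  "finite A \<Longrightarrow> Poly_Mapping.keys m \<subseteq> A \<Longrightarrow>
    monom_val \<phi> m = (\<Prod>v\<in>A. case_prod \<phi> (prod_decode v) ^ Poly_Mapping.lookup m v)"
  unfolding monom_val_def by (rule prod.mono_neutral_left) (auto simp: in_keys_iff)

lemma monom_val_add: "monom_val \<phi> (a + b) = monom_val \<phi> a * monom_val \<phi> b"
proof -
  let ?A = "Poly_Mapping.keys a \<union> Poly_Mapping.keys b"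
  have "Poly_Mapping.keys (a + b) \<subseteq> ?A" by (rule Poly_Mapping.keys_add)
  then show ?thesis
    using monom_val_superset[of ?A a \<phi>] monom_val_superset[of ?A b \<phi>] monom_val_superset[of ?A "a + b" \<phi>]
    by (simp add: lookup_add power_add prod.distrib)
qed

lemma monom_val_0: "monom_val \<phi> 0 = 1"
  by (simp add: monom_val_def)

lemma poly_subst_lift: "poly_subst \<phi> = lift (monom_val \<phi>)"
  by (simp add: fun_eq_iff poly_subst_def lift_def monom_val_def)

lemma poly_subst_hom [simp]: "poly_subst \<phi> (f * g) = poly_subst \<phi> f * poly_subst \<phi> g"
  "poly_subst \<phi> 1 = 1" "poly_subst \<phi> 0 = 0" "poly_subst \<phi> (f + g) = poly_subst \<phi> f + poly_subst \<phi> g"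
  "poly_subst \<phi> (- f) = - poly_subst \<phi> f"
  unfolding poly_subst_lift
  by (rule lift_mult[OF monom_val_0 monom_val_add], rule lift_1[OF monom_val_0 monom_val_add])
    (simp_all add: lift_add lift_uminus)

lemma poly_subst_indet:
  "poly_subst \<phi> (Poly_Mapping.single (Poly_Mapping.single (prod_encode (c, p)) 1) 1) = \<phi> c p"
  by (simp add: poly_subst_lift lift_single monom_val_def)

text \<open>\<open>rat_subst\<close> is a definite description, so calculations go through this
  relation, which is functional and respects the field operations as long as no inverted value is
  0.\<close>

definition subst_rel :: "(nat \<Rightarrow> nat \<Rightarrow> 'k) \<Rightarrow> ratfun \<Rightarrow> 'k::field \<Rightarrow> bool" where
  "subst_rel \<phi> F y \<longleftrightarrow> (\<exists>f g. F = Fract f g \<and> poly_subst \<phi> g \<noteq> 0 \<and> y = poly_subst \<phi> f / poly_subst \<phi> g)"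

lemma subst_relE:
  assumes "subst_rel \<phi> F y"
  obtains f g where "F = Fract f g" "g \<noteq> 0" "poly_subst \<phi> g \<noteq> 0" "y = poly_subst \<phi> f / poly_subst \<phi> g"
  using assms unfolding subst_rel_def by (metis poly_subst_hom(3))

lemma subst_rel_unique: assumes "subst_rel \<phi> F y" "subst_rel \<phi> F z" shows "y = z"
proof -
  obtain f g f' g' where *: "F = Fract f g" "g \<noteq> 0" "poly_subst \<phi> g \<noteq> 0" "y = poly_subst \<phi> f / poly_subst \<phi> g"
    "F = Fract f' g'" "g' \<noteq> 0" "poly_subst \<phi> g' \<noteq> 0" "z = poly_subst \<phi> f' / poly_subst \<phi> g'"
    using assms by (metis subst_relE)
  then have "f * g' = f' * g" by (simp add: eq_fract)
  then have "poly_subst \<phi> f * poly_subst \<phi> g' = poly_subst \<phi> f' * poly_subst \<phi> g"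
    by (metis poly_subst_hom(1))
  then show ?thesis using * by (simp add: frac_eq_eq)
qed

lemma rat_subst_eq: "subst_rel \<phi> F y \<Longrightarrow> rat_subst \<phi> F = y"
  unfolding rat_subst_def subst_rel_def[symmetric]
  by (rule the_equality) (auto dest: subst_rel_unique)

lemma subst_rel_add: assumes "subst_rel \<phi> F y" "subst_rel \<phi> G z" shows "subst_rel \<phi> (F + G) (y + z)"
proof -
  obtain f g f' g' where *: "F = Fract f g" "g \<noteq> 0" "poly_subst \<phi> g \<noteq> 0" "y = poly_subst \<phi> f / poly_subst \<phi> g"
    "G = Fract f' g'" "g' \<noteq> 0" "poly_subst \<phi> g' \<noteq> 0" "z = poly_subst \<phi> f' / poly_subst \<phi> g'"
    using assms by (metis subst_relE)
  then show ?thesis unfolding subst_rel_def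
    by (intro exI[of _ "f * g' + f' * g"] exI[of _ "g * g'"]) (simp add: add_frac_eq)
qed

lemma subst_rel_mult: assumes "subst_rel \<phi> F y" "subst_rel \<phi> G z" shows "subst_rel \<phi> (F * G) (y * z)"
proof -
  obtain f g f' g' where *: "F = Fract f g" "g \<noteq> 0" "poly_subst \<phi> g \<noteq> 0" "y = poly_subst \<phi> f / poly_subst \<phi> g"
    "G = Fract f' g'" "g' \<noteq> 0" "poly_subst \<phi> g' \<noteq> 0" "z = poly_subst \<phi> f' / poly_subst \<phi> g'"
    using assms by (metis subst_relE)
  then show ?thesis unfolding subst_rel_def
    by (intro exI[of _ "f * f'"] exI[of _ "g * g'"]) simp
qed

lemma subst_rel_inverse: assumes "subst_rel \<phi> F y" "y \<noteq> 0" shows "subst_rel \<phi> (inverse F) (inverse y)"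
proof -
  obtain f g where *: "F = Fract f g" "g \<noteq> 0" "poly_subst \<phi> g \<noteq> 0" "y = poly_subst \<phi> f / poly_subst \<phi> g"
    using assms by (metis subst_relE)
  then show ?thesis unfolding subst_rel_def using assms(2)
    by (intro exI[of _ g] exI[of _ f]) simp
qed

lemma subst_rel_0: "subst_rel \<phi> 0 0" and subst_rel_1: "subst_rel \<phi> 1 1"
  unfolding subst_rel_def by (intro exI[of _ 0] exI[of _ 1], simp add: fract_collapse)
    (intro exI[of _ 1], simp add: fract_collapse)

lemma subst_rel_uminus: assumes "subst_rel \<phi> F y" shows "subst_rel \<phi> (- F) (- y)"
proof -
  obtain f g where *: "F = Fract f g" "g \<noteq> 0" "poly_subst \<phi> g \<noteq> 0" "y = poly_subst \<phi> f / poly_subst \<phi> g"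
    using assms by (metis subst_relE)
  then show ?thesis unfolding subst_rel_def
    by (intro exI[of _ "- f"] exI[of _ g]) simp
qed

lemma subst_rel_indet: "subst_rel \<phi> (indet c p) (\<phi> c p)"
  unfolding subst_rel_def indet_def 
  by (intro exI[of _ "Poly_Mapping.single (Poly_Mapping.single (prod_encode (c, p)) 1) 1"] exI[of _ 1])
    (simp add: poly_subst_indet del: One_nat_def)

lemma subst_rel_divide:
  "subst_rel \<phi> F y \<Longrightarrow> subst_rel \<phi> G z \<Longrightarrow> z \<noteq> 0 \<Longrightarrow> subst_rel \<phi> (F / G) (y / z)"
  by (simp add: divide_inverse subst_rel_mult subst_rel_inverse)

lemma subst_rel_diff: "subst_rel \<phi> F y \<Longrightarrow> subst_rel \<phi> G z \<Longrightarrow> subst_rel \<phi> (F - G) (y - z)"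
  using subst_rel_add[OF _ subst_rel_uminus] by fastforce

lemma indet_eq_iff: "indet c p = indet c' p' \<longleftrightarrow> c = c' \<and> p = p'"
proof
  assume "indet c p = indet c' p'"
  then have "Poly_Mapping.single (Poly_Mapping.single (prod_encode (c, p)) (1::nat)) (1::int)
      = Poly_Mapping.single (Poly_Mapping.single (prod_encode (c', p')) 1) 1"
    by (simp add: indet_def eq_fract)
  then have "Poly_Mapping.keys (Poly_Mapping.single (Poly_Mapping.single (prod_encode (c, p)) (1::nat)) (1::int))
      = Poly_Mapping.keys (Poly_Mapping.single (Poly_Mapping.single (prod_encode (c', p')) (1::nat)) (1::int))" by (rule arg_cong)
  then have "Poly_Mapping.keys (Poly_Mapping.single (prod_encode (c, p)) (1::nat))
      = Poly_Mapping.keys (Poly_Mapping.single (prod_encode (c', p')) (1::nat))" by simp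
  then show "c = c' \<and> p = p'" by simp
qed simp

lemma indet_nonzero [simp]: "indet c p \<noteq> 0"
  using subst_rel_unique[OF subst_rel_indet[of "\<lambda>_ _. 1 :: ratfun" c p]] subst_rel_0[of "\<lambda>_ _. 1 :: ratfun"] by force

text \<open>The coefficients of a word are polynomials in the coefficients of its letters, so
  substitution may be carried out letter by letter.\<close>

lemma coef_subst:
  assumes "finite_perm w"
    and "\<And>x. x \<in> set xs \<Longrightarrow> subst_rel \<phi> (a x) (a' x)" "\<And>x. x \<in> set xs \<Longrightarrow> subst_rel \<phi> (b x) (b' x)"
  shows "subst_rel \<phi> (coef (gprod (map (\<lambda>x. (k x, a x, b x)) xs)) w)
    (coef (gprod (map (\<lambda>x. (k x, a' x, b' x)) xs)) w)"
  using assms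
proof (induction xs arbitrary: w rule: rev_induct)
  case Nil
  then show ?case by (simp add: coef_1 subst_rel_0 subst_rel_1)
next
  case (snoc x xs)
  define w' where "w' = w \<circ> adj (k x)"
  have fw: "finite_perm w'" "finite_perm w" using snoc by (simp_all add: w'_def)
  have IH: "subst_rel \<phi> (coef (gprod (map (\<lambda>x. (k x, a x, b x)) xs)) v)
    (coef (gprod (map (\<lambda>x. (k x, a' x, b' x)) xs)) v)" if "finite_perm v" for v
    using snoc.prems that by (intro snoc.IH) auto
  have s: "subst_rel \<phi> (a x) (a' x)" "subst_rel \<phi> (b x) (b' x)" using snoc by auto
  show ?case
    using IH[OF fw(1)] IH[OF fw(2)] s
    by (simp add: coef_mult_lett[OF fw(2)] w'_def[symmetric] subst_rel_mult subst_rel_add)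
qed

lemma sign_ascent: "finite_perm w \<Longrightarrow> (- 1 :: 'a::ring_1) ^ perm_length (w \<circ> adj k) = - ((- 1) ^ perm_length w)"
  using perm_length_ascent[of w k] perm_length_descent[of w k] finite_perm_neq[of w "Suc k" "Suc (Suc k)"]
  by (cases "w (Suc k) < w (Suc (Suc k))") auto

subsection \<open>Staircase words\<close>

text \<open>The reading order of the crossings in \<open>tri\<close>. With indices from 0, the box
  (i, j) carries the letter i + j.\<close>

definition boxes :: "nat \<Rightarrow> (nat \<times> nat) list" where
  "boxes N = concat (map (\<lambda>i. map (\<lambda>j. (i, j)) [0..<N - 1 - i]) (rev [0..<N]))"

lemma set_boxes: "set (boxes N) = {(i, j). i + j + 1 < N}"
proof -
  have "(i, j) \<in> set (boxes N) \<longleftrightarrow> i + j + 1 < N" for i j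
    by (auto simp: boxes_def intro!: bexI[of _ i])
  then show ?thesis by auto
qed

lemma distinct_boxes: "distinct (boxes N)"
  unfolding boxes_def by (rule distinct_concat) (auto simp: distinct_map inj_on_def dest: arg_cong[where f = length])

lemma hrow_gprod: "hrow d m q y x = gprod (map (\<lambda>j. hl (d + j) (y / x j)) [0..<min q (m - d)])"
proof (induction q)
  case (Suc q)
  show ?case
  proof (cases "q < m - d")
    case True
    then have "min (Suc q) (m - d) = Suc q" "min q (m - d) = q" "d + q < m" by auto
    then show ?thesis using Suc by (simp add: hrow_def hm_def)
  next
    case False
    then have "min (Suc q) (m - d) = m - d" "min q (m - d) = m - d" "\<not> d + q < m" by auto
    then show ?thesis using Suc by (simp add: hrow_def hm_def)
  qed
qed (simp add: hrow_def)

lemma tri_gprod: "tri N X Y = gprod (map (\<lambda>(i, j). hl (i + j) (Y i / X j)) (boxes N))"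
proof -
  have "hrow (0 + i) (N - 1) N (Y i) X = gprod (map (\<lambda>(i, j). hl (i + j) (Y i / X j)) (map (\<lambda>j. (i, j)) [0..<N - 1 - i]))" for i
    unfolding hrow_gprod by (simp add: comp_def min_def)
  then show ?thesis unfolding tri_grid grid_def boxes_def map_concat map_map comp_def gprod_concat by simp
qed

text \<open>Exchange of two consecutive blocks of lengths a and b behind the first c positions. The
  factors of z(r) and the permutations delta_j all have this shape.\<close>

definition bswap :: "nat \<Rightarrow> nat \<Rightarrow> nat \<Rightarrow> nat \<Rightarrow> nat" where
  "bswap c a b p = (if c < p \<and> p \<le> c + a then p + b else if c + a < p \<and> p \<le> c + a + b then p - a else p)"

lemma redword_row:
  assumes "redword ks w" "\<And>p. Suc c < p \<Longrightarrow> p \<le> Suc (c + a) \<Longrightarrow> w (Suc c) < w p"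
  shows "redword (ks @ [c..<c + a]) (w \<circ> bswap c a 1)"
  using assms(2)
proof (induction a)
  case 0
  have "bswap c 0 1 = id" by (auto simp: bswap_def)
  then show "redword (ks @ [c..<c + 0]) (w \<circ> bswap c 0 1)" using assms(1) by simp
next
  case (Suc a)
  have IH: "redword (ks @ [c..<c + a]) (w \<circ> bswap c a 1)" by (rule Suc.IH) (simp add: Suc.prems)
  have e: "w \<circ> bswap c (Suc a) 1 \<circ> adj (c + a) = w \<circ> bswap c a 1"
    by (auto simp: fun_eq_iff bswap_def adj_apply)
  have d: "(w \<circ> bswap c (Suc a) 1) (Suc (Suc (c + a))) < (w \<circ> bswap c (Suc a) 1) (Suc (c + a))"
    using Suc.prems[of "Suc (Suc (c + a))"] by (simp add: bswap_def)
  have "redword ((ks @ [c..<c + a]) @ [c + a]) (w \<circ> bswap c (Suc a) 1)"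
    unfolding redword_snoc_iff e using IH d by simp
  then show "redword (ks @ [c..<c + Suc a]) (w \<circ> bswap c (Suc a) 1)" by simp
qed

lemma boxes_redword: "redword (map (\<lambda>(i, j). i + j) (boxes N)) (longest_perm N)"
proof -
  \<comment> \<open>\<open>R i\<close> reverses the positions i + 1, ..., N. Row i moves the entry
    at position i + 1, which is the smallest of the interval, to its end.\<close>
  define R where "R i p = (if i < p \<and> p \<le> N then N + 1 + i - p else p)" for i p
  have "redword (concat (map (\<lambda>i. [i..<N - 1]) (rev [i..<N]))) (R i)" if "i \<le> N" for i
    using that
  proof (induction i rule: inc_induct)
    case base
    have "R N = id" by (auto simp: R_def)
    then show "redword (concat (map (\<lambda>i. [i..<N - 1]) (rev [N..<N]))) (R N)" by (simp add: redword_def)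
  next
    case (step i)
    have "redword (concat (map (\<lambda>i. [i..<N - 1]) (rev [Suc i..<N])) @ [i..<i + (N - 1 - i)])
        (R (Suc i) \<circ> bswap i (N - 1 - i) 1)"
      by (rule redword_row[OF step.IH]) (auto simp: R_def)
    moreover have "R (Suc i) \<circ> bswap i (N - 1 - i) 1 = R i"
    proof
      fix p
      have "i < N" by fact
      then consider "p \<le> i" | "i < p" "p < N" | "p = N" | "N < p" by linarith
      then show "(R (Suc i) \<circ> bswap i (N - 1 - i) 1) p = R i p"
        using \<open>i < N\<close> by cases (auto simp: R_def bswap_def)
    qed
    ultimately show "redword (concat (map (\<lambda>i. [i..<N - 1]) (rev [i..<N]))) (R i)"
      using step.hyps by (simp add: upt_rec[of i N])
  qed
  from this[of 0] have "redword (concat (map (\<lambda>i. [i..<N - 1]) (rev [0..<N]))) (R 0)" by simp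
  moreover have "R 0 = longest_perm N" by (auto simp: R_def longest_perm_def)
  moreover have "map (\<lambda>(i, j). i + j) (boxes N) = concat (map (\<lambda>i. [i..<N - 1]) (rev [0..<N]))"
  proof -
    have "map (\<lambda>j. i + j) [0..<N - 1 - i] = [i..<N - 1]" for i
      by (rule nth_equalityI) auto
    then show ?thesis unfolding boxes_def map_concat map_map comp_def by simp
  qed
  ultimately show ?thesis by simp
qed

lemma coef_gprod_short: "finite_perm w \<Longrightarrow> length L < perm_length w \<Longrightarrow> coef (gprod L) w = 0"
proof (induction L arbitrary: w rule: rev_induct)
  case Nil
  then have "w \<noteq> id" using perm_length_id by (metis not_less_zero)
  then show "coef (gprod []) w = 0" using Nil by (simp add: coef_1)
next
  case (snoc x L)
  obtain k a b where x: "x = (k, a, b)" by (cases x)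
  define w' where "w' = w \<circ> adj k"
  have w': "finite_perm w'" using snoc by (simp add: w'_def)
  have "coef (gprod L) w = 0" using snoc by simp
  moreover have "coef (gprod L) w' = 0" if "\<not> w (Suc k) < w (Suc (Suc k))"
  proof (rule snoc.IH[OF w'])
    have "w (Suc (Suc k)) < w (Suc k)" using that finite_perm_neq[OF snoc.prems(1)]
      by (metis linorder_neqE_nat n_not_Suc_n)
    then show "length L < perm_length w'"
      using perm_length_descent snoc.prems by (fastforce simp: w'_def)
  qed
  ultimately show ?case using snoc.prems by (simp add: x coef_mult_lett w'_def[symmetric])
qed

text \<open>A reduced word has no letter to spare, so each letter contributes its coefficient at
  \<open>tau\<close>.\<close>

lemma coef_gprod_redword: "redword (map fst L) w \<Longrightarrow> coef (gprod L) w = prod_list (map (\<lambda>x. snd (snd x)) L)"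
proof (induction L arbitrary: w rule: rev_induct)
  case Nil
  then have "w = id" by (simp add: redword_def)
  then show "coef (gprod []) w = prod_list (map (\<lambda>x. snd (snd x)) [])" by (simp add: coef_1)
next
  case (snoc x L)
  obtain k a b where x: "x = (k, a, b)" by (cases x)
  have fw: "finite_perm w" using snoc redword_finite_perm by blast
  have r: "redword (map fst L) (w \<circ> adj k)" "w (Suc (Suc k)) < w (Suc k)"
    using snoc.prems by (auto simp: x redword_snoc_iff)
  have "length L < perm_length w" using snoc.prems by (simp add: redword_def)
  then have "coef (gprod L) w = 0" using coef_gprod_short fw by blast
  moreover have "coef (gprod L) (w \<circ> adj k) = prod_list (map (\<lambda>x. snd (snd x)) L)" by (rule snoc.IH) (rule r(1))
  ultimately show ?case using r fw by (simp add: x coef_mult_lett)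
qed

subsection \<open>Grothendieck polynomials as coefficients\<close>

text \<open>The sign accounts for \<open>tau\<close> being the negative of a generator.\<close>

definition groth :: "nat \<Rightarrow> (nat \<Rightarrow> nat) \<Rightarrow> ratfun" where
  "groth N w = (- 1) ^ perm_length w * coef (tri N (\<lambda>j. avar (Suc j)) (\<lambda>i. bvar (Suc i))) w"

lemma subst_rel_sign: "subst_rel \<phi> ((- 1) ^ n) ((- 1) ^ n)"
  by (induction n) (use subst_rel_1 in \<open>auto intro: subst_rel_uminus\<close>)

lemma ab_subst_groth:
  assumes "finite_perm w" "\<And>j. j + 1 < N \<Longrightarrow> \<alpha> (Suc j) \<noteq> 0"
  shows "ab_subst \<alpha> \<beta> (groth N w) = (- 1) ^ perm_length w * coef (tri N (\<lambda>j. \<alpha> (Suc j)) (\<lambda>i. \<beta> (Suc i))) w"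
  unfolding ab_subst_def groth_def
proof (intro rat_subst_eq subst_rel_mult subst_rel_sign)
  let ?\<phi> = "\<lambda>c p. if c = 0 then \<alpha> p else \<beta> p"
  have "subst_rel ?\<phi> (case x of (i, j) \<Rightarrow> bvar (Suc i) / avar (Suc j) - 1)
      (case x of (i, j) \<Rightarrow> \<beta> (Suc i) / \<alpha> (Suc j) - 1)" if "x \<in> set (boxes N)" for x
  proof -
    obtain i j where x: "x = (i, j)" by (cases x)
    have "\<alpha> (Suc j) \<noteq> 0" using that assms(2) by (simp add: x set_boxes)
    then show ?thesis unfolding x
      using subst_rel_diff[OF subst_rel_divide[OF subst_rel_indet[of ?\<phi> 1 "Suc i"] subst_rel_indet[of ?\<phi> 0 "Suc j"]] subst_rel_1]
      by simp
  qed
  then have "subst_rel ?\<phi>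
      (coef (gprod (map (\<lambda>x. (case x of (i, j) \<Rightarrow> i + j, 1, case x of (i, j) \<Rightarrow> bvar (Suc i) / avar (Suc j) - 1)) (boxes N))) w)
      (coef (gprod (map (\<lambda>x. (case x of (i, j) \<Rightarrow> i + j, 1, case x of (i, j) \<Rightarrow> \<beta> (Suc i) / \<alpha> (Suc j) - 1)) (boxes N))) w)"
    by (intro coef_subst assms(1)) (auto intro: subst_rel_1)
  then show "subst_rel ?\<phi> (coef (tri N (\<lambda>j. avar (Suc j)) (\<lambda>i. bvar (Suc i))) w)
      (coef (tri N (\<lambda>j. \<alpha> (Suc j)) (\<lambda>i. \<beta> (Suc i))) w)"
    unfolding tri_gprod hl_def by (simp add: case_prod_unfold)
qed

lemma prod_list_uminus:
  "prod_list (map (\<lambda>x. - f x) xs) = (- 1) ^ length xs * prod_list (map f xs :: 'a::comm_ring_1 list)"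
  by (induction xs) simp_all

lemma groth_longest:
  "groth N (longest_perm N) = (\<Prod>(p, q)\<in>{(p, q). 1 \<le> p \<and> 1 \<le> q \<and> p + q \<le> N}. 1 - bvar p / avar q)"
proof -
  let ?f = "\<lambda>(i, j). 1 - bvar (Suc i) / avar (Suc j)"
  let ?L = "map (\<lambda>(i, j). hl (i + j) (bvar (Suc i) / avar (Suc j))) (boxes N)"
  have f: "map fst ?L = map (\<lambda>(i, j). i + j) (boxes N)" by (simp add: case_prod_unfold comp_def)
  have "coef (gprod ?L) (longest_perm N) = prod_list (map (\<lambda>x. snd (snd x)) ?L)"
    using boxes_redword[of N] unfolding f[symmetric] by (rule coef_gprod_redword)
  also have "\<dots> = prod_list (map (\<lambda>x. - ?f x) (boxes N))"
    by (simp add: case_prod_unfold comp_def hl_def)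
  also have "\<dots> = (- 1) ^ length (boxes N) * prod_list (map ?f (boxes N))"
    by (rule prod_list_uminus)
  finally have "coef (gprod ?L) (longest_perm N) = (- 1) ^ length (boxes N) * prod_list (map ?f (boxes N))" .
  moreover have "length (boxes N) = perm_length (longest_perm N)" using boxes_redword[of N] by (simp add: redword_def)
  ultimately have "groth N (longest_perm N) = prod_list (map ?f (boxes N))"
    unfolding groth_def tri_gprod by (simp add: power_add[symmetric])
  also have "\<dots> = prod ?f {(i, j). i + j + 1 < N}"
    using prod.distinct_set_conv_list[OF distinct_boxes, of ?f N] by (simp add: set_boxes)
  also have "\<dots> = (\<Prod>(p, q)\<in>{(p, q). 1 \<le> p \<and> 1 \<le> q \<and> p + q \<le> N}. 1 - bvar p / avar q)"
    by (rule prod.reindex_bij_witness[of _ "\<lambda>(p, q). (p - 1, q - 1)" "\<lambda>(i, j). (Suc i, Suc j)"]) auto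
  finally show ?thesis .
qed

lemma is_grothendieck_family_groth: "is_grothendieck_family N (groth N)"
  unfolding is_grothendieck_family_def Let_def
proof (intro conjI allI impI groth_longest)
  fix w i assume a: "w permutes {1..N} \<and> 1 \<le> i \<and> i < N \<and> w i < w (i + 1)"
  then obtain k where k: "i = Suc k" by (cases i) auto
  have s: "transpose i (i + 1) = adj k" by (simp add: k adj_def)
  have fw: "finite_perm w" using a by (auto simp: finite_perm_def)
  define w' where "w' = w \<circ> adj k"
  have fw': "finite_perm w'" using fw by (simp add: w'_def)
  have w: "w' \<circ> adj k = w" by (simp add: w'_def)
  have desc: "\<not> w' (Suc k) < w' (Suc (Suc k))" using a by (simp add: w'_def k)
  let ?X = "\<lambda>j. avar (Suc j)" and ?Y = "\<lambda>i. bvar (Suc i)"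
  let ?c = "?X k / ?X (Suc k)"
  have X: "?X \<circ> transpose k (Suc k) = (\<lambda>j. avar (adj k (Suc j)))"
    by (auto simp: fun_eq_iff adj_apply transpose_def)
  have "coef (tri N ?X ?Y * h k ?c) w' = coef (tri N (?X \<circ> transpose k (Suc k)) ?Y) w'"
    using tri_swap[of k N ?X ?Y] a k by simp
  \<comment> \<open>At the descent k of \<open>w'\<close> the additional letter mixes the
    coefficients at \<open>w'\<close> and \<open>w\<close>; solving for the one at \<open>w\<close>
    gives the recursion.\<close>
  then have 1: "?c * coef (tri N ?X ?Y) w' + (?c - 1) * coef (tri N ?X ?Y) w =
      coef (tri N (\<lambda>j. avar (adj k (Suc j))) ?Y) w'"
    unfolding h_def X using desc by (simp add: coef_mult_lett[OF fw'] w)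
  have 2: "ab_subst (\<lambda>p. avar (adj k p)) bvar (groth N w') =
      (- 1) ^ perm_length w' * coef (tri N (\<lambda>j. avar (adj k (Suc j))) ?Y) w'"
    by (rule ab_subst_groth[OF fw']) simp
  have sg: "(- 1 :: ratfun) ^ perm_length w' = - ((- 1) ^ perm_length w)"
    unfolding w'_def by (rule sign_ascent[OF fw])
  have nz: "avar (Suc (Suc k)) \<noteq> 0" by simp
  show "(avar i - avar (i + 1)) * groth N w =
     avar i * groth N (w \<circ> transpose i (i + 1)) -
     avar (i + 1) * ab_subst (\<lambda>p. avar (transpose i (i + 1) p)) bvar (groth N (w \<circ> transpose i (i + 1)))"
    unfolding s w'_def[symmetric] 2 1[symmetric] unfolding groth_def sg k
    using nz by (simp add: field_simps)
qed

lemma longest_perm_permutes: "longest_perm N permutes {1..N}"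
  by (rule bij_imp_permutes, rule bij_betwI[of _ _ _ "longest_perm N"]) (auto simp: longest_perm_def)

lemma longest_perm_invol: "longest_perm N \<circ> longest_perm N = id" "longest_perm N (longest_perm N p) = p"
  by (auto simp: longest_perm_def fun_eq_iff)

lemma finite_perm_longest [simp]: "finite_perm (longest_perm N)"
  using longest_perm_permutes finite_perm_def by blast

text \<open>Reversing the positions turns a permutation without ascents into one without
  descents.\<close>

lemma ex_ascent:
  assumes "w permutes {1..N}" "w \<noteq> longest_perm N"
  obtains i where "1 \<le> i" "i < N" "w i < w (i + 1)"
proof (rule ccontr)
  assume a: "\<not> thesis"
  let ?v = "w \<circ> longest_perm N"
  have fw: "finite_perm w" using assms by (auto simp: finite_perm_def)
  have "?v (Suc k) < ?v (Suc (Suc k))" for k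
  proof -
    consider "k + 2 \<le> N" | "k + 1 = N" | "N \<le> k" by linarith
    then show ?thesis
    proof cases
      case 1
      then have "1 \<le> N - 1 - k" "N - 1 - k < N" by auto
      then have "\<not> w (N - 1 - k) < w (N - 1 - k + 1)" using a that by blast
      moreover have "N - 1 - k + 1 = N - k" using 1 by simp
      moreover have "w (N - 1 - k) \<noteq> w (N - k)" using 1 finite_perm_neq[OF fw] by auto
      ultimately show ?thesis using 1 by (simp add: longest_perm_def)
    next
      case 2
      have "w 1 \<in> {1..N}" using 2 permutes_in_image[OF assms(1), of 1] by simp
      moreover have "w (Suc N) = Suc N" using permutes_not_in[OF assms(1)] by simp
      ultimately show ?thesis using 2 by (simp add: longest_perm_def)
    next
      case 3
      then show ?thesis using permutes_not_in[OF assms(1)] by (simp add: longest_perm_def)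
    qed
  qed
  then have "?v = id" using no_descent_id finite_perm_comp[OF fw finite_perm_longest] by blast
  then have "w = longest_perm N" by (metis comp_assoc comp_id id_comp longest_perm_invol(1))
  then show False using assms by simp
qed

lemma perm_length_bound: assumes "w permutes {1..N}" shows "perm_length w \<le> Suc N * Suc N"
proof -
  have *: "q \<le> N" if "p < q" "w q < w p" for p q
  proof (rule ccontr)
    assume "\<not> q \<le> N"
    then have "w q = q" using assms by (auto simp: permutes_def)
    have "w p \<le> max p N"
      using permutes_in_image[OF assms, of p] permutes_not_in[OF assms, of p] by (cases "p \<in> {1..N}") auto
    then show False using that \<open>w q = q\<close> \<open>\<not> q \<le> N\<close> by auto
  qed
  have "{(p, q). p < q \<and> w q < w p} \<subseteq> {..N} \<times> {..N}" using * by force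
  then have "perm_length w \<le> card ({..N} \<times> {..N})" unfolding perm_length_def by (rule card_mono[rotated]) simp
  then show ?thesis by (simp add: card_cartesian_product)
qed

text \<open>Downward induction on length: the value at w is determined by that at the longer w s_i,
  because the difference of two distinct variables is invertible.\<close>

lemma grothendieck_family_unique:
  assumes "is_grothendieck_family N F" "is_grothendieck_family N G" "w permutes {1..N}"
  shows "F w = G w"
  using assms(3)
proof (induction "Suc N * Suc N - perm_length w" arbitrary: w rule: less_induct)
  case less
  show ?case
  proof (cases "w = longest_perm N")
    case True
    then show ?thesis using assms by (simp add: is_grothendieck_family_def)
  next
    case False
    then obtain i where i: "1 \<le> i" "i < N" "w i < w (i + 1)" using ex_ascent less.prems by blast
    then obtain k where k: "i = Suc k" by (cases i) auto
    have s: "transpose i (i + 1) = adj k" by (simp add: k adj_def)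
    let ?w = "w \<circ> adj k"
    have p: "?w permutes {1..N}" using i k by (intro permutes_compose less.prems adj_permutes) simp
    have "finite_perm w" using less.prems by (auto simp: finite_perm_def)
    then have "perm_length ?w = Suc (perm_length w)" using i k by (intro perm_length_ascent) simp_all
    then have "F ?w = G ?w" using perm_length_bound[OF p] by (intro less.hyps p) simp
    moreover have "(avar i - avar (i + 1)) * H w = avar i * H ?w - avar (i + 1) * ab_subst (\<lambda>p. avar (adj k p)) bvar (H ?w)"
      if "is_grothendieck_family N H" for H
      using that i less.prems unfolding is_grothendieck_family_def Let_def s[symmetric] by blast
    ultimately have "(avar i - avar (i + 1)) * F w = (avar i - avar (i + 1)) * G w"
      using assms by metis
    moreover have "avar i - avar (i + 1) \<noteq> 0" by (simp add: indet_eq_iff)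
    ultimately show ?thesis by simp
  qed
qed

lemma grothendieck_groth: "w permutes {1..N} \<Longrightarrow> grothendieck N w = groth N w"
  unfolding grothendieck_def
  by (rule the_equality) (use is_grothendieck_family_groth grothendieck_family_unique in blast)+

lemma grothendieck_at_coef:
  assumes "w permutes {1..N}" "\<And>j. j + 1 < N \<Longrightarrow> as ! j \<noteq> 0"
  shows "grothendieck_at N w as bs = (- 1) ^ perm_length w * coef (tri N (nth as) (nth bs)) w"
proof -
  have "finite_perm w" using assms by (auto simp: finite_perm_def)
  then show ?thesis
    unfolding grothendieck_at_def grothendieck_groth[OF assms(1)]
    using ab_subst_groth[of w N "\<lambda>p. as ! (p - 1)" "\<lambda>p. bs ! (p - 1)"] assms(2) by simp
qed

lemma upt_split: "a \<le> b \<Longrightarrow> b \<le> c \<Longrightarrow> [a..<c] = [a..<b] @ [b..<c]"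
  by (metis le_Suc_ex upt_add_eq_append)

text \<open>Only the parity of lengths enters the signs, so words need not be reduced here.\<close>

lemma sign_wprod: "(- 1 :: 'a::ring_1) ^ perm_length (wprod ks) = (- 1) ^ length ks"
proof (induction ks rule: rev_induct)
  case Nil
  show "(- 1 :: 'a) ^ perm_length (wprod []) = (- 1) ^ length []" by simp
next
  case (snoc k ks)
  then show "(- 1 :: 'a) ^ perm_length (wprod (ks @ [k])) = (- 1) ^ length (ks @ [k])"
    using sign_ascent[of "wprod ks" k, where 'a = 'a] by simp
qed

lemma sign_comp:
  assumes "finite_perm u" "finite_perm v"
  shows "(- 1 :: 'a::ring_1) ^ perm_length (u \<circ> v) = (- 1) ^ perm_length u * (- 1) ^ perm_length v"
proof -
  obtain ks ls where "u = wprod ks" "v = wprod ls"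
    using redword_exists assms by (metis redword_def)
  then show ?thesis using sign_wprod[of "ks @ ls", where 'a = 'a] sign_wprod[of ks, where 'a = 'a] sign_wprod[of ls, where 'a = 'a]
    by (simp add: power_add)
qed

lemma coef_snoc_nonzero:
  assumes "finite_perm w" "coef (gprod (L @ [(k, a, b)])) w \<noteq> 0"
  shows "coef (gprod L) w \<noteq> 0 \<or> b \<noteq> 0 \<and> coef (gprod L) (w \<circ> adj k) \<noteq> 0"
  using assms by (auto simp: coef_mult_lett split: if_splits)

subsection \<open>Stable Grothendieck polynomials\<close>

text \<open>A permutation that fixes 1, ..., m ascends at every letter below m, and there a letter
  with scalar part 1 does not affect the coefficient.\<close>

lemma coef_restrict:
  assumes "finite_perm w" "\<And>p. p \<le> m \<Longrightarrow> w p = p" "\<And>x. x \<in> set L \<Longrightarrow> fst (snd x) = 1"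
  shows "coef (gprod L) w = coef (gprod (filter (\<lambda>x. m \<le> fst x) L)) w"
  using assms
proof (induction L arbitrary: w rule: rev_induct)
  case (snoc x L)
  obtain k b where x: "x = (k, 1, b)" using snoc.prems(3)[of x] by (cases x) auto
  define w' where "w' = w \<circ> adj k"
  have fw: "finite_perm w" "finite_perm w'" using snoc.prems by (simp_all add: w'_def)
  have L: "\<And>y. y \<in> set L \<Longrightarrow> fst (snd y) = 1" using snoc.prems by simp
  have w: "coef (gprod L) w = coef (gprod (filter (\<lambda>x. m \<le> fst x) L)) w"
    using snoc.prems L by (intro snoc.IH) auto
  show ?case
  proof (cases "m \<le> k")
    case True
    then have "coef (gprod L) w' = coef (gprod (filter (\<lambda>x. m \<le> fst x) L)) w'"
      using snoc.prems(2) L by (intro snoc.IH fw) (auto simp: w'_def)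
    then show ?thesis using True fw w by (simp add: x coef_mult_lett w'_def)
  next
    case False
    have 1: "w (Suc k) = Suc k" using snoc.prems(2) False by simp
    have "w (Suc (Suc k)) > Suc k"
    proof (rule ccontr)
      assume "\<not> w (Suc (Suc k)) > Suc k"
      then have "w (w (Suc (Suc k))) = w (Suc (Suc k))" using snoc.prems(2) False by simp
      then show False using finite_perm_neq[OF fw(1)] \<open>\<not> w (Suc (Suc k)) > Suc k\<close> by auto
    qed
    then show ?thesis using False fw w 1 by (simp add: x coef_mult_lett)
  qed
qed simp

lemma shift_perm_comp: "shift_perm m w \<circ> adj (k + m) = shift_perm m (w \<circ> adj k)"
proof
  fix p
  show "(shift_perm m w \<circ> adj (k + m)) p = shift_perm m (w \<circ> adj k) p"
  proof (cases "p \<le> m")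
    case True
    then show ?thesis by (simp add: shift_perm_def)
  next
    case False
    then obtain q where q: "p = q + m" "0 < q" by (metis add.commute le_add_diff_inverse nat_le_linear not_le zero_less_diff)
    then show ?thesis by (auto simp: shift_perm_def adj_apply)
  qed
qed

lemma shift_perm_id: "shift_perm m id = id"
  by (auto simp: shift_perm_def)

lemma shift_perm_wprod: "shift_perm m (wprod ks) = wprod (map (\<lambda>k. k + m) ks)"
proof (induction ks rule: rev_induct)
  case Nil
  show "shift_perm m (wprod []) = wprod (map (\<lambda>k. k + m) [])" by (simp add: shift_perm_id)
next
  case (snoc k ks)
  then show "shift_perm m (wprod (ks @ [k])) = wprod (map (\<lambda>k. k + m) (ks @ [k]))"
    by (simp add: shift_perm_comp[symmetric])
qed

lemma shift_perm_sign:
  assumes "finite_perm w"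
  shows "finite_perm (shift_perm m w)" "(- 1 :: 'a::ring_1) ^ perm_length (shift_perm m w) = (- 1) ^ perm_length w"
proof -
  obtain ks where "w = wprod ks" using redword_exists assms by (metis redword_def)
  then show "finite_perm (shift_perm m w)" "(- 1 :: 'a::ring_1) ^ perm_length (shift_perm m w) = (- 1) ^ perm_length w"
    by (simp_all add: shift_perm_wprod sign_wprod)
qed

lemma coef_shift:
  assumes "finite_perm w"
  shows "coef (gprod (map (\<lambda>(k, a, b). (k + m, a, b)) L)) (shift_perm m w) = coef (gprod L) w"
  using assms
proof (induction L arbitrary: w rule: rev_induct)
  case Nil
  have "shift_perm m w = id \<longleftrightarrow> w = id"
  proof
    assume s: "shift_perm m w = id"
    show "w = id"
    proof
      fix p
      have "shift_perm m w (p + m) = p + m" using s by simp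
      then show "w p = id p" using finite_perm_0[OF Nil] by (cases p) (auto simp: shift_perm_def)
    qed
  qed (simp add: shift_perm_id)
  then show ?case using Nil shift_perm_sign(1)[OF Nil] by (simp add: coef_1)
next
  case (snoc x L)
  obtain k a b where x: "x = (k, a, b)" by (cases x)
  define w' where "w' = w \<circ> adj k"
  have fw: "finite_perm w" "finite_perm w'" using snoc by (simp_all add: w'_def)
  have s: "shift_perm m w (Suc (k + m)) = w (Suc k) + m" "shift_perm m w (Suc (Suc (k + m))) = w (Suc (Suc k)) + m"
    by (simp_all add: shift_perm_def Suc_diff_le)
  show ?case
    using snoc.IH[OF fw(1)] snoc.IH[OF fw(2)] shift_perm_sign(1)[OF fw(1), of m] fw(1)
    by (simp add: x coef_mult_lett shift_perm_comp w'_def[symmetric] s)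
qed

lemma prod_list_all_1: "(\<And>x. x \<in> set xs \<Longrightarrow> x = 1) \<Longrightarrow> prod_list xs = (1 :: 'a::monoid_mult)"
  by (induction xs) auto

lemma AB_1 [simp]: "Aw i m 1 = 1" "Bw i m 1 = 1"
  unfolding Aw_def Bw_def gprod_def by (auto intro!: prod_list_all_1)

lemma Arow_trunc: assumes "p \<le> p'" "\<And>i. p \<le> i \<Longrightarrow> i < p' \<Longrightarrow> y i = 1" shows "Arow d m p' y = Arow d m p y"
proof -
  have "[0..<p'] = [0..<p] @ [p..<p']" using assms by (intro upt_split) auto
  moreover have "prod_list (map (\<lambda>i. Aw (d + i) m (y i)) (rev [p..<p'])) = 1"
    using assms by (intro prod_list_all_1) auto
  ultimately show ?thesis by (simp add: Arow_def)
qed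

lemma Bcol_trunc: assumes "q \<le> q'" "\<And>i. q \<le> i \<Longrightarrow> i < q' \<Longrightarrow> x i = 1" shows "Bcol d m q' x = Bcol d m q x"
proof -
  have "[0..<q'] = [0..<q] @ [q..<q']" using assms by (intro upt_split) auto
  moreover have "prod_list (map (\<lambda>i. Bw (d + i) m (x i)) [q..<q']) = 1"
    using assms by (intro prod_list_all_1) auto
  ultimately show ?thesis by (simp add: Bcol_def)
qed

text \<open>At a permutation fixing \<open>1, \<dots>, m\<close> only the letters from \<open>m\<close> on matter.\<close>

lemma coef_tri_stable:
  assumes w: "finite_perm w" and pq: "p \<le> m" "q \<le> m"
    and "\<And>i. p \<le> i \<Longrightarrow> i < m + k \<Longrightarrow> Y i = 1" "\<And>i. q \<le> i \<Longrightarrow> i < m + k \<Longrightarrow> X i = 1"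
  shows "coef (tri (m + k) X Y) (shift_perm m w) = coef (Hst (k - 1) p q Y X) w"
proof -
  let ?M = "m + k - 1"
  let ?A = "\<lambda>l u i. map (\<lambda>k. hl k (Y i)) [l i..<u]"
  let ?B = "\<lambda>l u j. map (\<lambda>k. hl k (1 / X j)) (rev [l j..<u])"
  let ?W = "\<lambda>l u. concat (map (?A l u) (rev [0..<p])) @ concat (map (?B l u) [0..<q])"
  have "tri (m + k) X Y = Arow 0 ?M p Y * Bcol 0 ?M q X"
    unfolding tri_def using assms by (simp add: Arow_trunc[of p "m + k"] Bcol_trunc[of q "m + k"])
  also have "\<dots> = gprod (?W (\<lambda>i. i) ?M)"
    by (simp add: gprod_concat Arow_def Bcol_def Aw_def Bw_def)
  finally have T: "tri (m + k) X Y = gprod (?W (\<lambda>i. i) ?M)" .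
  have f: "filter (\<lambda>i. m \<le> i) [j..<?M] = [m..<?M]" if "j \<le> m" for j
  proof (cases "m \<le> ?M")
    case True
    then have "[j..<?M] = [j..<m] @ [m..<?M]" using that True by (intro upt_split)
    then show ?thesis by (simp add: filter_False)
  qed simp
  have fA: "filter (\<lambda>x. m \<le> fst x) (?A (\<lambda>i. i) ?M i) = ?A (\<lambda>_. m) ?M i" if "i < p" for i
    using f[of i] that pq by (simp add: filter_map comp_def)
  have fB: "filter (\<lambda>x. m \<le> fst x) (?B (\<lambda>i. i) ?M i) = ?B (\<lambda>_. m) ?M i" if "i < q" for i
    using f[of i] that pq by (simp add: filter_map comp_def rev_filter[symmetric])
  \<comment> \<open>Since p and q are at most m, all staggered rows and columns start at or before
    the letter m. Dropping the smaller letters therefore removes the stagger.\<close>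
  have F: "filter (\<lambda>x. m \<le> fst x) (?W (\<lambda>i. i) ?M) = ?W (\<lambda>_. m) ?M"
  proof -
    have "map (\<lambda>i. filter (\<lambda>x. m \<le> fst x) (?A (\<lambda>i. i) ?M i)) (rev [0..<p]) = map (?A (\<lambda>_. m) ?M) (rev [0..<p])"
      by (rule map_cong[OF refl]) (rule fA, simp)
    moreover have "map (\<lambda>i. filter (\<lambda>x. m \<le> fst x) (?B (\<lambda>i. i) ?M i)) [0..<q] = map (?B (\<lambda>_. m) ?M) [0..<q]"
      by (rule map_cong[OF refl]) (rule fB, simp)
    ultimately show ?thesis unfolding filter_append filter_concat map_map comp_def by (simp only:)
  qed
  have u: "[m..<?M] = map (\<lambda>k. k + m) [0..<k - 1]"
    by (rule nth_equalityI) auto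
  have S: "?W (\<lambda>_. m) ?M = map (\<lambda>(k, a, b). (k + m, a, b)) (?W (\<lambda>_. 0) (k - 1))"
    unfolding u by (simp add: map_concat comp_def hl_def rev_map)
  have H: "gprod (?W (\<lambda>_. 0) (k - 1)) = Hst (k - 1) p q Y X"
    by (simp add: gprod_concat Hst_def Aw_def Bw_def)
  have "coef (tri (m + k) X Y) (shift_perm m w) = coef (gprod (filter (\<lambda>x. m \<le> fst x) (?W (\<lambda>i. i) ?M))) (shift_perm m w)"
    unfolding T
    by (rule coef_restrict) (use shift_perm_sign(1)[OF w] in \<open>auto simp: shift_perm_def hl_def\<close>)
  then show ?thesis unfolding F S coef_shift[OF w] H .
qed

lemma Hst_cong:
  "(\<And>i. i < p \<Longrightarrow> y i = y' i) \<Longrightarrow> (\<And>j. j < q \<Longrightarrow> x j = x' j) \<Longrightarrow> Hst m p q y x = Hst m p q y' x'"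
  unfolding Hst_def by (intro arg_cong2[where f = "(*)"] arg_cong[where f = prod_list] map_cong) auto

text \<open>Arguments equal to 1 give trivial rows and columns, so the padding disappears from the
  word.\<close>

lemma stable_grothendieck_coef:
  assumes "w permutes {1..k}" "\<And>x. x \<in> set as \<Longrightarrow> x \<noteq> 0"
  shows "stable_grothendieck k w as bs =
    (- 1) ^ perm_length w * coef (Hst (k - 1) (length bs) (length as) (nth bs) (nth as)) w"
proof -
  let ?m = "max (length as) (length bs)"
  let ?X = "as @ replicate (?m + k - length as) 1" and ?Y = "bs @ replicate (?m + k - length bs) 1"
  have fw: "finite_perm w" using assms by (auto simp: finite_perm_def)
  have "shift_perm ?m w permutes {1..?m + k}"
    unfolding permutes_def
  proof (intro conjI allI impI)
    show "\<exists>!x. shift_perm ?m w x = y" for y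
      using finite_perm_bij[OF shift_perm_sign(1)[OF fw, of ?m]] unfolding bij_iff by blast
    show "shift_perm ?m w j = j" if "j \<notin> {1..?m + k}" for j
    proof -
      have "j = 0 \<or> j - ?m \<notin> {1..k}" using that by auto
      then show ?thesis using that permutes_not_in[OF assms(1), of "j - ?m"] unfolding shift_perm_def by (cases "j \<le> ?m") auto
    qed
  qed
  moreover have "?X ! j \<noteq> 0" if "j + 1 < ?m + k" for j
    using that assms(2) by (auto simp: nth_append)
  ultimately have "stable_grothendieck k w as bs = (- 1) ^ perm_length (shift_perm ?m w) * coef (tri (?m + k) (nth ?X) (nth ?Y)) (shift_perm ?m w)"
    unfolding stable_grothendieck_def Let_def by (rule grothendieck_at_coef)
  also have "coef (tri (?m + k) (nth ?X) (nth ?Y)) (shift_perm ?m w)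
      = coef (Hst (k - 1) (length bs) (length as) (nth ?Y) (nth ?X)) w"
    by (rule coef_tri_stable[OF fw]) (auto simp: nth_append)
  also have "Hst (k - 1) (length bs) (length as) (nth ?Y) (nth ?X) = Hst (k - 1) (length bs) (length as) (nth bs) (nth as)"
    by (rule Hst_cong) (auto simp: nth_append)
  finally show ?thesis by (simp add: shift_perm_sign(2)[OF fw])
qed

subsection \<open>Reversal of words\<close>

definition hat_perm :: "nat \<Rightarrow> (nat \<Rightarrow> nat) \<Rightarrow> nat \<Rightarrow> nat" where
  "hat_perm N w = longest_perm N \<circ> inv w \<circ> longest_perm N"

lemma inv_longest [simp]: "inv (longest_perm N) = longest_perm N"
  using inv_unique_comp longest_perm_invol(1) by blast

lemma hat_perm_permutes: "w permutes {1..N} \<Longrightarrow> hat_perm N w permutes {1..N}"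
  unfolding hat_perm_def by (intro permutes_compose longest_perm_permutes permutes_inv)

lemma inv_hat_perm: assumes "w permutes {1..N}" shows "inv (hat_perm N w) = longest_perm N \<circ> w \<circ> longest_perm N"
proof -
  have b: "bij w" "bij (longest_perm N)" using assms longest_perm_permutes permutes_bij by blast+
  show ?thesis unfolding hat_perm_def
    using b by (simp add: o_inv_distrib bij_comp bij_imp_bij_inv inv_inv_eq comp_assoc)
qed

lemma adj_longest: assumes "k + 2 \<le> N" shows "adj k \<circ> longest_perm N = longest_perm N \<circ> adj (N - 2 - k)"
proof
  fix p
  define l where "l = N - 2 - k"
  have N: "N = l + k + 2" using assms by (simp add: l_def)
  have "adj k (longest_perm N p) = longest_perm N (adj l p)"
  proof (cases "p = l + 1 \<or> p = l + 2")
    case True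
    then show ?thesis by (auto simp: longest_perm_def N)
  next
    case False
    then have "longest_perm N p \<noteq> Suc k" "longest_perm N p \<noteq> Suc (Suc k)"
      by (auto simp: longest_perm_def N)
    then show ?thesis using False by simp
  qed
  then show "(adj k \<circ> longest_perm N) p = (longest_perm N \<circ> adj (N - 2 - k)) p" by (simp add: l_def)
qed

text \<open>Inversion reverses words, and conjugation by the longest element turns the letter k into
  N - 2 - k. Ascents correspond accordingly, so the coefficient rules for left and right letters
  match.\<close>

lemma coef_hat:
  assumes "w permutes {1..N}" "\<And>x. x \<in> set L \<Longrightarrow> fst x + 2 \<le> N"
  shows "coef (gprod L) (hat_perm N w) = coef (gprod (rev (map (\<lambda>(k, a, b). (N - 2 - k, a, b)) L))) w"
  using assms
proof (induction L arbitrary: w)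
  case Nil
  have fw: "finite_perm w" "finite_perm (hat_perm N w)"
    using Nil hat_perm_permutes[of w N] by (auto simp: finite_perm_def)
  have "hat_perm N w = id \<longleftrightarrow> w = id"
  proof
    assume "hat_perm N w = id"
    then have "longest_perm N \<circ> w \<circ> longest_perm N = id" using inv_hat_perm[OF Nil(1)] by simp
    then have "longest_perm N \<circ> (longest_perm N \<circ> w \<circ> longest_perm N) \<circ> longest_perm N = id"
      by (simp add: longest_perm_invol)
    moreover have "longest_perm N \<circ> (longest_perm N \<circ> w \<circ> longest_perm N) \<circ> longest_perm N
      = (longest_perm N \<circ> longest_perm N) \<circ> w \<circ> (longest_perm N \<circ> longest_perm N)" by (simp only: comp_assoc)
    ultimately show "w = id" by (simp add: longest_perm_invol)
  qed (simp add: hat_perm_def longest_perm_invol)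
  then show ?case using fw by (simp add: coef_1)
next
  case (Cons x L)
  obtain k a b where x: "x = (k, a, b)" by (cases x)
  define l where "l = N - 2 - k"
  have k: "k + 2 \<le> N" using Cons.prems(2)[of x] x by simp
  then have l: "N - Suc (Suc k) = l" "l + 2 \<le> N" "N = l + k + 2" by (simp_all add: l_def)
  define w' where "w' = w \<circ> adj l"
  have pw: "w permutes {1..N}" by fact
  have pw': "w' permutes {1..N}" unfolding w'_def using l by (intro permutes_compose pw adj_permutes) simp
  have fw: "finite_perm w" "finite_perm (hat_perm N w)"
    using pw hat_perm_permutes[of w N] by (auto simp: finite_perm_def)
  have L: "\<And>x. x \<in> set L \<Longrightarrow> fst x + 2 \<le> N" using Cons.prems by simp
  have i: "inv (hat_perm N w) (Suc k) = longest_perm N (w (Suc (Suc l)))"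
    "inv (hat_perm N w) (Suc (Suc k)) = longest_perm N (w (Suc l))"
  proof -
    have "longest_perm N (Suc k) = Suc (Suc l)" "longest_perm N (Suc (Suc k)) = Suc l"
      by (simp_all add: longest_perm_def l(3))
    then show "inv (hat_perm N w) (Suc k) = longest_perm N (w (Suc (Suc l)))"
      "inv (hat_perm N w) (Suc (Suc k)) = longest_perm N (w (Suc l))"
      unfolding inv_hat_perm[OF pw] by simp_all
  qed
  have "w (Suc l) \<in> {1..N}" "w (Suc (Suc l)) \<in> {1..N}"
    using permutes_in_image[OF pw] l(2) by simp_all
  then have "longest_perm N (w (Suc l)) + w (Suc l) = N + 1"
    "longest_perm N (w (Suc (Suc l))) + w (Suc (Suc l)) = N + 1" by (simp_all add: longest_perm_def)
  then have asc: "inv (hat_perm N w) (Suc k) < inv (hat_perm N w) (Suc (Suc k)) \<longleftrightarrow> w (Suc l) < w (Suc (Suc l))"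
    unfolding i by linarith
  have "inv w' = adj l \<circ> inv w"
    unfolding w'_def using permutes_bij[OF pw] by (simp add: o_inv_distrib)
  then have e: "adj k \<circ> hat_perm N w = hat_perm N w'"
    unfolding hat_perm_def using adj_longest[OF k, folded l_def] by (metis comp_assoc)
  have "coef (gprod (x # L)) (hat_perm N w) = (if w (Suc l) < w (Suc (Suc l)) then a * coef (gprod L) (hat_perm N w)
      else (a + b) * coef (gprod L) (hat_perm N w) + b * coef (gprod L) (hat_perm N w'))"
    by (simp add: x coef_lett_mult[OF fw(2)] asc e)
  also have "\<dots> = coef (gprod (rev (map (\<lambda>(k, a, b). (N - 2 - k, a, b)) (x # L)))) w"
    using Cons.IH[OF pw L] Cons.IH[OF pw' L] by (simp add: x coef_mult_lett[OF fw(1)] w'_def[symmetric] l(1))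
  finally show ?case .
qed

subsection \<open>Invisible letters\<close>

text \<open>This serves to strip the outer factors at z(r), whose letters sit at ascents.\<close>

lemma coef_left_invisible:
  assumes "finite_perm w" "\<And>x. x \<in> set L \<Longrightarrow> fst (snd x) = 1 \<and> inv w (Suc (fst x)) < inv w (Suc (Suc (fst x)))"
  shows "coef (gprod L * f) w = coef f w"
  using assms(2)
proof (induction L)
  case (Cons x L)
  obtain k b where x: "x = (k, 1, b)" using Cons.prems[of x] by (cases x) auto
  then have "inv w (Suc k) < inv w (Suc (Suc k))" using Cons.prems[of x] by simp
  then show ?case using Cons x by (simp add: mult.assoc coef_lett_mult[OF assms(1)])
qed simp

lemma coef_right_invisible:
  assumes "finite_perm w" "\<And>x. x \<in> set L \<Longrightarrow> fst (snd x) = 1 \<and> w (Suc (fst x)) < w (Suc (Suc (fst x)))"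
  shows "coef (f * gprod L) w = coef f w"
  using assms(2)
proof (induction L rule: rev_induct)
  case (snoc x L)
  obtain k b where x: "x = (k, 1, b)" using snoc.prems[of x] by (cases x) auto
  then have "w (Suc k) < w (Suc (Suc k))" using snoc.prems[of x] by simp
  then show ?case using snoc x by (simp add: mult.assoc[symmetric] coef_mult_lett[OF assms(1)])
qed simp

text \<open>If d carries the neighbours l + 1, l + 2 to k + 1, k + 2 in this order, then s_k d = d
  s_l, and both products increase the length; so the identity persists in the Demazure
  product.\<close>

lemma gprod_conj:
  assumes "finite_perm d" "\<And>x. x \<in> set L \<Longrightarrow> d (Suc (\<phi> (fst x))) = Suc (fst x) \<and> d (Suc (Suc (\<phi> (fst x)))) = Suc (Suc (fst x))"
  shows "gprod L * Poly_Mapping.single (to_hperm d) 1 =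
    Poly_Mapping.single (to_hperm d) 1 * gprod (map (\<lambda>(k, a, b). (\<phi> k, a, b)) L)"
  using assms(2)
proof (induction L)
  case (Cons x L)
  obtain k a b where x: "x = (k, a, b)" by (cases x)
  let ?l = "\<phi> k" and ?D = "Poly_Mapping.single (to_hperm d) 1"
  have d: "d (Suc ?l) = Suc k" "d (Suc (Suc ?l)) = Suc (Suc k)" using Cons.prems[of x] x by simp_all
  have bd: "bij d" using finite_perm_bij assms by blast
  have i: "inv d (Suc k) = Suc ?l" "inv d (Suc (Suc k)) = Suc (Suc ?l)"
    using d bd by (metis bij_inv_eq_iff)+
  have "d \<circ> adj ?l = adj k \<circ> d"
  proof
    fix p
    have "d p = Suc k \<longleftrightarrow> p = Suc ?l" "d p = Suc (Suc k) \<longleftrightarrow> p = Suc (Suc ?l)"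
      using d assms(1) finite_perm_neq by metis+
    then show "(d \<circ> adj ?l) p = (adj k \<circ> d) p" using d by (auto simp: adj_apply)
  qed
  moreover have "inv (inv d \<circ> adj k) = adj k \<circ> d"
    using bd by (simp add: o_inv_distrib bij_imp_bij_inv inv_inv_eq)
  ultimately have "tau k + to_hperm d = to_hperm d + tau ?l"
    using assms(1) d i by (simp add: tau_add add_tau dstep_def)
  then have "lett x * ?D = ?D * lett (?l, a, b)"
    by (simp add: x lett_def distrib_left distrib_right mult_single)
  then show ?case using Cons by (simp add: x mult.assoc) (simp add: mult.assoc[symmetric])
qed simp

subsection \<open>Forced crossings\<close>

text \<open>The rank matrix that describes Bruhat order; larger permutations have smaller
  entries.\<close>

definition rk :: "(nat \<Rightarrow> nat) \<Rightarrow> nat \<Rightarrow> nat \<Rightarrow> nat" where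
  "rk w p v = card {i \<in> {1..p}. w i \<le> v}"

lemma rk_comp_adj: assumes "p \<noteq> Suc k" shows "rk (w \<circ> adj k) p v = rk w p v"
proof -
  have "{i \<in> {1..p}. (w \<circ> adj k) i \<le> v} = adj k ` {i \<in> {1..p}. w i \<le> v}"
  proof (intro equalityI subsetI)
    fix i assume "i \<in> {i \<in> {1..p}. (w \<circ> adj k) i \<le> v}"
    then have "adj k i \<in> {i \<in> {1..p}. w i \<le> v}" using assms by (auto simp: adj_apply)
    then show "i \<in> adj k ` {i \<in> {1..p}. w i \<le> v}" by (metis adj_invol(1) imageI)
  qed (use assms in \<open>auto simp: adj_apply\<close>)
  then show ?thesis unfolding rk_def by (simp add: card_image inj_on_subset[OF bij_adj(2)])
qed

lemma rk_mono: "p \<le> p' \<Longrightarrow> rk w p v \<le> rk w p' v"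
  unfolding rk_def by (intro card_mono) auto

lemma rk_Suc: "rk w (Suc p) v = rk w p v + (if w (Suc p) \<le> v then 1 else 0)"
proof -
  have "{i \<in> {1..Suc p}. w i \<le> v} = (if w (Suc p) \<le> v then insert (Suc p) {i \<in> {1..p}. w i \<le> v} else {i \<in> {1..p}. w i \<le> v})"
    by (auto simp: le_Suc_eq)
  then show ?thesis by (simp add: rk_def)
qed

text \<open>A lower rank bound on all permutations that occur in a word, in a form that can be
  propagated letter by letter.\<close>

definition rk_bound :: "(nat \<times> 'k \<times> 'k::field) list \<Rightarrow> nat \<Rightarrow> nat \<Rightarrow> nat \<Rightarrow> bool" where
  "rk_bound L p v c \<longleftrightarrow> (\<forall>w. finite_perm w \<and> coef (gprod L) w \<noteq> 0 \<longrightarrow> c \<le> rk w p v)"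

lemma rk_bound_append:
  assumes "rk_bound L p v c" "\<And>x. x \<in> set M \<Longrightarrow> Suc (fst x) \<noteq> p \<or> snd (snd x) = 0"
  shows "rk_bound (L @ M) p v c"
  using assms(2)
proof (induction M rule: rev_induct)
  case (snoc x M)
  obtain k a b where x: "x = (k, a, b)" by (cases x)
  have IH: "rk_bound (L @ M) p v c" using snoc by simp
  have k: "Suc k \<noteq> p \<or> b = 0" using snoc.prems[of x] x by simp
  show ?case unfolding rk_bound_def
  proof (intro allI impI, elim conjE)
    fix w assume w: "finite_perm w" and "coef (gprod (L @ M @ [x])) w \<noteq> 0"
    then consider "coef (gprod (L @ M)) w \<noteq> 0" | "b \<noteq> 0" "coef (gprod (L @ M)) (w \<circ> adj k) \<noteq> 0"
      using coef_snoc_nonzero[OF w, of "L @ M" k a b] by (auto simp: x)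
    then show "c \<le> rk w p v"
    proof cases
      case 1 then show ?thesis using IH w by (simp add: rk_bound_def)
    next
      case 2
      then have "c \<le> rk (w \<circ> adj k) p v" using IH w unfolding rk_bound_def by (meson finite_perm_comp_adj_iff)
      then show ?thesis using 2 k rk_comp_adj[of p k w v] by simp
    qed
  qed
qed (use assms in simp)

text \<open>The letter k does not change the count up to position k + 2, and giving up the last of
  these positions costs at most one.\<close>

lemma rk_bound_letter:
  assumes "rk_bound L (Suc (Suc k)) v (Suc c)"
  shows "rk_bound (L @ [(k, a, b)]) (Suc k) v c"
  unfolding rk_bound_def
proof (intro allI impI, elim conjE)
  fix w assume w: "finite_perm w" and "coef (gprod (L @ [(k, a, b)])) w \<noteq> 0"
  then consider "coef (gprod L) w \<noteq> 0" | "coef (gprod L) (w \<circ> adj k) \<noteq> 0"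
    using coef_snoc_nonzero[OF w] by blast
  then have "Suc c \<le> rk w (Suc (Suc k)) v"
  proof cases
    case 1 then show ?thesis using assms w by (simp add: rk_bound_def)
  next
    case 2
    then have "Suc c \<le> rk (w \<circ> adj k) (Suc (Suc k)) v"
      using assms w unfolding rk_bound_def by (meson finite_perm_comp_adj_iff)
    then show ?thesis using rk_comp_adj[of "Suc (Suc k)" k w v] by simp
  qed
  then show "c \<le> rk w (Suc k) v" by (simp add: rk_Suc[of w "Suc k"] split: if_splits)
qed

definition box_word :: "nat \<Rightarrow> (nat \<times> nat \<Rightarrow> 'k) \<Rightarrow> (nat \<times> nat \<Rightarrow> 'k) \<Rightarrow> (nat \<times> 'k \<times> 'k::field) list" where
  "box_word N A B = map (\<lambda>x. (fst x + snd x, A x, B x)) (boxes N)"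

text \<open>If box (i, j) has no crossing, a value up to i + 1 stays among the first j + 1
  positions. After row i the bound is i + 1 at position i + j + 1, and each of the i remaining rows
  lowers the position and the bound by one.\<close>

lemma rk_bound_box_word:
  assumes "i + j + 1 < N" "B (i, j) = 0"
  shows "rk_bound (box_word N A B) (Suc j) (Suc i) 1"
proof -
  define R where "R l = map (\<lambda>j. (l + j, A (l, j), B (l, j))) [0..<N - 1 - l]" for l
  define W where "W l = concat (map R (rev [l..<N]))" for l
  have W_rec: "W l = W (Suc l) @ R l" if "l < N" for l
    using that by (simp add: W_def upt_rec[of l])
  have "rk_bound [] (Suc i) (Suc i) (Suc i)"
    unfolding rk_bound_def
  proof (intro allI impI, elim conjE)
    fix w assume "finite_perm w" "coef (gprod []) w \<noteq> 0"
    then have "w = id" by (simp add: coef_1 split: if_splits)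
    moreover have "{l \<in> {1..Suc i}. id l \<le> Suc i} = {1..Suc i}" by auto
    ultimately show "Suc i \<le> rk w (Suc i) (Suc i)" by (simp add: rk_def)
  qed
  \<comment> \<open>The rows read before row i only have letters from i + 1 on, which do not touch
    the count at position i + 1.\<close>
  then have "rk_bound ([] @ W (Suc i)) (Suc i) (Suc i) (Suc i)"
    by (rule rk_bound_append) (auto simp: W_def R_def)
  then have "rk_bound (W (Suc i)) (Suc (i + j)) (Suc i) (Suc i)"
    unfolding rk_bound_def append_Nil using order_trans[OF _ rk_mono[of "Suc i" "Suc (i + j)"]] le_add1
    by (metis add_Suc)
  \<comment> \<open>Within row i, the count at position i + j + 1 could change only in box (i,
    j).\<close>
  then have "rk_bound (W (Suc i) @ R i) (Suc (i + j)) (Suc i) (Suc i)"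
    by (rule rk_bound_append) (use assms in \<open>auto simp: R_def\<close>)
  then have base: "rk_bound (W i) (Suc (i + j)) (Suc i) (Suc i)" using W_rec[of i] assms by simp
  have "rk_bound (W l) (Suc (l + j)) (Suc i) (Suc l)" if "l \<le> i" for l
    using that
  proof (induction l rule: inc_induct)
    case base
    then show ?case using \<open>rk_bound (W i) (Suc (i + j)) (Suc i) (Suc i)\<close> .
  next
    case (step l)
    let ?f = "\<lambda>j. (l + j, A (l, j), B (l, j))"
    have "j < N - 1 - l" using step assms by linarith
    then have "[0..<N - 1 - l] = [0..<j] @ j # [Suc j..<N - 1 - l]"
      using upt_split[of 0 j "N - 1 - l"] by (simp add: upt_conv_Cons)
    then have R: "R l = map ?f [0..<j] @ [?f j] @ map ?f [Suc j..<N - 1 - l]" by (simp add: R_def)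
    have "rk_bound (W (Suc l) @ map ?f [0..<j]) (Suc (Suc (l + j))) (Suc i) (Suc (Suc l))"
      using step.IH by (intro rk_bound_append) auto
    then have "rk_bound ((W (Suc l) @ map ?f [0..<j]) @ [?f j]) (Suc (l + j)) (Suc i) (Suc l)"
      by (rule rk_bound_letter)
    then have "rk_bound (((W (Suc l) @ map ?f [0..<j]) @ [?f j]) @ map ?f [Suc j..<N - 1 - l]) (Suc (l + j)) (Suc i) (Suc l)"
      by (rule rk_bound_append) auto
    moreover have "W l = ((W (Suc l) @ map ?f [0..<j]) @ [?f j]) @ map ?f [Suc j..<N - 1 - l]"
      using W_rec[of l] step assms by (simp add: R)
    ultimately show ?case by simp
  qed
  from this[of 0] have "rk_bound (W 0) (Suc j) (Suc i) 1" by simp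
  moreover have "box_word N A B = W 0"
    unfolding box_word_def boxes_def W_def R_def map_concat map_map comp_def by simp
  ultimately show ?thesis by simp
qed

text \<open>The scalar part of the letter enters additively, and its contribution consists of
  permutations with positive rank at this place; w is not among them.\<close>

lemma coef_box_word_upd:
  assumes "finite_perm w" "i + j + 1 < N" "rk w (Suc j) (Suc i) = 0"
  shows "coef (gprod (box_word N (A((i, j) := a)) B)) w = coef (gprod (box_word N A B)) w"
proof -
  let ?x = "(i, j)"
  have "?x \<in> set (boxes N)" using assms by (simp add: set_boxes)
  then obtain l1 l2 where l: "boxes N = l1 @ ?x # l2" by (meson split_list)
  then have n: "?x \<notin> set l1" "?x \<notin> set l2" using distinct_boxes[of N] by auto
  define g where "g ls = gprod (map (\<lambda>x. (fst x + snd x, A x, B x)) ls)" for ls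
  have u: "gprod (box_word N (A(?x := c)) (B(?x := d))) = g l1 * lett (i + j, c, d) * g l2" for c d
  proof -
    let ?F = "\<lambda>x. (fst x + snd x, (A(?x := c)) x, (B(?x := d)) x)"
    have m: "gprod (map ?F ls) = g ls" if "?x \<notin> set ls" for ls
      unfolding g_def using that by (intro arg_cong[where f = gprod] map_cong refl) auto
    have "gprod (box_word N (A(?x := c)) (B(?x := d))) = gprod (map ?F l1 @ ?F ?x # map ?F l2)"
      unfolding box_word_def l map_append list.map ..
    also have "\<dots> = g l1 * (lett (?F ?x) * g l2)"
      unfolding gprod_simps m[OF n(1)] m[OF n(2)] ..
    also have "?F ?x = (i + j, c, d)" by simp
    finally show ?thesis by (simp only: mult.assoc)
  qed
  have z: "coef (g l1 * lett (i + j, c, 0) * g l2) w = 0" for c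
  proof (rule ccontr)
    assume "coef (g l1 * lett (i + j, c, 0) * g l2) w \<noteq> 0"
    moreover have "rk_bound (box_word N (A(?x := c)) (B(?x := 0))) (Suc j) (Suc i) 1"
      using assms(2) by (rule rk_bound_box_word) simp
    ultimately have "1 \<le> rk w (Suc j) (Suc i)"
      using assms(1) unfolding rk_bound_def u by blast
    then show False using assms by simp
  qed
  have E: "coef (g l1 * lett (i + j, c, B ?x) * g l2) w = coef (g l1 * lett (i + j, 0, B ?x) * g l2) w" for c
  proof -
    have "lett (i + j, c, B ?x) = lett (i + j, 0, B ?x) + lett (i + j, c, 0)" by (simp add: lett_def)
    then have "coef (g l1 * lett (i + j, c, B ?x) * g l2) w =
        coef (g l1 * lett (i + j, 0, B ?x) * g l2) w + coef (g l1 * lett (i + j, c, 0) * g l2) w"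
      by (simp only: distrib_left distrib_right coef_add)
    then show ?thesis using z[of c] by simp
  qed
  have "coef (g l1 * lett (i + j, a, B ?x) * g l2) w = coef (g l1 * lett (i + j, A ?x, B ?x) * g l2) w"
    unfolding E[of a] E[of "A ?x"] ..
  then have "coef (gprod (box_word N (A(?x := a)) (B(?x := B ?x)))) w =
      coef (gprod (box_word N (A(?x := A ?x)) (B(?x := B ?x)))) w"
    unfolding u .
  then show ?thesis unfolding fun_upd_triv .
qed

lemma coef_box_word_forced:
  assumes "finite_perm w" "finite S" "\<And>i j. (i, j) \<in> S \<Longrightarrow> i + j + 1 < N \<and> rk w (Suc j) (Suc i) = 0"
  shows "coef (gprod (box_word N (\<lambda>x. if x \<in> S then 0 else A x) B)) w = coef (gprod (box_word N A B)) w"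
  using assms(2,3)
proof (induction S rule: finite_induct)
  case (insert x S)
  obtain i j where x: "x = (i, j)" by (cases x)
  have "(\<lambda>y. if y \<in> insert x S then 0 else A y) = (\<lambda>y. if y \<in> S then 0 else A y)(x := 0)" by auto
  moreover have "coef (gprod (box_word N ((\<lambda>y. if y \<in> S then 0 else A y)(x := 0)) B)) w =
      coef (gprod (box_word N (\<lambda>y. if y \<in> S then 0 else A y) B)) w"
    unfolding x using insert.prems[of i j] by (intro coef_box_word_upd assms(1)) (simp_all add: x)
  moreover have "coef (gprod (box_word N (\<lambda>y. if y \<in> S then 0 else A y) B)) w = coef (gprod (box_word N A B)) w"
    by (rule insert.IH) (use insert.prems in auto)
  ultimately show ?case by (simp only:)
qed simp

subsection \<open>Block exchanges\<close>

lemma bswap_inverse: "bswap c b a (bswap c a b p) = p"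
  by (auto simp: bswap_def)

lemma bswap_bij: "bij (bswap c a b)"
  by (rule o_bij[of "bswap c b a"]) (auto simp: bswap_inverse)

lemma bswap_permutes: assumes "c + a + b \<le> N" shows "bswap c a b permutes {1..N}"
  unfolding permutes_def
proof (intro conjI allI impI)
  show "\<exists>!p. bswap c a b p = q" for q using bswap_bij[of c a b] unfolding bij_iff by blast
qed (use assms in \<open>auto simp: bswap_def\<close>)

lemma finite_perm_bswap [simp]: "finite_perm (bswap c a b)"
  using bswap_permutes[of c a b "c + a + b"] by (auto simp: finite_perm_def)

lemma inv_bswap: "inv (bswap c a b) = bswap c b a"
  by (rule inv_unique_comp) (auto simp: bswap_inverse)

lemma bswap_trivial: "bswap c 0 b = id" "bswap c a 0 = id"
  by (auto simp: bswap_def)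

lemma bswap_fix: "p \<le> c \<or> c + a + b < p \<Longrightarrow> bswap c a b p = p"
  by (auto simp: bswap_def)

lemma bswap_comp_left: "bswap c a b \<circ> bswap (c + a) a' b = bswap c (a + a') b"
  by (auto simp: bswap_def fun_eq_iff)

lemma bswap_Suc_right: "bswap (Suc c) a b \<circ> bswap c a 1 = bswap c a (Suc b)"
  by (auto simp: bswap_def fun_eq_iff)

text \<open>A word for \<open>bswap c a b\<close>: b rows of a letters, each starting one letter
  below the previous one.\<close>

fun blk :: "nat \<Rightarrow> nat \<Rightarrow> nat \<Rightarrow> nat list" where
  "blk c a 0 = []"
| "blk c a (Suc b) = blk (Suc c) a b @ [c..<c + a]"

lemma length_blk: "length (blk c a b) = a * b"
  by (induction b arbitrary: c) auto

lemma set_blk: "k \<in> set (blk c a b) \<Longrightarrow> c \<le> k \<and> k + 2 \<le> c + a + b"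
  by (induction b arbitrary: c) fastforce+

lemma blk_alt: "blk c a b = concat (map (\<lambda>i. [c + b - 1 - i..<c + b - 1 - i + a]) [0..<b])"
proof (induction b arbitrary: c)
  case (Suc b)
  have "map (\<lambda>i. [Suc c + b - 1 - i..<Suc c + b - 1 - i + a]) [0..<b]
      = map (\<lambda>i. [c + Suc b - 1 - i..<c + Suc b - 1 - i + a]) [0..<b]"
    by (intro map_cong) auto
  then show ?case using Suc[of "Suc c"] by simp
qed simp

lemma act_row:
  assumes "\<And>p. Suc c < p \<Longrightarrow> p \<le> Suc (c + a) \<Longrightarrow> w (Suc c) < w p"
  shows "act [c..<c + a] w = w \<circ> bswap c a 1"
  using assms
proof (induction a)
  case 0
  show "act [c..<c + 0] w = w \<circ> bswap c 0 1" by (simp add: bswap_trivial)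
next
  case (Suc a)
  have IH: "act [c..<c + a] w = w \<circ> bswap c a 1" by (rule Suc.IH) (simp add: Suc.prems)
  have "(w \<circ> bswap c a 1) (Suc (c + a)) < (w \<circ> bswap c a 1) (Suc (Suc (c + a)))"
    using Suc.prems[of "Suc (Suc (c + a))"] by (auto simp: bswap_def)
  then have "dstep (w \<circ> bswap c a 1) (c + a) = w \<circ> bswap c a 1 \<circ> adj (c + a)" by (simp only: dstep_def if_True)
  also have "\<dots> = w \<circ> bswap c (Suc a) 1"
    by (auto simp: fun_eq_iff bswap_def adj_apply)
  finally have "dstep (w \<circ> bswap c a 1) (c + a) = w \<circ> bswap c (Suc a) 1" .
  then show "act [c..<c + Suc a] w = w \<circ> bswap c (Suc a) 1" using IH by simp
qed

text \<open>On an increasing window every letter meets an ascent, so the Demazure action is ordinary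
  composition.\<close>

lemma act_blk:
  assumes "\<And>p q. c < p \<Longrightarrow> p < q \<Longrightarrow> q \<le> c + a + b \<Longrightarrow> w p < w q"
  shows "act (blk c a b) w = w \<circ> bswap c a b"
  using assms
proof (induction b arbitrary: c)
  case 0
  show "act (blk c a 0) w = w \<circ> bswap c a 0" by (simp add: bswap_trivial)
next
  case (Suc b)
  have IH: "act (blk (Suc c) a b) w = w \<circ> bswap (Suc c) a b"
    by (rule Suc.IH) (simp add: Suc.prems)
  have "act [c..<c + a] (w \<circ> bswap (Suc c) a b) = w \<circ> bswap (Suc c) a b \<circ> bswap c a 1"
  proof (rule act_row)
    fix p assume "Suc c < p" "p \<le> Suc (c + a)"
    then show "(w \<circ> bswap (Suc c) a b) (Suc c) < (w \<circ> bswap (Suc c) a b) p"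
      using Suc.prems[of "Suc c" "p + b"] by (simp add: bswap_def)
  qed
  then show "act (blk c a (Suc b)) w = w \<circ> bswap c a (Suc b)"
    using IH bswap_Suc_right[of c a b] by (simp add: comp_assoc)
qed

lemma dem_blk: "dem (blk c a b) = bswap c a b"
  using act_blk[of c a b id] by simp

lemma wprod_row: "wprod [c..<c + a] = bswap c a 1"
proof (induction a)
  case 0
  show "wprod [c..<c + 0] = bswap c 0 1" by (simp add: bswap_trivial)
next
  case (Suc a)
  have "bswap c a 1 \<circ> adj (c + a) = bswap c (Suc a) 1"
    by (auto simp: fun_eq_iff bswap_def adj_apply)
  then show "wprod [c..<c + Suc a] = bswap c (Suc a) 1" using Suc by simp
qed

lemma wprod_blk: "wprod (blk c a b) = bswap c a b"
proof (induction b arbitrary: c)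
  case 0
  show "wprod (blk c a 0) = bswap c a 0" by (simp add: bswap_trivial)
next
  case (Suc b)
  have "wprod (blk (Suc c) a b) = bswap (Suc c) a b" by (rule Suc)
  then show "wprod (blk c a (Suc b)) = bswap c a (Suc b)"
    using bswap_Suc_right[of c a b] by (simp add: wprod_row)
qed

lemma sign_bswap: "(- 1 :: 'a::ring_1) ^ perm_length (bswap c a b) = (- 1) ^ (a * b)"
  using sign_wprod[of "blk c a b", where 'a = 'a] by (simp add: wprod_blk length_blk)

subsection \<open>The Zelevinsky permutation\<close>

lemma perm_prod_simps: "perm_prod [] = id" "perm_prod (u # us) = u \<circ> perm_prod us"
  "perm_prod (us @ vs) = perm_prod us \<circ> perm_prod vs"
proof -
  show "perm_prod [] = id" "perm_prod (u # us) = u \<circ> perm_prod us" for u us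
    by (simp_all add: perm_prod_def)
  then show "perm_prod (us @ vs) = perm_prod us \<circ> perm_prod vs"
    by (induction us) (auto simp: comp_assoc)
qed

locale ranks =
  fixes n :: nat and r :: "nat \<Rightarrow> nat \<Rightarrow> nat"
  assumes rc: "rank_conditions n r"
begin

abbreviation "R \<equiv> ext_rank n r"
abbreviation "e \<equiv> dim_vec r"

definition s :: "nat \<Rightarrow> nat" where "s i = (\<Sum>k<i. e k)"

definition tail :: "nat \<Rightarrow> nat" where "tail j = (\<Sum>k\<in>{j..n}. e k)"

text \<open>The rank with first index i - 1, including the value 0 at index -1, which natural
  numbers do not represent.\<close>

definition Rm :: "nat \<Rightarrow> nat \<Rightarrow> nat" where "Rm i j = (if i = 0 then 0 else R (i - 1) j)"

lemma Rm_simps [simp]: "Rm 0 j = 0" "Rm (Suc i) j = R i j"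
  by (simp_all add: Rm_def)

lemma s_simps [simp]: "s 0 = 0" "s (Suc i) = s i + e i"
  by (simp_all add: s_def)

lemma s_mono: "i \<le> j \<Longrightarrow> s i \<le> s j"
  by (auto simp: s_def intro: sum_mono2)

lemma tail_gt [simp]: "n < j \<Longrightarrow> tail j = 0"
  by (simp add: tail_def)

lemma tail_rec: "j \<le> n \<Longrightarrow> tail j = e j + tail (Suc j)"
  by (simp add: tail_def sum.atLeast_Suc_atMost)

lemma R_n: "R n j = tail j"
  by (simp add: ext_rank_def tail_def)

lemma tail_antimono: "i \<le> j \<Longrightarrow> tail j \<le> tail i"
  unfolding tail_def by (intro sum_mono2) auto

lemma s_tail: "i \<le> Suc n \<Longrightarrow> s i + tail i = total_dim n e"
proof (induction i)
  case 0
  then show ?case by (simp add: tail_def total_dim_def)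
next
  case (Suc i)
  then show ?case using tail_rec[of i] by simp
qed

lemma s_Suc_n: "s (Suc n) = total_dim n e"
  using s_tail[of "Suc n"] by simp

lemma R_gt [simp]: "n < j \<Longrightarrow> R i j = 0"
  by (simp add: ext_rank_def)

lemma R_ge: "j \<le> i \<Longrightarrow> i \<le> n \<Longrightarrow> R i j = (\<Sum>k\<in>{j..i}. e k)"
  by (simp add: ext_rank_def)

lemma R_le: "i \<le> j \<Longrightarrow> j \<le> n \<Longrightarrow> R i j = r i j"
  by (auto simp: ext_rank_def dim_vec_def le_less)

lemma R_0: assumes "i \<le> n" shows "R i 0 = s (Suc i)"
  unfolding R_ge[OF le0 assms] s_def by (rule sum.cong) auto

lemma Rm_0: "i \<le> Suc n \<Longrightarrow> Rm i 0 = s i"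
  by (cases i) (simp_all add: R_0)

lemma rc1: "i < j \<Longrightarrow> j \<le> n \<Longrightarrow> r i j \<le> r i (j - 1) \<and> r i j \<le> r (Suc i) j"
  using rc unfolding rank_conditions_def by (metis Suc_eq_plus1 min.bounded_iff)

lemma rc2: "i < j \<Longrightarrow> j < n \<Longrightarrow> r i j + r (Suc i) (Suc j) \<le> r (Suc i) j + r i (Suc j)"
proof -
  assume "i < j" "j < n"
  then have "0 < Suc i \<and> Suc i \<le> j \<and> j < n" by simp
  then have "r (Suc i) j + r (Suc i - 1) (j + 1) \<ge> r (Suc i - 1) j + r (Suc i) (j + 1)"
    using rc unfolding rank_conditions_def by blast
  then show ?thesis by simp
qed

lemma R_antimono: assumes "i \<le> n" shows "R i (Suc j) \<le> R i j"
proof -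
  consider "n \<le> j" | "Suc j \<le> i" | "j < n" "i \<le> j" by linarith
  then show ?thesis
  proof cases
    case 2
    then show ?thesis using assms by (auto simp: R_ge intro!: sum_mono2)
  next
    case 3
    then show ?thesis using rc1[of i "Suc j"] by (simp add: R_le)
  qed simp
qed

lemma R_mono: assumes "Suc i \<le> n" shows "R i j \<le> R (Suc i) j"
proof -
  consider "n < j" | "j \<le> i" | "j \<le> n" "i < j" by linarith
  then show ?thesis
  proof cases
    case 2
    then show ?thesis using assms by (auto simp: R_ge intro!: sum_mono2)
  next
    case 3
    then show ?thesis using rc1[of i j] by (simp add: R_le)
  qed simp
qed

lemma R_monos: "i \<le> i' \<Longrightarrow> i' \<le> n \<Longrightarrow> R i j \<le> R i' j"
  by (induction i' rule: dec_induct) (auto intro: order_trans R_mono)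

text \<open>The inequality between ranks persists across the diagonal, where it becomes a statement
  about sums of dimensions.\<close>

lemma R_super: assumes "Suc i \<le> n" shows "R i j + R (Suc i) (Suc j) \<le> R (Suc i) j + R i (Suc j)"
proof -
  consider "n \<le> j" | "j < n" "i < j" | "j < n" "i = j" | "j < i" by linarith
  then show ?thesis
  proof cases
    case 1
    then show ?thesis using R_mono[OF assms] by simp
  next
    case 2
    then show ?thesis using rc2[of i j] by (simp add: R_le)
  next
    case 3
    have "R (Suc i) i = e i + e (Suc i)" using assms by (simp add: R_ge)
    then show ?thesis using 3 assms by (simp add: R_ge)
  next
    case 4
    then have "{j..i} = insert j {Suc j..i}" "{j..Suc i} = insert j {Suc j..Suc i}" by auto
    then show ?thesis using 4 assms by (simp add: R_ge)
  qed
qed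

lemma Rm_super: "I \<le> n \<Longrightarrow> Rm I j + R I (Suc j) \<le> R I j + Rm I (Suc j)"
  using R_super[of "I - 1" j] R_antimono[of I j] by (cases I) auto

lemma Rm_le: "I \<le> n \<Longrightarrow> Rm I j \<le> R I j"
  using R_mono[of "I - 1" j] by (cases I) auto

lemma Rm_antimono: "I \<le> Suc n \<Longrightarrow> Rm I (Suc j) \<le> Rm I j"
  using R_antimono[of "I - 1" j] by (cases I) auto

definition W :: "nat \<Rightarrow> nat \<Rightarrow> nat \<Rightarrow> nat" where
  "W i j = bswap (R i j) (R (Suc i) j - R i j) (R i (j - 1) - R i j)"

lemma W_perm_eq: assumes "i < n" shows "W_perm n r i j = W i j"
  using R_mono[of i j] assms by (auto simp: fun_eq_iff W_perm_def W_def bswap_def Let_def)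

lemma W_range: assumes "i < n" "1 \<le> j"
  shows "R i j + (R (Suc i) j - R i j) + (R i (j - 1) - R i j) \<le> R (Suc i) (j - 1)"
  using R_super[of i "j - 1"] R_mono[of i j] R_antimono[of i "j - 1"] assms by simp

lemma W_fix_low: "p \<le> R i j \<Longrightarrow> W i j p = p"
  by (simp add: W_def bswap_fix)

lemma W_fix_high: assumes "i < n" "1 \<le> j" "R (Suc i) j + R i (j - 1) < p + R i j" shows "W i j p = p"
  unfolding W_def using R_mono[of i j] R_antimono[of i "j - 1"] assms by (intro bswap_fix) simp

lemma W_fix_top: assumes "i < n" "1 \<le> j" "R (Suc i) (j - 1) < p" shows "W i j p = p"
  unfolding W_def using W_range[OF assms(1,2)] assms(3) by (intro bswap_fix) simp

text \<open>The factors of z(r) act from the right. \<open>C i j\<close> is a final part of column j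
  and \<open>Z m\<close> the product of the columns after m; with these partial products a point can
  be followed on its way.\<close>

definition C :: "nat \<Rightarrow> nat \<Rightarrow> nat \<Rightarrow> nat" where
  "C i j = perm_prod (map (\<lambda>i. W i j) [i..<n])"

definition Z :: "nat \<Rightarrow> nat \<Rightarrow> nat" where
  "Z m = perm_prod (map (C 0) [Suc m..<Suc n])"

abbreviation "z \<equiv> zel_perm n r"

lemma zel_perm_Z: "z = Z 0"
proof -
  have *: "perm_prod (concat xss) = perm_prod (map perm_prod xss)" for xss
    by (induction xss) (simp_all add: perm_prod_simps)
  have "map (\<lambda>i. W_perm n r i j) [0..<n] = map (\<lambda>i. W i j) [0..<n]" for j
    by (intro map_cong) (auto simp: W_perm_eq)
  then show ?thesis unfolding zel_perm_def * Z_def C_def map_map comp_def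
    by (simp only: Suc_eq_plus1 add_0)
qed

lemma C_rec: "i < n \<Longrightarrow> C i j = W i j \<circ> C (Suc i) j"
  by (simp add: C_def upt_conv_Cons perm_prod_simps)

lemma C_n: "C n j = id"
  by (simp add: C_def perm_prod_simps)

lemma Z_rec: "m < n \<Longrightarrow> Z m = C 0 (Suc m) \<circ> Z (Suc m)"
  unfolding Z_def by (subst upt_conv_Cons) (simp_all add: perm_prod_simps)

lemma Z_n: "Z n = id"
  by (simp add: Z_def perm_prod_simps)

lemma C_fix: assumes "i \<le> n" "1 \<le> j" "tail (j - 1) < p" shows "C i j p = p"
  using assms(1)
proof (induction i rule: inc_induct)
  case base
  show "C n j p = p" by (simp add: C_n)
next
  case (step i)
  have "R (Suc i) (j - 1) < p" using R_monos[of "Suc i" n "j - 1"] step assms by (simp add: R_n)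
  then show ?case using step assms by (simp add: C_rec W_fix_top)
qed

lemma Z_fix: assumes "m \<le> n" "tail m < p" shows "Z m p = p"
  using assms(1)
proof (induction m rule: inc_induct)
  case base
  show "Z n p = p" by (simp add: Z_n)
next
  case (step m')
  have "tail m' < p" using assms(2) tail_antimono[of m m'] step.hyps by simp
  then show "Z m' p = p" using step C_fix[of 0 "Suc m'" p] by (simp add: Z_rec)
qed

lemma R_supers: assumes "i \<le> i'" "i' \<le> n" shows "R i j + R i' (Suc j) \<le> R i' j + R i (Suc j)"
  using assms
proof (induction i' rule: dec_induct)
  case (step k)
  then show ?case using R_super[of k j] by simp
qed simp

text \<open>The \<open>t\<close>-th element of domain block \<open>J\<close> is sent to value block \<open>I\<close>.\<close>

definition piece :: "nat \<Rightarrow> nat \<Rightarrow> nat \<Rightarrow> bool" where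
  "piece I J t \<longleftrightarrow> I \<le> n \<and> J \<le> n \<and> 0 < t \<and> Rm I J < t + Rm I (Suc J) \<and> t + R I (Suc J) \<le> R I J"

text \<open>The upper bound in \<open>piece\<close> keeps the point in the second block of each
  factor with index at least I, and these factors move it down.\<close>

lemma C_crossing:
  assumes p: "piece I J t" and i: "I \<le> i" "i \<le> n"
  shows "C i (Suc J) (tail (Suc J) + t) = R i (Suc J) + t"
  using i(2,1)
proof (induction i rule: inc_induct)
  case base
  show "C n (Suc J) (tail (Suc J) + t) = R n (Suc J) + t" by (simp add: C_n R_n)
next
  case (step i)
  have "t \<le> R i J - R i (Suc J)" "0 < t" using p R_supers[of I i J] step by (auto simp: piece_def)
  then have "W i (Suc J) (R (Suc i) (Suc J) + t) = R i (Suc J) + t"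
    using R_mono[of i "Suc J"] step by (simp add: W_def bswap_def)
  then show ?case using step by (simp add: C_rec)
qed

text \<open>The lower bound in \<open>piece\<close> places the point above the windows of all
  factors with index below I.\<close>

lemma C_crossing':
  assumes p: "piece I J t" and i: "i \<le> I"
  shows "C i (Suc J) (tail (Suc J) + t) = R I (Suc J) + t"
  using i
proof (induction i rule: inc_induct)
  case base
  show ?case using C_crossing[OF p] p by (simp add: piece_def)
next
  case (step i)
  obtain I' where I': "I = Suc I'" using step by (cases I) auto
  have "I \<le> n" using p by (simp add: piece_def)
  have "R (Suc i) (Suc J) + R i J < R I (Suc J) + t + R i (Suc J)"
    using p R_supers[of i I' J] R_monos[of "Suc i" I "Suc J"] step \<open>I \<le> n\<close> by (simp add: piece_def I')
  then have "W i (Suc J) (R I (Suc J) + t) = R I (Suc J) + t"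
    using step \<open>I \<le> n\<close> by (intro W_fix_high) auto
  then show ?case using step \<open>I \<le> n\<close> by (simp add: C_rec)
qed

text \<open>In this column only the factor with index I - 1 moves the point; it lies below the
  windows of the factors with larger index, and above those of the factors with smaller
  index.\<close>

lemma C_shift:
  assumes "I \<le> n" "j < n" "Rm I (Suc j) < x" "x \<le> R I (Suc j)"
  shows "C 0 (Suc j) x = x + (Rm I j - Rm I (Suc j))"
proof -
  have hi: "C i (Suc j) x = x" if "i \<le> n" "I \<le> i" for i
    using that
  proof (induction i rule: inc_induct)
    case base
    show "C n (Suc j) x = x" by (simp add: C_n)
  next
    case (step i)
    have "x \<le> R i (Suc j)" using R_monos[of I i "Suc j"] step assms by simp
    then show ?case using step by (simp add: C_rec W_fix_low)
  qed
  show ?thesis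
  proof (cases I)
    case 0
    then show ?thesis using hi[of 0] by simp
  next
    case (Suc I')
    let ?x = "x + (R I' j - R I' (Suc j))"
    have "C i (Suc j) x = ?x" if "i \<le> I'" for i
      using that
    proof (induction i rule: inc_induct)
      case base
      have "W I' (Suc j) x = ?x" using assms R_antimono[of I' j] by (auto simp: W_def bswap_def Suc)
      then show ?case using hi[of I] assms Suc by (simp add: C_rec)
    next
      case (step i)
      have "R (Suc i) j < ?x" using R_monos[of "Suc i" I' j] step assms Suc by simp
      then have "W i (Suc j) ?x = ?x" using step assms Suc by (intro W_fix_top) auto
      then show ?case using step assms Suc by (simp add: C_rec)
    qed
    from this[of 0] show ?thesis using Suc by simp
  qed
qed

text \<open>The height of the point above \<open>Rm I j\<close> stays constant while columns are
  added, and the point remains in the interval from \<open>Rm I j\<close> to \<open>R I j\<close>.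
  At j = 0 this interval is value block I.\<close>

lemma Z_piece:
  assumes p: "piece I J t" and "j \<le> J"
  shows "Z j (tail (Suc J) + t) + Rm I J = R I (Suc J) + t + Rm I j \<and>
    Rm I j < Z j (tail (Suc J) + t) \<and> Z j (tail (Suc J) + t) \<le> R I j"
  using assms(2)
proof (induction j rule: inc_induct)
  case base
  have In: "I \<le> n" "J \<le> n" "0 < t" using p by (auto simp: piece_def)
  have "Z J (tail (Suc J) + t) = R I (Suc J) + t"
  proof (cases "J = n")
    case True
    then show ?thesis by (simp add: Z_n)
  next
    case False
    then show ?thesis using In C_crossing'[OF p, of 0] Z_fix[of "Suc J" "tail (Suc J) + t"] by (simp add: Z_rec)
  qed
  then show ?case using p Rm_le[OF In(1), of "Suc J"] by (simp add: piece_def)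
next
  case (step j)
  have In: "I \<le> n" "j < n" using p step by (auto simp: piece_def)
  let ?x = "Z (Suc j) (tail (Suc J) + t)"
  have "Z j (tail (Suc J) + t) = C 0 (Suc j) ?x" using In by (simp add: Z_rec)
  moreover have "C 0 (Suc j) ?x = ?x + (Rm I j - Rm I (Suc j))"
    by (rule C_shift[OF In]) (use step.IH in auto)
  moreover have "Rm I (Suc j) \<le> Rm I j" using In by (intro Rm_antimono) simp
  ultimately have "Z j (tail (Suc J) + t) + Rm I (Suc j) = ?x + Rm I j" by linarith
  then show ?case using step.IH Rm_super[OF In(1), of j] by linarith
qed

lemma z_piece:
  assumes "piece I J t"
  shows "z (tail (Suc J) + t) + Rm I J = s I + R I (Suc J) + t" "s I < z (tail (Suc J) + t)"
    "z (tail (Suc J) + t) \<le> s (Suc I)"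
  using Z_piece[OF assms le0] assms by (auto simp: zel_perm_Z Rm_0 R_0 piece_def)

text \<open>The upper bound on t for I is the lower bound for I + 1, so the ranges are consecutive.
  Missing all of them would push t beyond e_J.\<close>

lemma piece_exists:
  assumes "J \<le> n" "0 < t" "t \<le> e J"
  obtains I where "piece I J t"
proof (rule ccontr)
  assume a: "\<not> thesis"
  have "I \<le> Suc n \<Longrightarrow> Rm I J < t + Rm I (Suc J)" for I
  proof (induction I)
    case (Suc I)
    then have "\<not> piece I J t" using a that by blast
    then show ?case using Suc assms by (simp add: piece_def)
  qed (use assms in simp)
  from this[of "Suc n"] show False using assms tail_rec[of J] by (simp add: R_n)
qed

lemma block_exists:
  assumes "0 < P" "P \<le> total_dim n e"
  obtains J t where "J \<le> n" "0 < t" "t \<le> e J" "P = tail (Suc J) + t"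
proof (rule ccontr)
  assume a: "\<not> thesis"
  have "J \<le> Suc n \<Longrightarrow> P \<le> tail J" for J
  proof (induction J)
    case 0
    then show ?case using assms s_tail[of 0] by simp
  next
    case (Suc J)
    show ?case
    proof (rule ccontr)
      assume "\<not> P \<le> tail (Suc J)"
      moreover have "P \<le> e J + tail (Suc J)" using Suc tail_rec[of J] by simp
      ultimately show False using a that[of J "P - tail (Suc J)"] Suc.prems by auto
    qed
  qed
  from this[of "Suc n"] show False using assms by simp
qed

lemma W_permutes: assumes "i < n" "1 \<le> j" shows "W i j permutes {1..total_dim n e}"
proof -
  have "R (Suc i) (j - 1) \<le> tail (j - 1)" using R_monos[of "Suc i" n "j - 1"] assms by (simp add: R_n)
  also have "\<dots> \<le> total_dim n e" using tail_antimono[of 0 "j - 1"] s_tail[of 0] by simp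
  finally show ?thesis unfolding W_def using W_range[OF assms] by (intro bswap_permutes) simp
qed

lemma finite_perm_W [simp]: "finite_perm (W i j)"
  by (simp add: W_def)

lemma z_list: "z = perm_prod (concat (map (\<lambda>j. map (\<lambda>i. W i j) [0..<n]) [1..<Suc n]))"
proof -
  have "map (\<lambda>i. W_perm n r i j) [0..<n] = map (\<lambda>i. W i j) [0..<n]" for j
    by (intro map_cong) (auto simp: W_perm_eq)
  then show ?thesis unfolding zel_perm_def by (simp only: Suc_eq_plus1)
qed

lemma z_permutes: "z permutes {1..total_dim n e}"
proof -
  have "perm_prod us permutes S" if "\<And>u. u \<in> set us \<Longrightarrow> u permutes S" for us and S :: "nat set"
    using that
  proof (induction us)
    case Nil
    show "perm_prod [] permutes S" by (simp add: perm_prod_simps)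
  next
    case (Cons u us)
    then have "u permutes S" "perm_prod us permutes S" by auto
    then show "perm_prod (u # us) permutes S" unfolding perm_prod_simps by (rule permutes_compose[rotated])
  qed
  note perms = this
  show ?thesis unfolding z_list
  proof (rule perms)
    fix u assume "u \<in> set (concat (map (\<lambda>j. map (\<lambda>i. W i j) [0..<n]) [1..<Suc n]))"
    then obtain i j where "u = W i j" "i < n" "1 \<le> j" by auto
    then show "u permutes {1..total_dim n e}" using W_permutes by simp
  qed
qed

lemma finite_perm_z [simp]: "finite_perm z"
  using z_permutes by (auto simp: finite_perm_def)

text \<open>As t grows, the index I of its piece cannot decrease, and on a single piece z is a
  translation.\<close>

lemma z_right_ascent:
  assumes "J \<le> n" "tail (Suc J) < P" "P < tail J"
  shows "z P < z (Suc P)"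
proof -
  define t where "t = P - tail (Suc J)"
  have t: "0 < t" "t < e J" "P = tail (Suc J) + t" using assms tail_rec[of J] by (auto simp: t_def)
  obtain I where I: "piece I J t" using piece_exists[of J t] t assms by auto
  obtain I' where I': "piece I' J (Suc t)" using piece_exists[of J "Suc t"] t assms by auto
  have "I \<le> I'"
  proof (rule ccontr)
    assume "\<not> I \<le> I'"
    then obtain K where K: "I = Suc K" "I' \<le> K" by (cases I) auto
    have "K \<le> n" using I K by (simp add: piece_def)
    then show False using I I' K R_supers[of I' K J] by (simp add: piece_def)
  qed
  show ?thesis
  proof (cases "I = I'")
    case True
    then show ?thesis using z_piece(1)[OF I] z_piece(1)[OF I'] t by simp
  next
    case False
    then have "s (Suc I) \<le> s I'" using \<open>I \<le> I'\<close> by (intro s_mono) simp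
    then show ?thesis using z_piece(3)[OF I] z_piece(2)[OF I'] t by simp
  qed
qed

text \<open>Within one value block, pieces with larger J have smaller values; since
  \<open>tail\<close> decreases, they also sit at smaller positions.\<close>

lemma z_left_ascent:
  assumes "I \<le> n" "s I < Q" "Q < s (Suc I)"
  shows "inv z Q < inv z (Suc Q)"
proof (rule ccontr)
  assume a: "\<not> inv z Q < inv z (Suc Q)"
  let ?P = "inv z Q" and ?P' = "inv z (Suc Q)"
  have zi: "z (inv z q) = q" for q using z_permutes by (simp add: permutes_inverses)
  have lt: "?P' < ?P" using a zi[of Q] zi[of "Suc Q"] by (metis linorder_neqE_nat n_not_Suc_n)
  have "s (Suc I) \<le> total_dim n e" using s_mono[of "Suc I" "Suc n"] assms s_Suc_n by simp
  then have "Q \<in> {1..total_dim n e}" "Suc Q \<in> {1..total_dim n e}" using assms by auto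
  then have "?P \<in> {1..total_dim n e}" "?P' \<in> {1..total_dim n e}"
    using permutes_in_image[OF permutes_inv[OF z_permutes]] by blast+
  then obtain J t J' t' where J: "J \<le> n" "0 < t" "t \<le> e J" "?P = tail (Suc J) + t"
    "J' \<le> n" "0 < t'" "t' \<le> e J'" "?P' = tail (Suc J') + t'"
    using block_exists[of ?P] block_exists[of ?P'] by (metis atLeastAtMost_iff less_eq_Suc_le One_nat_def)
  obtain K where K: "piece K J t" using piece_exists J by blast
  obtain K' where K': "piece K' J' t'" using piece_exists J by blast
  have blk: "L = I" if "s L < q" "q \<le> s (Suc L)" "s I < q" "q \<le> s (Suc I)" for L q
    using that s_mono[of "Suc L" I] s_mono[of "Suc I" L] by (metis linorder_neqE_nat not_le order.strict_trans1 Suc_leI)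
  have "K = I" using z_piece(2,3)[OF K] zi[of Q] J assms by (intro blk[of K Q]) auto
  moreover have "K' = I" using z_piece(2,3)[OF K'] zi[of "Suc Q"] J assms by (intro blk[of K' "Suc Q"]) auto
  ultimately have p: "piece I J t" "piece I J' t'" using K K' by auto
  have q: "Q + Rm I J = s I + R I (Suc J) + t" "Suc Q + Rm I J' = s I + R I (Suc J') + t'"
    using z_piece(1)[OF p(1)] z_piece(1)[OF p(2)] zi[of Q] zi[of "Suc Q"] J by auto
  show False
  proof (cases "J' \<le> J")
    case True
    show ?thesis
    proof (cases "J' = J")
      case True
      then show ?thesis using q lt J by simp
    next
      case False
      then have "tail J \<le> tail (Suc J')" using True by (intro tail_antimono) simp
      then show ?thesis using lt J tail_rec[of J] by simp
    qed
  next
    case False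
    \<comment> \<open>\<open>R I j - Rm I j\<close> decreases with j, so the values coming from J'
      would have to lie below those from J.\<close>
    have "R I j' + Rm I j \<le> R I j + Rm I j'" if "j \<le> j'" for j j'
      using that
    proof (induction j' rule: dec_induct)
      case (step k)
      then show ?case using Rm_super[OF assms(1), of k] by simp
    qed simp
    from this[of "Suc J" J'] show ?thesis using False q p by (simp add: piece_def)
  qed
qed

text \<open>For I at least J + 2 the difference of \<open>R (I - 1) J\<close> and
  \<open>R (I - 1) (Suc J)\<close> is all of e_J, so t would have to exceed e_J. This restriction is
  what forces the crossings.\<close>

lemma z_upper: assumes "J \<le> n" "tail (Suc J) < P" "P \<le> tail J" shows "z P \<le> s (J + 2)"
proof -
  define t where "t = P - tail (Suc J)"
  have t: "0 < t" "t \<le> e J" "P = tail (Suc J) + t" using assms tail_rec[of J] by (auto simp: t_def)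
  obtain I where I: "piece I J t" using piece_exists[of J t] t assms by auto
  have "I \<le> Suc J"
  proof (rule ccontr)
    assume "\<not> I \<le> Suc J"
    then obtain K where K: "I = Suc K" "Suc J \<le> K" by (cases I) auto
    have "I \<le> n" using I by (simp add: piece_def)
    have g: "R L J = e J + R L (Suc J)" if "Suc J \<le> L" "L \<le> n" for L
    proof -
      have "{J..L} = insert J {Suc J..L}" using that by auto
      then show ?thesis using that by (simp add: R_ge)
    qed
    show False using I K g[of K] t \<open>I \<le> n\<close> by (simp add: piece_def)
  qed
  then have "s (Suc I) \<le> s (J + 2)" by (intro s_mono) simp
  then show ?thesis using z_piece(3)[OF I] t by simp
qed

lemma sign_perm_prod:
  assumes "\<And>u. u \<in> set us \<Longrightarrow> finite_perm u"
  shows "finite_perm (perm_prod us) \<and>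
    (- 1 :: 'a::ring_1) ^ perm_length (perm_prod us) = prod_list (map (\<lambda>u. (- 1) ^ perm_length u) us)"
  using assms
proof (induction us)
  case Nil
  show "finite_perm (perm_prod []) \<and>
    (- 1 :: 'a) ^ perm_length (perm_prod []) = prod_list (map (\<lambda>u. (- 1) ^ perm_length u) [])"
    by (simp add: perm_prod_simps)
next
  case (Cons u us)
  then show "finite_perm (perm_prod (u # us)) \<and>
    (- 1 :: 'a) ^ perm_length (perm_prod (u # us)) = prod_list (map (\<lambda>u. (- 1) ^ perm_length u) (u # us))"
    by (simp add: perm_prod_simps sign_comp finite_perm_comp)
qed

text \<open>The parity of each block exchange is the product of its block lengths. The factors with
  i < j add up to d(r), and those with i at least j depend on e only.\<close>

lemma z_sign:
  "(- 1 :: 'a::comm_ring_1) ^ perm_length z = (- 1) ^ rank_codim n r *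
    (\<Prod>j\<in>{1..n}. \<Prod>i\<in>{j..<n}. (- 1) ^ (e (Suc i) * e (j - 1)))"
proof -
  let ?f = "\<lambda>i j. (R (Suc i) j - R i j) * (R i (j - 1) - R i j)"
  have prod_concat: "prod_list (concat xss) = prod_list (map prod_list xss)" for xss :: "'a list list"
    by (induction xss) auto
  have pl: "prod_list (map g [a..<b]) = prod g {a..<b}" for g :: "nat \<Rightarrow> 'a" and a b
    by (metis distinct_upt set_upt prod.distinct_set_conv_list)
  have "(- 1 :: 'a) ^ perm_length z =
      prod_list (map (\<lambda>u. (- 1) ^ perm_length u) (concat (map (\<lambda>j. map (\<lambda>i. W i j) [0..<n]) [1..<Suc n])))"
    unfolding z_list by (rule sign_perm_prod[THEN conjunct2]) auto
  also have "\<dots> = prod_list (map (\<lambda>j. prod_list (map (\<lambda>i. (- 1) ^ ?f i j) [0..<n])) [1..<Suc n])"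
    unfolding map_concat prod_concat map_map comp_def W_def sign_bswap ..
  also have "\<dots> = (\<Prod>j\<in>{1..<Suc n}. \<Prod>i\<in>{0..<n}. (- 1) ^ ?f i j)"
    unfolding pl ..
  also have "\<dots> = (\<Prod>j\<in>{1..n}. (- 1) ^ (\<Sum>i\<in>{0..<j}. (r i (j - 1) - r i j) * (r (i + 1) j - r i j)) *
      (\<Prod>i\<in>{j..<n}. (- 1) ^ (e (Suc i) * e (j - 1))))"
  proof (rule prod.cong)
    fix j assume j: "j \<in> {1..n}"
    have "(\<Prod>i\<in>{0..<n}. (- 1 :: 'a) ^ ?f i j) = (\<Prod>i\<in>{0..<j}. (- 1) ^ ?f i j) * (\<Prod>i\<in>{j..<n}. (- 1) ^ ?f i j)"
      using j by (simp add: prod.atLeastLessThan_concat)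
    also have "(\<Prod>i\<in>{0..<j}. (- 1 :: 'a) ^ ?f i j) = (\<Prod>i\<in>{0..<j}. (- 1) ^ ((r i (j - 1) - r i j) * (r (i + 1) j - r i j)))"
      using j by (intro prod.cong) (auto simp: R_le mult.commute)
    also have "\<dots> = (- 1) ^ (\<Sum>i\<in>{0..<j}. (r i (j - 1) - r i j) * (r (i + 1) j - r i j))"
      by (simp add: power_sum)
    also have "(\<Prod>i\<in>{j..<n}. (- 1 :: 'a) ^ ?f i j) = (\<Prod>i\<in>{j..<n}. (- 1) ^ (e (Suc i) * e (j - 1)))"
    proof (intro prod.cong refl)
      fix i assume i: "i \<in> {j..<n}"
      have "{j - 1..i} = insert (j - 1) {j..i}" "{j..Suc i} = insert (Suc i) {j..i}" using i j by auto
      moreover have "j - 1 \<notin> {j..i}" "Suc i \<notin> {j..i}" using j by auto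
      ultimately show "(- 1 :: 'a) ^ ?f i j = (- 1) ^ (e (Suc i) * e (j - 1))"
        using i j by (simp add: R_ge)
    qed
    finally show "(\<Prod>i\<in>{0..<n}. (- 1) ^ ?f i j) =
      (- 1) ^ (\<Sum>i\<in>{0..<j}. (r i (j - 1) - r i j) * (r (i + 1) j - r i j)) *
      (\<Prod>i\<in>{j..<n}. (- 1 :: 'a) ^ (e (Suc i) * e (j - 1)))" .
  qed auto
  also have "\<dots> = (- 1) ^ (\<Sum>j\<in>{1..n}. \<Sum>i\<in>{0..<j}. (r i (j - 1) - r i j) * (r (i + 1) j - r i j)) *
      (\<Prod>j\<in>{1..n}. \<Prod>i\<in>{j..<n}. (- 1) ^ (e (Suc i) * e (j - 1)))"
    by (simp add: prod.distrib power_sum)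
  also have "(\<Sum>j\<in>{1..n}. \<Sum>i\<in>{0..<j}. (r i (j - 1) - r i j) * (r (i + 1) j - r i j)) = rank_codim n r"
    unfolding rank_codim_def by (rule sum.mono_neutral_left) auto
  finally show ?thesis .
qed

definition delta :: "nat \<Rightarrow> nat \<Rightarrow> nat" where
  "delta j = bswap (e j) (tail (Suc j)) (e (j - 1))"

lemma delta_perm_eq: assumes "1 \<le> j" "j \<le> n" shows "delta_perm n r j = delta j"
proof
  fix p
  have t: "tail (j - 1) = e (j - 1) + (e j + tail (Suc j))" "tail j = e j + tail (Suc j)"
    using assms tail_rec[of j] tail_rec[of "j - 1"] by simp_all
  define a where "a = e j"
  define b where "b = e (j - 1)"
  define c where "c = tail (Suc j)"
  show "delta_perm n r j p = delta j p"
    unfolding delta_perm_def delta_def bswap_def Let_def R_n Suc_eq_plus1[symmetric] t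
      a_def[symmetric] b_def[symmetric] c_def[symmetric]
    by simp
qed

text \<open>The hypothesis says that every factor with i < j has an empty block. The other factors
  of column j merge into delta_j, and delta_n is the identity.\<close>

lemma z_delta:
  assumes "\<And>i j. i < j \<Longrightarrow> j \<le> n \<Longrightarrow> R i j = R (Suc i) j \<or> R i j = R i (j - 1)"
  shows "z = perm_prod (map delta [1..<n])"
proof -
  have Cd: "perm_prod (map (\<lambda>i. W i j) [j..<m]) = bswap (e j) (\<Sum>k\<in>{Suc j..m}. e k) (e (j - 1))"
    if "1 \<le> j" "j \<le> m" "m \<le> n" for j m
    using that(2,3)
  proof (induction m rule: dec_induct)
    case base
    show "perm_prod (map (\<lambda>i. W i j) [j..<j]) = bswap (e j) (\<Sum>k\<in>{Suc j..j}. e k) (e (j - 1))"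
      by (simp add: perm_prod_simps bswap_trivial)
  next
    case (step m)
    have IH: "perm_prod (map (\<lambda>i. W i j) [j..<m]) = bswap (e j) (\<Sum>k\<in>{Suc j..m}. e k) (e (j - 1))"
      using step by simp
    have a: "{j..m} = insert j {Suc j..m}" "{j - 1..m} = insert (j - 1) {j..m}" "{j..Suc m} = insert (Suc m) {j..m}"
      "{Suc j..Suc m} = insert (Suc m) {Suc j..m}"
      using step that(1) by auto
    have b: "j - 1 \<notin> {j..m}" using that(1) by auto
    have "R m j = e j + (\<Sum>k\<in>{Suc j..m}. e k)" "R m (j - 1) = e (j - 1) + R m j" "R (Suc m) j = e (Suc m) + R m j"
    proof -
      show "R m j = e j + (\<Sum>k\<in>{Suc j..m}. e k)"
        using step.hyps step.prems by (subst R_ge) (simp_all add: sum.atLeast_Suc_atMost)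
      show "R m (j - 1) = e (j - 1) + R m j"
        using step.hyps step.prems that(1) b a(2) R_ge[of "j - 1" m] R_ge[of j m] by simp
      show "R (Suc m) j = e (Suc m) + R m j"
        using step.hyps step.prems by (simp add: R_ge)
    qed
    then have "W m j = bswap (e j + (\<Sum>k\<in>{Suc j..m}. e k)) (e (Suc m)) (e (j - 1))"
      by (simp add: W_def)
    then show "perm_prod (map (\<lambda>i. W i j) [j..<Suc m]) = bswap (e j) (\<Sum>k\<in>{Suc j..Suc m}. e k) (e (j - 1))"
      using step by (simp add: IH perm_prod_simps bswap_comp_left a(4) add.commute)
  qed
  have id: "perm_prod us = id" if "\<And>u. u \<in> set us \<Longrightarrow> u = id" for us
    using that
  proof (induction us)
    case Nil
    show "perm_prod [] = id" by (simp add: perm_prod_simps)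
  next
    case (Cons u us)
    have "u = id" by (rule Cons.prems) simp
    moreover have "perm_prod us = id" by (rule Cons.IH) (rule Cons.prems, simp)
    ultimately show "perm_prod (u # us) = id" by (simp add: perm_prod_simps)
  qed
  have C: "C 0 j = delta j" if "1 \<le> j" "j \<le> n" for j
  proof -
    have "W i j = id" if "i < j" for i
      using assms[OF that \<open>j \<le> n\<close>] by (auto simp: W_def bswap_trivial)
    then have "perm_prod (map (\<lambda>i. W i j) [0..<j]) = id" by (intro id) auto
    moreover have "[0..<n] = [0..<j] @ [j..<n]" using that by (intro upt_split) auto
    ultimately show ?thesis
      using Cd[OF that(1,2) order_refl] by (simp add: C_def perm_prod_simps delta_def tail_def)
  qed
  have "Z 0 = perm_prod (map delta [1..<Suc n])"
    unfolding Z_def by (intro arg_cong[where f = perm_prod] map_cong) (auto simp: C)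
  also have "\<dots> = perm_prod (map delta [1..<n])"
  proof (cases "1 \<le> n")
    case True
    have "delta n = id" by (simp add: delta_def bswap_trivial)
    then show ?thesis using True by (simp add: perm_prod_simps)
  qed simp
  finally show ?thesis by (simp add: zel_perm_Z)
qed

end

section \<open>Generic rank conditions\<close>

lemma rank_conditions_generic: "rank_conditions n (generic_rank e)"
  unfolding rank_conditions_def
proof (intro conjI allI impI)
  fix i j :: nat assume "i < j \<and> j \<le> n"
  then show "generic_rank e i j \<le> min (generic_rank e i (j - 1)) (generic_rank e (i + 1) j)"
    unfolding generic_rank_def by (auto intro!: Min_antimono)
next
  fix i j :: nat assume a: "0 < i \<and> i \<le> j \<and> j < n"
  have s: "{i - 1..j} = insert (i - 1) {i..j}" "{i..j + 1} = insert (j + 1) {i..j}"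
    "{i - 1..j + 1} = insert (i - 1) (insert (j + 1) {i..j})" using a by auto
  have ne: "finite (e ` {i..j})" "e ` {i..j} \<noteq> {}" using a by auto
  have "generic_rank e (i - 1) j = min (e (i - 1)) (generic_rank e i j)"
    "generic_rank e i (j + 1) = min (e (j + 1)) (generic_rank e i j)"
    "generic_rank e (i - 1) (j + 1) = min (e (i - 1)) (min (e (j + 1)) (generic_rank e i j))"
  proof -
    let ?A = "e ` {i..j}"
    have "Min (insert x ?A) = min x (Min ?A)" for x by (rule Min_insert[OF ne])
    moreover have "Min (insert x (insert y ?A)) = min x (Min (insert y ?A))" for x y
      by (rule Min_insert) (use ne in auto)
    ultimately show "generic_rank e (i - 1) j = min (e (i - 1)) (generic_rank e i j)"
      "generic_rank e i (j + 1) = min (e (j + 1)) (generic_rank e i j)"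
      "generic_rank e (i - 1) (j + 1) = min (e (i - 1)) (min (e (j + 1)) (generic_rank e i j))"
      unfolding generic_rank_def s image_insert by metis+
  qed
  then show "generic_rank e (i - 1) j + generic_rank e i (j + 1) \<le> generic_rank e i j + generic_rank e (i - 1) (j + 1)"
    by linarith
qed

lemma dim_vec_generic: "dim_vec (generic_rank e) = e"
  by (simp add: fun_eq_iff dim_vec_def generic_rank_def)

text \<open>If the minimum over i, ..., j is not already that over i + 1, ..., j, it is attained at
  i, hence also over i, ..., j - 1. So every summand of the codimension has a zero factor.\<close>

lemma generic_rank_cases: "i < j \<Longrightarrow> generic_rank e i j = generic_rank e (Suc i) j \<or> generic_rank e i j = generic_rank e i (j - 1)"
proof -
  assume "i < j"
  then have a: "{i..j} = insert i {Suc i..j}" "{i..j} = insert j {i..j - 1}" by auto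
  have ne: "finite (e ` {i..j - 1})" "e ` {i..j - 1} \<noteq> {}" "finite (e ` {Suc i..j})" "e ` {Suc i..j} \<noteq> {}"
    using \<open>i < j\<close> by auto
  have m: "generic_rank e i j = min (e j) (generic_rank e i (j - 1))"
    "generic_rank e i j = min (e i) (generic_rank e (Suc i) j)"
    unfolding generic_rank_def using Min_insert[OF ne(1,2)] Min_insert[OF ne(3,4)] a by (metis image_insert)+
  have "generic_rank e i (j - 1) \<le> e i" "generic_rank e (Suc i) j \<le> e j"
    unfolding generic_rank_def using \<open>i < j\<close> by (auto intro!: Min_le)
  then show ?thesis using m by linarith
qed

subsection \<open>Words and their letters\<close>

text \<open>Scalar part 1 is what makes letters invisible at ascents; the range says that only the
  positions a + 1, ..., b are moved.\<close>

definition unit_letters :: "(nat \<times> 'k \<times> 'k::field) list \<Rightarrow> nat \<Rightarrow> nat \<Rightarrow> bool" where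
  "unit_letters L a b \<longleftrightarrow> (\<forall>x\<in>set L. fst (snd x) = 1 \<and> a \<le> fst x \<and> fst x + 2 \<le> b)"

lemma Lw_word: obtains L where "Lw p y = gprod L" "unit_letters L 0 p"
proof
  show "Lw p y = gprod (concat (map (\<lambda>i. map (\<lambda>k. hl k (y i)) [0..<i]) (rev [0..<p])))"
    by (simp add: Lw_def Aw_def gprod_concat)
qed (auto simp: unit_letters_def hl_def)

lemma Mw_word: obtains L where "Mw q x = gprod L" "unit_letters L 0 q"
proof
  show "Mw q x = gprod (concat (map (\<lambda>j. map (\<lambda>k. hl k (1 / x j)) (rev [0..<j])) [0..<q]))"
    by (simp add: Mw_def Bw_def gprod_concat)
qed (auto simp: unit_letters_def hl_def)

lemma Arow_word: obtains L where "Arow d m p y = gprod L" "unit_letters L d (Suc m)"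
proof
  show "Arow d m p y = gprod (concat (map (\<lambda>i. map (\<lambda>k. hl k (y i)) [d + i..<m]) (rev [0..<p])))"
    by (simp add: Arow_def Aw_def gprod_concat)
qed (auto simp: unit_letters_def hl_def)

lemma Bcol_word: obtains L where "Bcol d m q x = gprod L" "unit_letters L d (Suc m)"
proof
  show "Bcol d m q x = gprod (concat (map (\<lambda>j. map (\<lambda>k. hl k (1 / x j)) (rev [d + j..<m])) [0..<q]))"
    by (simp add: Bcol_def Bw_def gprod_concat)
qed (auto simp: unit_letters_def hl_def)

lemma grid_word: obtains L where "grid d m p q y x = gprod L" "unit_letters L d (Suc m)"
proof
  show "grid d m p q y x = gprod (concat (map (\<lambda>i. map (\<lambda>j. hl (d + i + j) (y i / x j)) [0..<min q (m - (d + i))]) (rev [0..<p])))"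
    by (simp add: grid_def hrow_gprod gprod_concat)
qed (auto simp: unit_letters_def hl_def)

lemma Hst_word: obtains L where "Hst m p q y x = gprod L" "unit_letters L 0 (Suc m)"
proof
  show "Hst m p q y x = gprod (concat (map (\<lambda>i. map (\<lambda>k. hl k (y i)) [0..<m]) (rev [0..<p])) @
      concat (map (\<lambda>j. map (\<lambda>k. hl k (1 / x j)) (rev [0..<m])) [0..<q]))"
    by (simp add: Hst_def Aw_def Bw_def gprod_concat)
qed (auto simp: unit_letters_def hl_def)

lemma Lw_Mw: "(\<And>i. i < p \<Longrightarrow> x i \<noteq> 0) \<Longrightarrow> Lw p x * Mw p x = 1"
  unfolding Mw_def Lw_def by (rule prod_list_cancel) (simp add: AB_cancel)

lemma coef_gprod_permutes:
  assumes "finite_perm w" "coef (gprod L) w \<noteq> 0" "\<And>x. x \<in> set L \<Longrightarrow> fst x + 2 \<le> M"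
  shows "w permutes {1..M}"
  using assms
proof (induction L arbitrary: w rule: rev_induct)
  case Nil
  then have "w = id" by (simp add: coef_1 split: if_splits)
  then show "w permutes {1..M}" by (simp only: permutes_id)
next
  case (snoc x L)
  obtain k a b where x: "x = (k, a, b)" by (cases x)
  have L: "\<And>x. x \<in> set L \<Longrightarrow> fst x + 2 \<le> M" using snoc.prems by simp
  have k: "Suc k < M" using snoc.prems(3)[of x] x by simp
  consider "coef (gprod L) w \<noteq> 0" | "coef (gprod L) (w \<circ> adj k) \<noteq> 0"
    using coef_snoc_nonzero[OF snoc.prems(1), of L k a b] snoc.prems(2) x by auto
  then show ?case
  proof cases
    case 1 then show ?thesis using snoc.IH snoc.prems(1) L by blast
  next
    case 2
    have f: "finite_perm (w \<circ> adj k)" using snoc.prems(1) by simp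
    have "w \<circ> adj k permutes {1..M}" by (rule snoc.IH[OF f 2 L])
    then have "w \<circ> adj k \<circ> adj k permutes {1..M}" by (rule permutes_compose[OF adj_permutes[OF k]])
    then show ?thesis by simp
  qed
qed

lemma coef_sum: "coef (sum f S) w = (\<Sum>x\<in>S. coef (f x) w)"
  by (simp add: coef_def lookup_sum)

lemma gprod_expand:
  assumes "\<And>x. x \<in> set L \<Longrightarrow> fst x + 2 \<le> M"
  shows "gprod L = (\<Sum>w\<in>{w. w permutes {1..M}}. Poly_Mapping.single (to_hperm w) (coef (gprod L) w))"
proof (rule coef_eqI)
  fix w assume w: "finite_perm w"
  let ?P = "{w. w permutes {1..M}}"
  have fin: "finite ?P" by (rule finite_permutations) simp
  have fp: "finite_perm u" if "u \<in> ?P" for u using that by (auto simp: finite_perm_def)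
  have "coef (\<Sum>w\<in>?P. Poly_Mapping.single (to_hperm w) (coef (gprod L) w)) w = (\<Sum>u\<in>?P. if u = w then coef (gprod L) u else 0)"
    unfolding coef_sum by (intro sum.cong refl) (use fp w in \<open>auto simp: coef_single\<close>)
  also have "\<dots> = (if w \<in> ?P then coef (gprod L) w else 0)" using fin by simp
  also have "\<dots> = coef (gprod L) w" using coef_gprod_permutes[OF w _ assms] by auto
  finally show "coef (gprod L) w = coef (\<Sum>w\<in>?P. Poly_Mapping.single (to_hperm w) (coef (gprod L) w)) w" ..
qed

definition choices :: "(nat \<Rightarrow> 'a set) \<Rightarrow> nat \<Rightarrow> 'a list set" where
  "choices P m = {ws. length ws = m \<and> (\<forall>i<m. ws ! i \<in> P i)}"

lemma choices_Suc: "choices P (Suc m) = (\<lambda>(ws, w). ws @ [w]) ` (choices P m \<times> P m)"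
proof (intro equalityI subsetI)
  fix ws assume ws: "ws \<in> choices P (Suc m)"
  then have "ws \<noteq> []" by (auto simp: choices_def)
  then have "ws = butlast ws @ [last ws]" by simp
  moreover have "butlast ws \<in> choices P m" "last ws \<in> P m"
    using ws \<open>ws \<noteq> []\<close> by (simp_all add: choices_def nth_butlast last_conv_nth)
  ultimately show "ws \<in> (\<lambda>(ws, w). ws @ [w]) ` (choices P m \<times> P m)" 
    by (intro image_eqI[of _ _ "(butlast ws, last ws)"]) auto
qed (auto simp: choices_def nth_append less_Suc_eq)

lemma prod_list_expand:
  fixes F :: "nat \<Rightarrow> ('k::field) hecke"
  assumes "\<And>i. i < m \<Longrightarrow> F i = (\<Sum>w\<in>P i. Poly_Mapping.single (g w) (c i w))" "\<And>i. i < m \<Longrightarrow> finite (P i)"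
  shows "prod_list (map (\<lambda>i. F i * Poly_Mapping.single (d i) 1) [0..<m]) =
    (\<Sum>ws\<in>choices P m. Poly_Mapping.single (sum_list (map (\<lambda>i. g (ws ! i) + d i) [0..<m])) (\<Prod>i<m. c i (ws ! i)))"
  using assms
proof (induction m)
  case 0
  have "choices P 0 = {[]}" by (auto simp: choices_def)
  then show ?case by simp
next
  case (Suc m)
  let ?g = "\<lambda>ws. sum_list (map (\<lambda>i. g (ws ! i) + d i) [0..<m])" and ?c = "\<lambda>ws. \<Prod>i<m. c i (ws ! i)"
  have inj: "inj_on (\<lambda>(ws, w). ws @ [w]) (choices P m \<times> P m)" by (auto simp: inj_on_def)
  have ss: "sum_list (map f [0..<Suc m]) = sum_list (map f [0..<m]) + f m" for f :: "nat \<Rightarrow> hperm" by simp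
  have g: "sum_list (map (\<lambda>i. g ((ws @ [w]) ! i) + d i) [0..<Suc m]) = ?g ws + (g w + d m)"
    "(\<Prod>i<Suc m. c i ((ws @ [w]) ! i)) = ?c ws * c m w" if "ws \<in> choices P m" for ws w
  proof -
    have l: "length ws = m" using that by (simp add: choices_def)
    have E: "map (\<lambda>i. g ((ws @ [w]) ! i) + d i) [0..<m] = map (\<lambda>i. g (ws ! i) + d i) [0..<m]"
      using l by (intro map_cong) (auto simp: nth_append)
    show "sum_list (map (\<lambda>i. g ((ws @ [w]) ! i) + d i) [0..<Suc m]) = ?g ws + (g w + d m)"
      unfolding ss E using l by (simp add: nth_append)
    have "(\<Prod>i<m. c i ((ws @ [w]) ! i)) = ?c ws" using l by (intro prod.cong) (auto simp: nth_append)
    then show "(\<Prod>i<Suc m. c i ((ws @ [w]) ! i)) = ?c ws * c m w" using l by (simp add: nth_append)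
  qed
  have "prod_list (map (\<lambda>i. F i * Poly_Mapping.single (d i) 1) [0..<Suc m]) =
      (\<Sum>ws\<in>choices P m. Poly_Mapping.single (?g ws) (?c ws)) *
      ((\<Sum>w\<in>P m. Poly_Mapping.single (g w) (c m w)) * Poly_Mapping.single (d m) 1)"
    using Suc by simp
  also have "\<dots> = (\<Sum>ws\<in>choices P m. \<Sum>w\<in>P m. Poly_Mapping.single (?g ws + (g w + d m)) (?c ws * c m w))"
    by (subst sum.swap) (simp add: sum_distrib_right sum_distrib_left mult_single)
  also have "\<dots> = (\<Sum>(ws, w)\<in>choices P m \<times> P m. Poly_Mapping.single (?g ws + (g w + d m)) (?c ws * c m w))"
    by (simp add: sum.cartesian_product)
  also have "\<dots> = (\<Sum>ws\<in>choices P (Suc m). Poly_Mapping.single (sum_list (map (\<lambda>i. g (ws ! i) + d i) [0..<Suc m])) (\<Prod>i<Suc m. c i (ws ! i)))"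
    unfolding choices_Suc sum.reindex[OF inj] comp_def
    by (intro sum.cong refl) (auto simp only: g split: prod.split)
  finally show ?case .
qed

lemma finite_choices: "(\<And>i. i < m \<Longrightarrow> finite (P i)) \<Longrightarrow> finite (choices P m)"
proof (induction m)
  case 0
  have "choices P 0 = {[]}" by (auto simp: choices_def)
  then show ?case by simp
next
  case (Suc m)
  then show ?case unfolding choices_Suc by simp
qed

subsection \<open>Comparison of rank functions\<close>

text \<open>Bruhat order with u above w.\<close>

definition rk_le :: "(nat \<Rightarrow> nat) \<Rightarrow> (nat \<Rightarrow> nat) \<Rightarrow> bool" where
  "rk_le u w \<longleftrightarrow> (\<forall>p v. rk u p v \<le> rk w p v)"

lemma rk_comp_adj_Suc:
  "rk (w \<circ> adj k) (Suc k) v = rk w k v + (if w (Suc (Suc k)) \<le> v then 1 else 0)"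
  using rk_Suc[of "w \<circ> adj k" k v] rk_comp_adj[of k k w v] by simp

lemma rk_Suc_Suc:
  "rk w (Suc (Suc k)) v = rk w k v + (if w (Suc k) \<le> v then 1 else 0) + (if w (Suc (Suc k)) \<le> v then 1 else 0)"
  by (simp add: rk_Suc)

text \<open>The entry at k + 1 drops to the least value compatible with the entries at k and k + 2.
  The formula is monotone in the rank function, which makes Demazure steps monotone.\<close>

lemma rk_dstep:
  "rk (dstep w k) p v = (if p = Suc k then max (rk w k v) (rk w (Suc (Suc k)) v - 1) else rk w p v)"
proof (cases "p = Suc k")
  case True
  then show ?thesis
    using rk_comp_adj_Suc[of w k v] rk_Suc[of w k v] rk_Suc_Suc[of w k v]
    by (auto simp: dstep_def max_def simp del: One_nat_def)
next
  case False
  then show ?thesis by (simp add: dstep_def rk_comp_adj)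
qed

lemma rk_le_trans: "rk_le u v \<Longrightarrow> rk_le v w \<Longrightarrow> rk_le u w"
  unfolding rk_le_def by (meson order_trans)

lemma rk_le_refl: "rk_le u u"
  by (simp add: rk_le_def)

lemma rk_le_dstep: assumes "rk_le u w" shows "rk_le (dstep u k) (dstep w k)"
  unfolding rk_le_def
proof (intro allI)
  fix p v
  have "rk u p v \<le> rk w p v" for p using assms by (simp add: rk_le_def)
  then show "rk (dstep u k) p v \<le> rk (dstep w k) p v"
    using max.mono[of "rk u k v" "rk w k v" "rk u (Suc (Suc k)) v - 1" "rk w (Suc (Suc k)) v - 1"]
    by (simp add: rk_dstep diff_le_mono)
qed

lemma dstep_rk_le: "rk_le (dstep w k) w" "rk_le (dstep w k) (w \<circ> adj k)"
  unfolding rk_le_def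
proof (intro allI)
  fix p v
  show "rk (dstep w k) p v \<le> rk w p v"
    using rk_Suc[of w k v] rk_Suc_Suc[of w k v] by (cases "p = Suc k") (simp_all add: rk_dstep)
next
  show "\<forall>p v. rk (dstep w k) p v \<le> rk (w \<circ> adj k) p v"
  proof (intro allI)
    fix p v
    show "rk (dstep w k) p v \<le> rk (w \<circ> adj k) p v"
      using rk_comp_adj_Suc[of w k v] rk_Suc_Suc[of w k v]
      by (cases "p = Suc k") (simp_all add: rk_dstep rk_comp_adj)
  qed
qed

lemma rk_le_act: "rk_le u w \<Longrightarrow> rk_le (act ks u) w"
proof (induction ks arbitrary: u)
  case (Cons k ks)
  then have "rk_le (dstep u k) w" using rk_le_trans dstep_rk_le(1) by blast
  then have "rk_le (act ks (dstep u k)) w" by (rule Cons.IH)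
  then show "rk_le (act (k # ks) u) w" by simp
qed simp

lemma rk_le_act_wprod: "rk_le u w \<Longrightarrow> rk_le (act ks u) (w \<circ> wprod ks)"
proof (induction ks arbitrary: u w)
  case (Cons k ks)
  then have "rk_le (dstep u k) (w \<circ> adj k)" using rk_le_trans[OF rk_le_dstep dstep_rk_le(2)] by blast
  then have "rk_le (act ks (dstep u k)) ((w \<circ> adj k) \<circ> wprod ks)" by (rule Cons.IH)
  then show "rk_le (act (k # ks) u) (w \<circ> wprod (k # ks))" by (simp add: comp_assoc)
next
  case Nil
  then show "rk_le (act [] u) (w \<circ> wprod [])" by simp
qed

text \<open>Demazure steps only lower ranks, so all letters except one may be dropped from the
  comparison.\<close>

lemma rk_le_act_letter:
  assumes "rk_le u w" "k \<in> set ks"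
  shows "rk_le (act ks u) (w \<circ> adj k)"
proof -
  obtain l1 l2 where ks: "ks = l1 @ k # l2" using assms by (meson split_list)
  have "rk_le (act l1 u) w" using assms rk_le_act by blast
  then have "rk_le (dstep (act l1 u) k) (w \<circ> adj k)" using rk_le_trans[OF rk_le_dstep dstep_rk_le(2)] by blast
  then have "rk_le (act l2 (dstep (act l1 u) k)) (w \<circ> adj k)" by (rule rk_le_act)
  then show ?thesis by (simp add: ks)
qed

text \<open>The witness is the prefix that ends where Q takes the value k + 1, with the bound
  \<open>P (Suc k)\<close> on values: inserting s_k removes this position from the count and adds no
  other.\<close>

lemma not_rk_le_insert:
  assumes "P (Suc k) < P (Suc (Suc k))" "bij Q" "inv Q (Suc k) < inv Q (Suc (Suc k))" "inv Q (Suc k) > 0"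
  shows "\<not> rk_le (P \<circ> Q) (P \<circ> adj k \<circ> Q)"
proof
  assume le: "rk_le (P \<circ> Q) (P \<circ> adj k \<circ> Q)"
  let ?a = "inv Q (Suc k)" and ?v = "P (Suc k)"
  let ?S = "{i \<in> {1..?a}. (P \<circ> adj k \<circ> Q) i \<le> ?v}" and ?T = "{i \<in> {1..?a}. (P \<circ> Q) i \<le> ?v}"
  have Qa: "Q ?a = Suc k" using assms(2) by (simp add: surj_f_inv_f bij_is_surj)
  have "?S \<subset> ?T"
  proof
    show "?S \<subseteq> ?T"
    proof
      fix i assume i: "i \<in> ?S"
      have "Q i \<noteq> Suc k" using i assms(1) by auto
      moreover have "Q i \<noteq> Suc (Suc k)"
      proof
        assume "Q i = Suc (Suc k)"
        then have "i = inv Q (Suc (Suc k))" using assms(2) by (metis bij_inv_eq_iff)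
        then show False using i assms(3) by auto
      qed
      ultimately show "i \<in> ?T" using i by auto
    qed
    have "?a \<in> ?T" "?a \<notin> ?S" using Qa assms by auto
    then show "?S \<noteq> ?T" by blast
  qed
  then have "card ?S < card ?T" by (intro psubset_card_mono) auto
  moreover have "card ?T \<le> card ?S" using le unfolding rk_le_def rk_def by blast
  ultimately show False by simp
qed

lemma redword_letters:
  assumes "redword ks w" "w permutes {1..M}" "k \<in> set ks"
  shows "k + 2 \<le> M"
  using assms
proof (induction ks arbitrary: w rule: rev_induct)
  case (snoc l ks)
  have d: "redword ks (w \<circ> adj l)" "w (Suc (Suc l)) < w (Suc l)" using snoc.prems by (auto simp: redword_snoc_iff)
  have l: "l + 2 \<le> M"
  proof (rule ccontr)
    assume "\<not> l + 2 \<le> M"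
    then have "Suc (Suc l) \<notin> {1..M}" "M \<le> Suc l" by auto
    then have "w (Suc (Suc l)) = Suc (Suc l)" "w (Suc l) \<le> Suc l"
      using permutes_not_in[OF snoc.prems(2)] permutes_in_image[OF snoc.prems(2), of "Suc l"]
      by (blast, cases "Suc l \<in> {1..M}") auto
    then show False using d by simp
  qed
  show ?case
  proof (cases "k = l")
    case False
    have "w \<circ> adj l permutes {1..M}" using l by (intro permutes_compose snoc.prems adj_permutes) simp
    moreover have "k \<in> set ks" using snoc.prems(3) False by simp
    ultimately show ?thesis by (rule snoc.IH[OF d(1)])
  qed (use l in simp)
qed simp

lemma rk_le_add:
  assumes "rk_le (of_hperm x) w"
  shows "rk_le (of_hperm (x + y)) w" "rk_le (of_hperm (x + y)) (w \<circ> of_hperm y)"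
proof -
  have "wprod (rw (of_hperm y)) = of_hperm y" using redword_rw[of "of_hperm y"] by (simp add: redword_def)
  then show "rk_le (of_hperm (x + y)) w" "rk_le (of_hperm (x + y)) (w \<circ> of_hperm y)"
    unfolding of_hperm_add using rk_le_act[OF assms] rk_le_act_wprod[OF assms, of "rw (of_hperm y)"] by auto
qed

lemma rk_le_add_letter:
  assumes "rk_le (of_hperm x) w" "of_hperm y permutes {1..M}" "of_hperm y \<noteq> id"
  obtains k where "k + 2 \<le> M" "rk_le (of_hperm (x + y)) (w \<circ> adj k)"
proof -
  have r: "redword (rw (of_hperm y)) (of_hperm y)" by (rule redword_rw) simp
  then have "rw (of_hperm y) \<noteq> []" using assms(3) by (auto simp: redword_def)
  then obtain k where k: "k \<in> set (rw (of_hperm y))" by (meson list.set_sel(1))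
  then show ?thesis
    using that[of k] redword_letters[OF r assms(2) k] rk_le_act_letter[OF assms(1) k] by (simp add: of_hperm_add)
qed

section \<open>The variables and their blocks\<close>

definition vv :: "nat \<Rightarrow> nat \<Rightarrow> ratfun" where
  "vv i p = indet i (Suc p)"

lemma vv_nonzero [simp]: "vv i p \<noteq> 0"
  by (simp add: vv_def)

lemma nth_concat_block:
  assumes "p < length y"
  shows "concat (xs @ y # zs) ! (length (concat xs) + p) = y ! p"
  using assms by (simp add: nth_append)

lemma var_block_nth: "p < e i \<Longrightarrow> var_block e i ! p = vv i p"
  by (simp add: var_block_def vv_def del: upt_Suc)

lemma length_var_block [simp]: "length (var_block e i) = e i"
  by (simp add: var_block_def)

lemma length_blocks: "length (concat (map (var_block e) is)) = sum_list (map e is)"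
  by (simp add: length_concat comp_def)

context ranks
begin

abbreviation "N \<equiv> total_dim n e"
abbreviation "a_rev \<equiv> nth (all_vars_rev n e)"
abbreviation "a_vars \<equiv> nth (all_vars n e)"

lemma a_vars_nth: assumes "i \<le> n" "p < e i" shows "a_vars (s i + p) = vv i p"
proof -
  have "[0..<n + 1] = [0..<i] @ i # [Suc i..<n + 1]"
    using assms upt_split[of 0 i "n + 1"] by (simp add: upt_conv_Cons)
  then have v: "all_vars n e = concat (map (var_block e) [0..<i] @ var_block e i # map (var_block e) [Suc i..<n + 1])"
    unfolding all_vars_def by simp
  have "length (concat (map (var_block e) [0..<i])) = s i"
    by (simp add: length_blocks interv_sum_list_conv_sum_set_nat s_def atLeast0LessThan)
  then show ?thesis using assms nth_concat_block[of p "var_block e i" "map (var_block e) [0..<i]"]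
    by (simp add: v var_block_nth)
qed

lemma a_rev_nth: assumes "i \<le> n" "p < e i" shows "a_rev (tail (Suc i) + p) = vv i p"
proof -
  have "[0..<n + 1] = [0..<i] @ i # [Suc i..<n + 1]"
    using assms upt_split[of 0 i "n + 1"] by (simp add: upt_conv_Cons)
  then have v: "all_vars_rev n e = concat (map (var_block e) (rev [Suc i..<n + 1]) @ var_block e i # map (var_block e) (rev [0..<i]))"
    unfolding all_vars_rev_def by simp
  have "{Suc i..n} = set [Suc i..<n + 1]" by auto
  then have "length (concat (map (var_block e) (rev [Suc i..<n + 1]))) = tail (Suc i)"
    unfolding length_blocks tail_def by (simp only: rev_map[symmetric] sum_list_rev interv_sum_list_conv_sum_set_nat)
  then show ?thesis using assms nth_concat_block[of p "var_block e i" "map (var_block e) (rev [Suc i..<n + 1])"]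
    by (simp add: v var_block_nth)
qed

lemma tail_block_exists:
  assumes "q < tail j" obtains k p where "j \<le> k" "k \<le> n" "p < e k" "q = tail (Suc k) + p"
proof (rule ccontr)
  assume a: "\<not> thesis"
  have "j \<le> k \<Longrightarrow> k \<le> Suc n \<Longrightarrow> q < tail k" for k
  proof (induction k rule: dec_induct)
    case base
    then show ?case using assms by simp
  next
    case (step k)
    show ?case
    proof (rule ccontr)
      assume "\<not> q < tail (Suc k)"
      moreover have "q < e k + tail (Suc k)" using step tail_rec[of k] by simp
      ultimately show False using a that[of k "q - tail (Suc k)"] step by auto
    qed
  qed
  moreover have "j \<le> Suc n" using assms tail_gt[of j] by (metis not_less_eq_eq not_less_zero Suc_le_eq le_SucI nat_le_linear)
  ultimately show False using tail_gt[of "Suc n"] by (metis lessI not_less_zero order_refl)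
qed

lemma a_rev_nonzero: assumes "q < N" shows "a_rev q \<noteq> 0"
proof -
  have "q < tail 0" using s_tail[of 0] assms by simp
  then obtain k p where "k \<le> n" "p < e k" "q = tail (Suc k) + p" by (rule tail_block_exists)
  then show ?thesis by (simp add: a_rev_nth)
qed

definition xbox :: "nat \<Rightarrow> nat \<Rightarrow> ratfun" where
  "xbox p q = a_vars p / a_rev q - 1"

text \<open>Such a column belongs to a block of index at least i + 2, so the two variables are
  distinct.\<close>

lemma xbox_nonzero:
  assumes "i \<le> n" "p < e i" "q < tail (Suc (Suc i))" shows "xbox (s i + p) q \<noteq> 0"
proof -
  obtain k l where k: "Suc (Suc i) \<le> k" "k \<le> n" "l < e k" "q = tail (Suc k) + l"
    using assms(3) by (rule tail_block_exists)
  have "vv i p \<noteq> vv k l" using k by (simp add: vv_def indet_eq_iff)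
  then show ?thesis using assms k by (simp add: xbox_def a_vars_nth a_rev_nth)
qed

subsection \<open>The blocks of the staircase\<close>

text \<open>The columns run through the blocks n, ..., 0. These are the boxes whose column block has
  index at least i + 2, where i is the row block.\<close>

definition S :: "(nat \<times> nat) set" where
  "S = {(p, q). \<exists>i\<le>n. s i \<le> p \<and> p < s (Suc i) \<and> q < tail (Suc (Suc i))}"

text \<open>By \<open>z_upper\<close>, values of z beyond \<open>s (Suc (Suc i))\<close> come from
  positions up to \<open>tail (Suc i)\<close>. After inversion and conjugation this says that the
  first \<open>tail (Suc (Suc i))\<close> values of z-hat all exceed
  \<open>s (Suc i)\<close>.\<close>

lemma S_facts:
  assumes "(p, q) \<in> S"
  shows "p + q + 1 < N" "rk (hat_perm N z) (Suc q) (Suc p) = 0"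
proof -
  obtain i where i: "i \<le> n" "s i \<le> p" "p < s (Suc i)" "q < tail (Suc (Suc i))"
    using assms by (auto simp: S_def)
  have "Suc i \<le> n" using i(4) tail_gt[of "Suc (Suc i)"] by (rule_tac ccontr) simp
  have t: "tail (Suc (Suc i)) \<le> tail (Suc i)" "s (Suc i) + tail (Suc i) = N" "s (Suc (Suc i)) + tail (Suc (Suc i)) = N"
    using s_tail[of "Suc i"] s_tail[of "Suc (Suc i)"] \<open>Suc i \<le> n\<close> tail_antimono[of "Suc i" "Suc (Suc i)"] by (simp_all del: s_simps)
  show pq: "p + q + 1 < N" using i t by linarith
  have "\<not> hat_perm N z j \<le> Suc p" if j: "j \<in> {1..Suc q}" for j
  proof -
    define Q where "Q = N + 1 - j"
    define P where "P = inv z Q"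
    have Q: "Q \<in> {1..N}" "s (Suc (Suc i)) < Q" using j i t pq by (auto simp: Q_def simp del: s_simps)
    have P: "P \<in> {1..N}" "z P = Q"
      using permutes_in_image[OF permutes_inv[OF z_permutes]] Q(1) permutes_inverses[OF z_permutes] unfolding P_def by blast+
    have "P \<le> tail (Suc i)"
    proof (rule ccontr)
      assume c: "\<not> P \<le> tail (Suc i)"
      obtain J l where J: "J \<le> n" "0 < l" "l \<le> e J" "P = tail (Suc J) + l" using block_exists[of P] P(1) by auto
      have "P \<le> tail J" using J tail_rec[of J] by simp
      then have "J \<le> i" using c tail_antimono[of "Suc i" J] by (metis not_less_eq_eq order_trans)
      then have "s (J + 2) \<le> s (Suc (Suc i))" by (intro s_mono) simp
      moreover have "z P \<le> s (J + 2)" using J \<open>P \<le> tail J\<close> by (intro z_upper) auto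
      ultimately show False using P Q by simp
    qed
    moreover have "hat_perm N z j = N + 1 - P"
    proof -
      have "longest_perm N j = Q" using j pq by (simp add: longest_perm_def Q_def)
      then have "hat_perm N z j = longest_perm N P" by (simp add: hat_perm_def P_def)
      then show ?thesis using P(1) by (simp add: longest_perm_def)
    qed
    ultimately show ?thesis using t i P(1) by auto
  qed
  then have "{j \<in> {1..Suc q}. hat_perm N z j \<le> Suc p} = {}" by blast
  then show "rk (hat_perm N z) (Suc q) (Suc p) = 0" unfolding rk_def by (simp only: card.empty)
qed

lemma finite_S: "finite S"
proof (rule finite_subset)
  show "S \<subseteq> {..<N} \<times> {..<N}" using S_facts(1) by fastforce
qed simp

text \<open>A row of block i falls into three parts: the forced boxes here, the boxes with the
  adjacent block in \<open>RW\<close>, and the triangle with its own block in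
  \<open>TW\<close>.\<close>

definition XW :: "nat \<Rightarrow> nat \<Rightarrow> (nat \<times> ratfun \<times> ratfun) list" where
  "XW i p = map (\<lambda>q. (s i + p + q, 0, xbox (s i + p) q)) [0..<tail (Suc (Suc i))]"

definition RW :: "nat \<Rightarrow> nat \<Rightarrow> (nat \<times> ratfun \<times> ratfun) list" where
  "RW i p = (if i < n then map (\<lambda>j. hl (s i + tail (Suc (Suc i)) + p + j) (vv i p / vv (Suc i) j)) [0..<e (Suc i)] else [])"

definition TW :: "nat \<Rightarrow> nat \<Rightarrow> (nat \<times> ratfun \<times> ratfun) list" where
  "TW i p = map (\<lambda>j. hl (s i + tail (Suc i) + p + j) (vv i p / vv i j)) [0..<e i - 1 - p]"

definition forced_box :: "nat \<Rightarrow> nat \<Rightarrow> nat \<times> ratfun \<times> ratfun" where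
  "forced_box p q = (p + q, if (p, q) \<in> S then 0 else 1, xbox p q)"

lemma block_row_unique: "s i \<le> p \<Longrightarrow> p < s (Suc i) \<Longrightarrow> s j \<le> p \<Longrightarrow> p < s (Suc j) \<Longrightarrow> i = j"
  using s_mono[of "Suc i" j] s_mono[of "Suc j" i]
  by (metis linorder_neqE_nat Suc_leI leD le_trans order.strict_trans1)

lemma forced_row:
  assumes i: "i \<le> n" "p < e i"
  shows "map (forced_box (s i + p)) [0..<N - 1 - (s i + p)] = XW i p @ RW i p @ TW i p"
proof -
  let ?c2 = "tail (Suc (Suc i))" and ?c1 = "tail (Suc i)" and ?f = "forced_box (s i + p)"
  have Ne: "s i + e i + ?c1 = N" using s_tail[of "Suc i"] i by simp
  have le: "?c2 \<le> ?c1" by (rule tail_antimono) simp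
  \<comment> \<open>The row ends inside its own block, of which \<open>e i - 1 - p\<close> boxes
    belong to the staircase.\<close>
  have l: "N - 1 - (s i + p) = ?c1 + (e i - 1 - p)" using Ne i by simp
  have sp: "[0..<N - 1 - (s i + p)] = [0..<?c2] @ [?c2..<?c1] @ [?c1..<?c1 + (e i - 1 - p)]"
    unfolding l using le upt_split[of 0 ?c2 "?c1 + (e i - 1 - p)"] upt_split[of ?c2 ?c1 "?c1 + (e i - 1 - p)"] by simp
  have inS: "(s i + p, q) \<in> S \<longleftrightarrow> q < ?c2" for q
  proof
    assume "(s i + p, q) \<in> S"
    then obtain j where j: "s j \<le> s i + p" "s i + p < s (Suc j)" "q < tail (Suc (Suc j))" by (auto simp: S_def)
    then have "j = i" using block_row_unique[of j "s i + p" i] i by simp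
    then show "q < ?c2" using j by simp
  next
    assume "q < ?c2"
    then show "(s i + p, q) \<in> S" using i unfolding S_def by auto
  qed
  have "map ?f [0..<?c2] = XW i p"
    unfolding XW_def by (intro map_cong) (auto simp: forced_box_def inS)
  moreover have "map ?f [?c2..<?c1] = RW i p"
  proof (cases "i < n")
    case True
    have c: "?c1 = ?c2 + e (Suc i)" using True tail_rec[of "Suc i"] by simp
    show ?thesis
    proof (rule nth_equalityI)
      fix j assume "j < length (map ?f [?c2..<?c1])"
      then have j: "j < e (Suc i)" using c by simp
      then show "map ?f [?c2..<?c1] ! j = RW i p ! j"
        using True c i by (simp add: RW_def forced_box_def inS hl_def xbox_def a_vars_nth a_rev_nth[of "Suc i" j])
    qed (use True c in \<open>simp add: RW_def\<close>)
  next
    case False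
    then show ?thesis using i by (simp add: RW_def)
  qed
  moreover have "map ?f [?c1..<?c1 + (e i - 1 - p)] = TW i p"
  proof (rule nth_equalityI)
    fix j assume "j < length (map ?f [?c1..<?c1 + (e i - 1 - p)])"
    then have j: "j < e i - 1 - p" by simp
    then show "map ?f [?c1..<?c1 + (e i - 1 - p)] ! j = TW i p ! j"
      using le i by (simp add: TW_def forced_box_def inS hl_def xbox_def a_vars_nth a_rev_nth[of i j])
  qed (simp add: TW_def)
  ultimately show ?thesis unfolding sp by simp
qed

text \<open>A triangle whose rows and columns carry the same variables is a product of mutually
  inverse factors.\<close>

lemma TW_1: assumes "i \<le> n" shows "prod_list (map (\<lambda>p. gprod (TW i p)) (rev [0..<e i])) = 1"
proof -
  let ?d = "s i + tail (Suc i)"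
  have Ne: "s i + e i + tail (Suc i) = N" using s_tail[of "Suc i"] assms by simp
  have "hrow (?d + p) (N - 1) (e i) (vv i p) (vv i) = gprod (TW i p)" for p
  proof -
    have "min (e i) (N - 1 - (?d + p)) = e i - 1 - p" using Ne by linarith
    then show ?thesis unfolding hrow_gprod TW_def by simp
  qed
  then have "prod_list (map (\<lambda>p. gprod (TW i p)) (rev [0..<e i])) = grid ?d (N - 1) (e i) (e i) (vv i) (vv i)"
    by (simp add: grid_def)
  also have "\<dots> = Arow ?d (N - 1) (e i) (vv i) * Bcol ?d (N - 1) (e i) (vv i)"
    by (rule grid_triangle) (use Ne in auto)
  also have "\<dots> = 1" by (rule Arow_Bcol_cancel) simp
  finally show ?thesis .
qed

definition XL :: "nat \<Rightarrow> (nat \<times> ratfun \<times> ratfun) list" where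
  "XL i = concat (map (XW i) (rev [0..<e i]))"

definition RL :: "nat \<Rightarrow> (nat \<times> ratfun \<times> ratfun) list" where
  "RL i = concat (map (RW i) (rev [0..<e i]))"

text \<open>Rows are read with p decreasing. A later part of row x has letters at distance at least
  two from those of the earlier parts of any row y < x, so the parts can be gathered.\<close>

lemma block_row:
  assumes "i \<le> n"
  shows "prod_list (map (\<lambda>p. gprod (map (forced_box p) [0..<N - 1 - p])) (rev [s i..<s (Suc i)])) = gprod (XL i @ RL i)"
proof -
  let ?X = "\<lambda>p. gprod (XW i p)" and ?R = "\<lambda>p. gprod (RW i p)" and ?T = "\<lambda>p. gprod (TW i p)"
  have desc: "sorted_wrt (>) (rev [0..<e i])" by (simp add: sorted_wrt_rev)
  have c2: "tail (Suc i) = tail (Suc (Suc i)) + (if i < n then e (Suc i) else 0)"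
    using tail_rec[of "Suc i"] assms by auto
  have rows: "[s i..<s (Suc i)] = map (\<lambda>p. s i + p) [0..<e i]" by (rule nth_equalityI) auto
  have row: "gprod (map (forced_box (s i + p)) [0..<N - 1 - (s i + p)]) = (?X p * ?R p) * ?T p" if "p < e i" for p
    unfolding forced_row[OF assms that] by (simp add: mult.assoc)
  have "prod_list (map (\<lambda>p. gprod (map (forced_box p) [0..<N - 1 - p])) (rev [s i..<s (Suc i)]))
      = prod_list (map (\<lambda>p. (?X p * ?R p) * ?T p) (rev [0..<e i]))"
    unfolding rows rev_map map_map comp_def
    by (intro arg_cong[where f = prod_list] map_cong refl row) simp
  also have "\<dots> = prod_list (map (\<lambda>p. ?X p * ?R p) (rev [0..<e i])) * prod_list (map ?T (rev [0..<e i]))"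
  proof (rule prod_list_mult_split)
    show "sorted_wrt (\<lambda>x y. ?T x * (?X y * ?R y) = ?X y * ?R y * ?T x) (rev [0..<e i])"
    proof (rule sorted_wrt_mono_rel[OF _ desc])
      fix x y :: nat assume "x > y"
      then have "gprod (TW i x) * gprod (XW i y @ RW i y) = gprod (XW i y @ RW i y) * gprod (TW i x)"
        by (intro gprod_commute) (auto simp: TW_def XW_def RW_def c2 split: if_splits)
      then show "?T x * (?X y * ?R y) = ?X y * ?R y * ?T x" by simp
    qed
  qed
  also have "prod_list (map (\<lambda>p. ?X p * ?R p) (rev [0..<e i])) =
      prod_list (map ?X (rev [0..<e i])) * prod_list (map ?R (rev [0..<e i]))"
  proof (rule prod_list_mult_split)
    show "sorted_wrt (\<lambda>x y. ?R x * ?X y = ?X y * ?R x) (rev [0..<e i])"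
    proof (rule sorted_wrt_mono_rel[OF _ desc])
      fix x y :: nat assume "x > y"
      then show "?R x * ?X y = ?X y * ?R x"
        by (intro gprod_commute) (auto simp: XW_def RW_def split: if_splits)
    qed
  qed
  finally show ?thesis using TW_1[OF assms] by (simp add: XL_def RL_def gprod_concat)
qed

lemma rows_concat: "rev [0..<s m] = concat (map (\<lambda>i. rev [s i..<s (Suc i)]) (rev [0..<m]))"
proof (induction m)
  case (Suc m)
  have "[0..<s (Suc m)] = [0..<s m] @ [s m..<s (Suc m)]" by (intro upt_split) auto
  then show ?case using Suc by simp
qed simp

definition blocks :: "(nat \<times> ratfun \<times> ratfun) list" where
  "blocks = concat (map (\<lambda>i. XL i @ RL i) (rev [0..<n]))"

lemma forced_word:
  "gprod (box_word N (\<lambda>x. if x \<in> S then 0 else 1) (\<lambda>x. xbox (fst x) (snd x))) = gprod blocks"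
proof -
  let ?g = "\<lambda>p. gprod (map (forced_box p) [0..<N - 1 - p])"
  have "box_word N (\<lambda>x. if x \<in> S then 0 else 1) (\<lambda>x. xbox (fst x) (snd x)) =
      concat (map (\<lambda>p. map (forced_box p) [0..<N - 1 - p]) (rev [0..<N]))"
    unfolding box_word_def boxes_def map_concat map_map comp_def forced_box_def by simp
  then have "gprod (box_word N (\<lambda>x. if x \<in> S then 0 else 1) (\<lambda>x. xbox (fst x) (snd x))) = prod_list (map ?g (rev [0..<s (Suc n)]))"
    by (simp only: gprod_concat s_Suc_n)
  also have "\<dots> = prod_list (map (\<lambda>i. prod_list (map ?g (rev [s i..<s (Suc i)]))) (rev [0..<Suc n]))"
  proof -
    have "prod_list (map ?g (concat (map f is))) = prod_list (map (\<lambda>i. prod_list (map ?g (f i))) is)" for f :: "nat \<Rightarrow> nat list" and "is"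
      by (induction "is") auto
    then show ?thesis unfolding rows_concat .
  qed
  also have "\<dots> = prod_list (map (\<lambda>i. gprod (XL i @ RL i)) (rev [0..<Suc n]))"
    by (intro arg_cong[where f = prod_list] map_cong refl block_row) auto
  \<comment> \<open>Row block n has neither forced boxes nor an adjacent block of larger
    index.\<close>
  also have "gprod (XL n @ RL n) = 1"
  proof -
    have c: "concat (map (\<lambda>_. []) xs) = ([] :: (nat \<times> ratfun \<times> ratfun) list)" for xs :: "nat list"
      by (induction xs) auto
    have w: "XW n = (\<lambda>_. [])" "RW n = (\<lambda>_. [])" by (auto simp: fun_eq_iff XW_def RW_def)
    show ?thesis unfolding XL_def RL_def w c by simp
  qed
  then have "prod_list (map (\<lambda>i. gprod (XL i @ RL i)) (rev [0..<Suc n])) = gprod blocks"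
    by (simp add: blocks_def gprod_concat)
  finally show ?thesis .
qed

lemma coef_tri_blocks: "coef (tri N a_rev a_vars) (hat_perm N z) = coef (gprod blocks) (hat_perm N z)"
proof -
  have fz: "finite_perm (hat_perm N z)" using hat_perm_permutes[OF z_permutes] by (auto simp: finite_perm_def)
  have "tri N a_rev a_vars = gprod (box_word N (\<lambda>_. 1) (\<lambda>x. xbox (fst x) (snd x)))"
    unfolding tri_gprod box_word_def hl_def xbox_def by (simp add: case_prod_unfold)
  then show ?thesis
    unfolding forced_word[symmetric]
    using coef_box_word_forced[OF fz finite_S, of N "\<lambda>_. 1" "\<lambda>x. xbox (fst x) (snd x)"] S_facts by simp
qed

end

section \<open>The block word read backwards\<close>

lemma prod_list_rev_comm: "prod_list (rev xs) = prod_list (xs :: 'a::comm_monoid_mult list)"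
  by (induction xs) (simp_all add: mult.commute)

lemma prod_list_upt: "prod_list (map f [0..<k]) = (\<Prod>i<k. f i :: 'a::comm_monoid_mult)"
  by (induction k) (simp_all add: mult.commute)

lemma gprod_crossings:
  assumes "\<And>x. x \<in> set L \<Longrightarrow> fst (snd x) = 0"
  shows "gprod L = Poly_Mapping.single (to_hperm (dem (map fst L))) (prod_list (map (\<lambda>x. snd (snd x)) L))"
proof -
  have "gprod L = Poly_Mapping.single (sum_list (map tau (map fst L))) (prod_list (map (\<lambda>x. snd (snd x)) L))"
    using assms
  proof (induction L)
    case (Cons x L)
    obtain k b where x: "x = (k, 0, b)" using Cons.prems[of x] by (cases x) auto
    have "gprod L = Poly_Mapping.single (sum_list (map tau (map fst L))) (prod_list (map (\<lambda>x. snd (snd x)) L))"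
      by (rule Cons.IH) (simp add: Cons.prems)
    then show ?case by (simp add: x lett_def mult_single)
  qed simp
  then show ?thesis by (simp only: tau_word)
qed

lemma prod_list_const:
  "prod_list (map (\<lambda>i. A i * (const (c i) * B i)) is) = const (prod_list (map c is)) * prod_list (map (\<lambda>i. A i * B i) is)"
proof (induction "is")
  case (Cons i "is")
  let ?P = "prod_list (map (\<lambda>i. A i * B i) is)" and ?c = "prod_list (map c is)"
  have "A i * (const (c i) * B i) * (const ?c * ?P) = (A i * const (c i)) * (B i * const ?c) * ?P"
    by (simp add: mult.assoc)
  also have "A i * const (c i) = const (c i) * A i" by (rule const_mult_commute[symmetric])
  also have "B i * const ?c = const ?c * B i" by (rule const_mult_commute[symmetric])
  also have "const (c i) * A i * (const ?c * B i) * ?P = const (c i) * (A i * const ?c) * B i * ?P"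
    by (simp add: mult.assoc)
  also have "A i * const ?c = const ?c * A i" by (rule const_mult_commute[symmetric])
  also have "const (c i) * (const ?c * A i) * B i * ?P = const (c i) * const ?c * (A i * B i * ?P)"
    by (simp add: mult.assoc)
  also have "const (c i) * const ?c = const (c i * ?c)" by (simp add: mult_single)
  finally show ?case using Cons by (simp add: mult.assoc)
qed simp

context ranks
begin

text \<open>Reading backwards reverses rows and columns, hence the order of the variables in each
  block.\<close>

definition vr :: "nat \<Rightarrow> nat \<Rightarrow> ratfun" where
  "vr i p = vv i (e i - 1 - p)"

lemma vr_nonzero [simp]: "vr i p \<noteq> 0"
  by (simp add: vr_def)

definition M :: "nat \<Rightarrow> nat" where "M i = e i + e (Suc i)"

definition G :: "nat \<Rightarrow> ratfun hecke" where
  "G i = grid 0 (M i - 1) (e i) (e (Suc i)) (vr i) (vr (Suc i))"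

definition D :: "nat \<Rightarrow> ratfun hecke" where
  "D i = Poly_Mapping.single (to_hperm (delta (Suc i))) 1"

definition H :: "nat \<Rightarrow> ratfun hecke" where
  "H i = Hst (M i - 1) (e i) (e (Suc i)) (vr i) (vr (Suc i))"

text \<open>The scalar collected from the forced crossings of block i.\<close>

definition kap :: "nat \<Rightarrow> ratfun" where
  "kap i = (\<Prod>p<e i. \<Prod>q<tail (Suc (Suc i)). xbox (s i + p) q)"

abbreviation "hatl \<equiv> \<lambda>(k, a, b). (N - 2 - k, a, b)"

lemma N_eq: "i < n \<Longrightarrow> N = s i + e i + e (Suc i) + tail (Suc (Suc i))"
  using s_tail[of "Suc i"] tail_rec[of "Suc i"] by simp

lemma RL_hat: assumes "i < n" shows "gprod (rev (map hatl (RL i))) = G i"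
proof -
  let ?q = "e (Suc i)"
  define f where "f p = gprod (map (\<lambda>j. hl (p + j) (vr i p / vr (Suc i) j)) [0..<?q])" for p
  have r: "rev (map hatl (RW i p)) = map (\<lambda>j. hl ((e i - 1 - p) + j) (vr i (e i - 1 - p) / vr (Suc i) j)) [0..<?q]"
    if "p < e i" for p
  proof (rule nth_equalityI)
    show "length (rev (map hatl (RW i p))) = length (map (\<lambda>j. hl ((e i - 1 - p) + j) (vr i (e i - 1 - p) / vr (Suc i) j)) [0..<?q])"
      using assms by (simp add: RW_def)
    fix l assume "l < length (rev (map hatl (RW i p)))"
    then have l: "l < ?q" using assms by (simp add: RW_def)
    define j where "j = ?q - 1 - l"
    have j: "j < ?q" "?q = l + j + 1" using l by (auto simp: j_def)
    have rwl: "length (RW i p) = ?q" using assms by (simp add: RW_def)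
    have "RW i p ! j = hl (s i + tail (Suc (Suc i)) + p + j) (vv i p / vv (Suc i) j)"
      using assms j(1) by (simp add: RW_def)
    moreover have "rev (map hatl (RW i p)) ! l = hatl (RW i p ! j)"
      using rwl l by (simp add: rev_nth j_def)
    moreover have "N - 2 - (s i + tail (Suc (Suc i)) + p + j) = (e i - 1 - p) + l"
      using N_eq[OF assms] that j(2) by simp
    moreover have "vr i (e i - 1 - p) = vv i p" "vr (Suc i) l = vv (Suc i) j"
      using that by (simp_all add: vr_def j_def)
    ultimately show "rev (map hatl (RW i p)) ! l = map (\<lambda>j. hl ((e i - 1 - p) + j) (vr i (e i - 1 - p) / vr (Suc i) j)) [0..<?q] ! l"
      using l by (simp add: hl_def)
  qed
  have "rev (map hatl (RL i)) = concat (map (\<lambda>p. rev (map hatl (RW i p))) [0..<e i])"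
    unfolding RL_def by (simp add: rev_concat map_concat rev_map comp_def)
  then have "gprod (rev (map hatl (RL i))) = prod_list (map (\<lambda>p. gprod (rev (map hatl (RW i p)))) [0..<e i])"
    by (simp only: gprod_concat)
  also have "\<dots> = prod_list (map (\<lambda>p. f (e i - 1 - p)) [0..<e i])"
    by (intro arg_cong[where f = prod_list] map_cong refl) (simp only: r f_def set_upt atLeastLessThan_iff)
  also have "\<dots> = prod_list (map f (rev [0..<e i]))" by (simp only: map_rev_upt)
  also have "\<dots> = G i"
    unfolding G_def grid_def
  proof (intro arg_cong[where f = prod_list] map_cong refl)
    fix p assume "p \<in> set (rev [0..<e i])"
    then have "min ?q (M i - 1 - p) = ?q" by (auto simp: M_def)
    then show "f p = hrow (0 + p) (M i - 1) (e (Suc i)) (vr i p) (vr (Suc i))"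
      by (simp add: hrow_gprod f_def)
  qed
  finally show ?thesis .
qed

text \<open>Letters without scalar part multiply as in the Demazure monoid. Read backwards, the rows
  of forced boxes are the rows of the word \<open>blk\<close> for delta_{i+1}.\<close>

lemma XL_hat: assumes "i < n" shows "gprod (rev (map hatl (XL i))) = const (kap i) * D i"
proof -
  let ?c = "tail (Suc (Suc i))" and ?L = "rev (map hatl (XL i))"
  have L: "?L = concat (map (\<lambda>p. rev (map hatl (XW i p))) [0..<e i])"
    unfolding XL_def by (simp add: rev_concat map_concat rev_map comp_def)
  have r: "map fst (rev (map hatl (XW i p))) = [e (Suc i) + e i - 1 - p..<e (Suc i) + e i - 1 - p + ?c]"
    if "p < e i" for p
  proof (rule nth_equalityI)
    show "length (map fst (rev (map hatl (XW i p)))) = length [e (Suc i) + e i - 1 - p..<e (Suc i) + e i - 1 - p + ?c]"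
      by (simp add: XW_def)
    fix l assume "l < length (map fst (rev (map hatl (XW i p))))"
    then have l: "l < ?c" by (simp add: XW_def)
    define j where "j = ?c - 1 - l"
    have j: "j < ?c" "?c = l + j + 1" using l by (auto simp: j_def)
    have len: "length (XW i p) = ?c" by (simp add: XW_def)
    have "map fst (rev (map hatl (XW i p))) ! l = N - 2 - (s i + p + j)"
      using l len by (simp add: rev_nth) (simp add: XW_def j_def)
    also have "\<dots> = e (Suc i) + e i - 1 - p + l" using N_eq[OF assms] that j(2) by simp
    finally show "map fst (rev (map hatl (XW i p))) ! l = [e (Suc i) + e i - 1 - p..<e (Suc i) + e i - 1 - p + ?c] ! l"
      using l by simp
  qed
  have "map fst ?L = concat (map (\<lambda>p. map fst (rev (map hatl (XW i p)))) [0..<e i])"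
    unfolding L map_concat map_map comp_def ..
  also have "\<dots> = concat (map (\<lambda>p. [e (Suc i) + e i - 1 - p..<e (Suc i) + e i - 1 - p + ?c]) [0..<e i])"
    by (intro arg_cong[where f = concat] map_cong refl r) simp
  also have "\<dots> = blk (e (Suc i)) ?c (e i)" unfolding blk_alt ..
  finally have fst: "map fst ?L = blk (e (Suc i)) ?c (e i)" .
  have pc: "prod_list (concat xss) = prod_list (map prod_list xss)" for xss :: "ratfun list list"
    by (induction xss) auto
  have "prod_list (map (\<lambda>x. snd (snd x)) ?L) = prod_list (map (\<lambda>p. prod_list (map (\<lambda>x. snd (snd x)) (rev (map hatl (XW i p))))) [0..<e i])"
    unfolding L map_concat pc map_map comp_def ..
  also have "\<dots> = prod_list (map (\<lambda>p. \<Prod>q<?c. xbox (s i + p) q) [0..<e i])"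
  proof (intro arg_cong[where f = prod_list] map_cong refl)
    fix p
    have "map (\<lambda>x. snd (snd x)) (map hatl (XW i p)) = map (\<lambda>q. xbox (s i + p) q) [0..<?c]"
      by (simp add: XW_def)
    then show "prod_list (map (\<lambda>x. snd (snd x)) (rev (map hatl (XW i p)))) = (\<Prod>q<?c. xbox (s i + p) q)"
      by (simp only: rev_map[symmetric] prod_list_rev_comm prod_list_upt)
  qed
  also have "\<dots> = kap i" unfolding kap_def prod_list_upt ..
  finally have k: "prod_list (map (\<lambda>x. snd (snd x)) ?L) = kap i" .
  have "gprod ?L = Poly_Mapping.single (to_hperm (dem (map fst ?L))) (prod_list (map (\<lambda>x. snd (snd x)) ?L))"
    by (rule gprod_crossings) (auto simp: XL_def XW_def)
  also have "\<dots> = Poly_Mapping.single (to_hperm (delta (Suc i))) (kap i)"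
    unfolding k fst dem_blk delta_def by simp
  finally show ?thesis by (simp add: D_def mult_single)
qed

lemma coef_tri_z:
  "coef (tri N a_rev a_vars) (hat_perm N z) = (\<Prod>i<n. kap i) * coef (prod_list (map (\<lambda>i. G i * D i) [0..<n])) z"
proof -
  have bound: "fst x + 2 \<le> N" if x: "x \<in> set blocks" for x
  proof -
    obtain i where i: "i < n" "x \<in> set (XL i @ RL i)" using x unfolding blocks_def by auto
    then show ?thesis using N_eq[OF i(1)] by (auto simp: XL_def XW_def RL_def RW_def hl_def)
  qed
  have "rev (map hatl blocks) = concat (map (\<lambda>i. rev (map hatl (RL i)) @ rev (map hatl (XL i))) [0..<n])"
    unfolding blocks_def by (simp add: rev_concat map_concat rev_map comp_def)
  then have "gprod (rev (map hatl blocks)) = prod_list (map (\<lambda>i. G i * (const (kap i) * D i)) [0..<n])"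
    by (simp only: gprod_concat gprod_simps)
      (intro arg_cong[where f = prod_list] map_cong refl, simp only: set_upt atLeastLessThan_iff RL_hat XL_hat)
  then have "coef (gprod blocks) (hat_perm N z) = coef (prod_list (map (\<lambda>i. G i * (const (kap i) * D i)) [0..<n])) z"
    using coef_hat[OF z_permutes bound] by simp
  then show ?thesis
    unfolding coef_tri_blocks prod_list_const by (simp only: coef_const_mult prod_list_upt)
qed

subsection \<open>From rectangles to stable polynomials\<close>

text \<open>Positions are counted from the beginning of block i, hence the shift by
  \<open>s i\<close>. The letter exchanges two values inside one block b > i, where the inverse of
  z(r) ascends.\<close>

definition left_letter :: "nat \<Rightarrow> nat \<Rightarrow> bool" where
  "left_letter i k \<longleftrightarrow> (\<exists>b. i < b \<and> b \<le> n \<and> s b \<le> k + s i \<and> k + 2 + s i \<le> s (Suc b))"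

definition right_letter :: "nat \<Rightarrow> nat \<Rightarrow> bool" where
  "right_letter i k \<longleftrightarrow> (\<exists>J. i \<le> J \<and> J \<le> n \<and> tail (Suc J) \<le> k \<and> k + 2 \<le> tail J)"

lemma left_letter_range: assumes "left_letter i k" shows "e i \<le> k" "k + 2 \<le> tail i"
proof -
  obtain b where b: "i < b" "b \<le> n" "s b \<le> k + s i" "k + 2 + s i \<le> s (Suc b)" using assms by (auto simp: left_letter_def)
  then show "e i \<le> k" using s_mono[of "Suc i" b] by simp
  show "k + 2 \<le> tail i" using b s_mono[of "Suc b" "Suc n"] s_Suc_n s_tail[of i] by simp
qed

lemma delta_apply:
  "p \<le> e (Suc i) \<Longrightarrow> delta (Suc i) p = p"
  "e (Suc i) < p \<Longrightarrow> p \<le> e (Suc i) + tail (Suc (Suc i)) \<Longrightarrow> delta (Suc i) p = p + e i"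
  "e (Suc i) + tail (Suc (Suc i)) < p \<Longrightarrow> p \<le> e (Suc i) + tail (Suc (Suc i)) + e i \<Longrightarrow> delta (Suc i) p = p - tail (Suc (Suc i))"
  by (simp_all add: delta_def bswap_def)

lemma finite_perm_delta [simp]: "finite_perm (delta j)"
  by (simp add: delta_def)

text \<open>The bound on the letters of the later factors lets the letters that move to the right
  commute with them.\<close>

lemma GD_word:
  obtains L where "prod_list (map (\<lambda>k. G k * D k) [i..<n]) = gprod L" "\<And>x. x \<in> set L \<Longrightarrow> fst x + 2 \<le> tail i"
proof -
  have "\<exists>L. G k * D k = gprod L \<and> (\<forall>x\<in>set L. fst x + 2 \<le> tail i)" if k: "i \<le> k" "k < n" for k
  proof -
    obtain L where L: "G k = gprod L" "unit_letters L 0 (Suc (M k - 1))" unfolding G_def by (rule grid_word)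
    have t: "tail k = e k + (e (Suc k) + tail (Suc (Suc k)))" "tail k \<le> tail i"
      using k tail_rec[of k] tail_rec[of "Suc k"] tail_antimono[of i k] by simp_all
    let ?B = "map (\<lambda>k. (k, 0, 1)) (blk (e (Suc k)) (tail (Suc (Suc k))) (e k)) :: (nat \<times> ratfun \<times> ratfun) list"
    have "gprod ?B = Poly_Mapping.single (to_hperm (dem (map fst ?B))) (prod_list (map (\<lambda>x. snd (snd x)) ?B))"
      by (rule gprod_crossings) auto
    also have "map fst ?B = blk (e (Suc k)) (tail (Suc (Suc k))) (e k)" by (simp add: comp_def)
    also have "prod_list (map (\<lambda>x. snd (snd x)) ?B) = 1" by (rule prod_list_all_1) auto
    finally have B: "gprod ?B = D k" unfolding dem_blk D_def delta_def by simp
    have "fst x + 2 \<le> tail i" if "x \<in> set L" for x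
      using L(2) that t by (auto simp: unit_letters_def M_def)
    moreover have "fst x + 2 \<le> tail i" if "x \<in> set ?B" for x
    proof -
      have "fst x \<in> set (blk (e (Suc k)) (tail (Suc (Suc k))) (e k))" using that by auto
      then show ?thesis using set_blk t by fastforce
    qed
    ultimately have "\<forall>x\<in>set (L @ ?B). fst x + 2 \<le> tail i" by (simp only: set_append) blast
    moreover have "G k * D k = gprod (L @ ?B)" using L(1) B by simp
    ultimately show ?thesis by blast
  qed
  then obtain F where F: "\<And>k. i \<le> k \<Longrightarrow> k < n \<Longrightarrow> G k * D k = gprod (F k) \<and> (\<forall>x\<in>set (F k). fst x + 2 \<le> tail i)" by metis
  show ?thesis
  proof (rule that)
    show "prod_list (map (\<lambda>k. G k * D k) [i..<n]) = gprod (concat (map F [i..<n]))"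
      unfolding gprod_concat using F by (intro arg_cong[where f = prod_list] map_cong) auto
    show "fst x + 2 \<le> tail i" if "x \<in> set (concat (map F [i..<n]))" for x
      using that F by auto
  qed
qed

text \<open>
  The last factor of \<open>H\<^sub>i\<close> cancels the first factor of \<open>H\<^sub>i\<^sub>+\<^sub>1\<close>, with which \<open>\<delta>\<^sub>i\<^sub>+\<^sub>1\<close>
  commutes; the other outer factors pass the \<open>\<delta>\<close>'s with their letters shifted.
\<close>

lemma HD_factor:
  assumes "i \<le> n"
  shows "\<exists>C F. prod_list (map (\<lambda>k. H k * D k) [i..<n]) =
      Lw (e i) (vr i) * gprod C * prod_list (map (\<lambda>k. G k * D k) [i..<n]) * gprod F \<and>
    (\<forall>x\<in>set C. fst (snd x) = 1 \<and> left_letter i (fst x)) \<and> (\<forall>x\<in>set F. fst (snd x) = 1 \<and> right_letter i (fst x))"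
  using assms
proof (induction i rule: inc_induct)
  case base
  \<comment> \<open>Both products are empty here. Writing 1 as \<open>Lw\<close> times
    \<open>Mw\<close> provides the first factor that the next step is going to cancel.\<close>
  obtain F where F: "Mw (e n) (vr n) = gprod F" "unit_letters F 0 (e n)" by (rule Mw_word)
  have "tail n = e n" using tail_rec[of n] by simp
  then have "\<forall>x\<in>set F. fst (snd x) = 1 \<and> right_letter n (fst x)"
    using F(2) unfolding unit_letters_def right_letter_def by (auto intro!: exI[of _ n])
  moreover have "Lw (e n) (vr n) * gprod F = 1" unfolding F(1)[symmetric] by (rule Lw_Mw) simp
  ultimately show ?case by (intro exI[of _ "[]"] exI[of _ F]) simp
next
  case (step i)
  let ?p = "e i" and ?q = "e (Suc i)" and ?t = "tail (Suc (Suc i))"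
  let ?S = "prod_list (map (\<lambda>k. G k * D k) [Suc i..<n])"
  have t: "tail (Suc i) = ?q + ?t" "tail i = ?p + (?q + ?t)" using tail_rec[of "Suc i"] tail_rec[of i] step by simp_all
  obtain C F where CF: "prod_list (map (\<lambda>k. H k * D k) [Suc i..<n]) =
      Lw ?q (vr (Suc i)) * gprod C * ?S * gprod F"
    "\<And>x. x \<in> set C \<Longrightarrow> fst (snd x) = 1 \<and> left_letter (Suc i) (fst x)"
    "\<And>x. x \<in> set F \<Longrightarrow> fst (snd x) = 1 \<and> right_letter (Suc i) (fst x)"
    using step.IH by blast
  obtain L where L: "Lw ?q (vr (Suc i)) = gprod L" "unit_letters L 0 ?q" by (rule Lw_word)
  obtain B where B: "Bcol ?p (M i - 1) ?q (vr (Suc i)) = gprod B" "unit_letters B ?p (Suc (M i - 1))" by (rule Bcol_word)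
  obtain A where A: "Arow ?q (M i - 1) ?p (vr i) = gprod A" "unit_letters A ?q (Suc (M i - 1))" by (rule Arow_word)
  obtain K where K: "G i = gprod K" "unit_letters K 0 (Suc (M i - 1))" unfolding G_def by (rule grid_word)
  obtain W where W: "?S = gprod W" "\<And>x. x \<in> set W \<Longrightarrow> fst x + 2 \<le> tail (Suc i)" using GD_word[of "Suc i"] by blast
  \<comment> \<open>The letters of L only involve the first \<open>?q\<close> positions, which delta
    fixes.\<close>
  have LD: "gprod L * D i = D i * gprod L"
  proof -
    have "gprod L * D i = D i * gprod (map (\<lambda>(k, a, b). (id k, a, b)) L)"
      unfolding D_def by (rule gprod_conj) (use L(2) in \<open>auto simp: unit_letters_def delta_apply\<close>)
    then show ?thesis by (simp add: case_prod_unfold)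
  qed
  \<comment> \<open>On the last \<open>?p\<close> positions of its range delta subtracts
    \<open>?t\<close>, so letters that pass it to the right gain \<open>?t\<close>.\<close>
  define A' where "A' = map (\<lambda>(k, a, b). (k + ?t, a, b)) A"
  have A_range: "?q \<le> fst x \<and> fst x + 2 \<le> ?p + ?q \<and> fst (snd x) = 1" if "x \<in> set A" for x
    using A(2) that by (auto simp: unit_letters_def M_def)
  have AD: "gprod A * D i = D i * gprod A'"
    unfolding D_def A'_def
    by (rule gprod_conj) (use A_range in \<open>fastforce simp: delta_apply(3)\<close>)+
  have A'_range: "tail (Suc i) \<le> fst x \<and> fst x + 2 \<le> tail i \<and> fst (snd x) = 1" if "x \<in> set A'" for x
    using that A_range t by (fastforce simp: A'_def)
  \<comment> \<open>On the middle window delta adds \<open>?p\<close>, so letters that pass it to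
    the left gain \<open>?p\<close>.\<close>
  define C' where "C' = map (\<lambda>(k, a, b). (k + ?p, a, b)) C"
  have C_range: "?q \<le> fst x \<and> fst x + 2 \<le> ?q + ?t" if "x \<in> set C" for x
    using left_letter_range[of "Suc i" "fst x"] CF(2)[OF that] t by simp
  have "gprod C' * D i = D i * gprod (map (\<lambda>(k, a, b). (k - ?p, a, b)) C')"
    unfolding D_def
    by (rule gprod_conj) (use C_range in \<open>fastforce simp: C'_def delta_apply(2)\<close>)+
  moreover have "map (\<lambda>(k, a, b). (k - ?p, a, b)) C' = C" by (simp add: C'_def case_prod_unfold comp_def)
  ultimately have CD: "D i * gprod C = gprod C' * D i" by simp
  have C'_range: "?p + ?q \<le> fst x" if "x \<in> set C'" for x
    using that C_range by (fastforce simp: C'_def)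
  have AC: "gprod A' * gprod C = gprod C * gprod A'"
    by (rule gprod_commute) (use A'_range C_range t in fastforce)
  have AW: "gprod A' * gprod W = gprod W * gprod A'"
    by (rule gprod_commute) (use A'_range W(2) in fastforce)
  have KC: "gprod K * gprod C' = gprod C' * gprod K"
  proof (rule gprod_commute)
    fix x y assume "x \<in> set K" "y \<in> set C'"
    \<comment> \<open>If \<open>M i\<close> is 0, the truncated difference \<open>M i - 1\<close>
      does no harm: K then has no letters.\<close>
    then have "fst x + 2 \<le> Suc (M i - 1)" "?p + ?q \<le> fst y" "?p + ?q \<ge> 1 \<or> fst x + 2 \<le> 1"
      using K(2) C'_range by (auto simp: unit_letters_def M_def)
    then show "fst x + 2 \<le> fst y \<or> fst y + 2 \<le> fst x" by (auto simp: M_def)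
  qed
  have Mw: "Mw ?q (vr (Suc i)) * gprod L = 1" unfolding L(1)[symmetric] by (rule Mw_Lw) simp
  have H: "H i = Lw ?p (vr i) * gprod B * gprod K * gprod A * Mw ?q (vr (Suc i))"
    unfolding H_def B(1)[symmetric] A(1)[symmetric] K(1)[symmetric] G_def
    by (rule Hst_factor) (auto simp: M_def)
  let ?Lp = "Lw ?p (vr i)" and ?m = "Mw ?q (vr (Suc i))"
  have "prod_list (map (\<lambda>k. H k * D k) [i..<n]) = H i * D i * (gprod L * gprod C * gprod W * gprod F)"
    using step CF(1) L(1) W(1) by (simp add: upt_conv_Cons)
  also have "\<dots> = ?Lp * gprod B * gprod K * gprod A * ?m * (D i * gprod L) * gprod C * gprod W * gprod F"
    unfolding H by (simp add: mult.assoc)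
  also have "\<dots> = ?Lp * gprod B * gprod K * gprod A * (?m * gprod L) * D i * gprod C * gprod W * gprod F"
    unfolding LD[symmetric] by (simp add: mult.assoc)
  also have "\<dots> = ?Lp * gprod B * gprod K * (gprod A * D i) * gprod C * gprod W * gprod F"
    unfolding Mw by (simp add: mult.assoc)
  also have "\<dots> = ?Lp * gprod B * gprod K * D i * (gprod A' * gprod C) * gprod W * gprod F"
    unfolding AD by (simp add: mult.assoc)
  also have "\<dots> = ?Lp * gprod B * gprod K * (D i * gprod C) * (gprod A' * gprod W) * gprod F"
    unfolding AC by (simp add: mult.assoc)
  also have "\<dots> = ?Lp * gprod B * (gprod K * gprod C') * D i * gprod W * (gprod A' * gprod F)"
    unfolding AW CD by (simp add: mult.assoc)
  also have "\<dots> = ?Lp * gprod (B @ C') * (G i * D i * ?S) * gprod (A' @ F)"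
    unfolding KC K(1) W(1) by (simp add: mult.assoc)
  also have "G i * D i * ?S = prod_list (map (\<lambda>k. G k * D k) [i..<n])"
    using step by (simp add: upt_conv_Cons)
  finally have eq: "prod_list (map (\<lambda>k. H k * D k) [i..<n]) =
      ?Lp * gprod (B @ C') * prod_list (map (\<lambda>k. G k * D k) [i..<n]) * gprod (A' @ F)" .
  have "fst (snd x) = 1 \<and> left_letter i (fst x)" if "x \<in> set B" for x
  proof -
    have "?p \<le> fst x \<and> fst x + 2 \<le> ?p + ?q \<and> fst (snd x) = 1" using B(2) that by (auto simp: unit_letters_def M_def)
    then show ?thesis unfolding left_letter_def using step by (auto intro!: exI[of _ "Suc i"])
  qed
  moreover have "fst (snd x) = 1 \<and> left_letter i (fst x)" if x: "x \<in> set C'" for x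
  proof -
    obtain y where y: "y \<in> set C" "x = (fst y + ?p, snd y)" using x by (auto simp: C'_def)
    then obtain b where "Suc i < b" "b \<le> n" "s b \<le> fst y + s (Suc i)" "fst y + 2 + s (Suc i) \<le> s (Suc b)" "fst (snd y) = 1"
      using CF(2)[OF y(1)] by (auto simp: left_letter_def)
    then show ?thesis using y unfolding left_letter_def by (auto intro!: exI[of _ b])
  qed
  moreover have "fst (snd x) = 1 \<and> right_letter i (fst x)" if "x \<in> set A'" for x
    using A'_range[OF that] step unfolding right_letter_def by (auto intro!: exI[of _ i])
  moreover have "fst (snd x) = 1 \<and> right_letter i (fst x)" if "x \<in> set F" for x
    using CF(3)[OF that] unfolding right_letter_def by (auto intro: Suc_leD)
  ultimately show ?case using eq by (intro exI[of _ "B @ C'"] exI[of _ "A' @ F"]) auto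
qed

lemma coef_HD: "coef (prod_list (map (\<lambda>k. H k * D k) [0..<n])) z = coef (prod_list (map (\<lambda>k. G k * D k) [0..<n])) z"
proof -
  obtain C F where CF: "prod_list (map (\<lambda>k. H k * D k) [0..<n]) =
      Lw (e 0) (vr 0) * gprod C * prod_list (map (\<lambda>k. G k * D k) [0..<n]) * gprod F"
    "\<And>x. x \<in> set C \<Longrightarrow> fst (snd x) = 1 \<and> left_letter 0 (fst x)"
    "\<And>x. x \<in> set F \<Longrightarrow> fst (snd x) = 1 \<and> right_letter 0 (fst x)"
    using HD_factor[of 0] by blast
  obtain L where L: "Lw (e 0) (vr 0) = gprod L" "unit_letters L 0 (e 0)" by (rule Lw_word)
  \<comment> \<open>The remaining triangle \<open>Lw\<close> exchanges values of block 0 only, and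
    each letter of C exchanges values of one later block.\<close>
  have left: "fst (snd x) = 1 \<and> inv z (Suc (fst x)) < inv z (Suc (Suc (fst x)))" if x: "x \<in> set (L @ C)" for x
  proof -
    have "\<exists>b\<le>n. s b \<le> fst x \<and> fst x + 2 \<le> s (Suc b) \<and> fst (snd x) = 1"
    proof (cases "x \<in> set L")
      case True
      then show ?thesis using L(2) by (intro exI[of _ 0]) (auto simp: unit_letters_def)
    next
      case False
      then have "x \<in> set C" using x by simp
      then show ?thesis using CF(2)[of x] by (auto simp: left_letter_def)
    qed
    then obtain b where "b \<le> n" "s b \<le> fst x" "fst x + 2 \<le> s (Suc b)" "fst (snd x) = 1" by blast
    then show ?thesis using z_left_ascent[of b "Suc (fst x)"] by simp
  qed
  have right: "fst (snd x) = 1 \<and> z (Suc (fst x)) < z (Suc (Suc (fst x)))" if x: "x \<in> set F" for x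
  proof -
    obtain J where "J \<le> n" "tail (Suc J) \<le> fst x" "fst x + 2 \<le> tail J" "fst (snd x) = 1"
      using CF(3)[OF x] by (auto simp: right_letter_def)
    then show ?thesis using z_right_ascent[of J "Suc (fst x)"] by simp
  qed
  have "coef (prod_list (map (\<lambda>k. H k * D k) [0..<n])) z =
      coef (gprod (L @ C) * (prod_list (map (\<lambda>k. G k * D k) [0..<n]) * gprod F)) z"
    unfolding CF(1) L(1) by (simp add: mult.assoc)
  also have "\<dots> = coef (prod_list (map (\<lambda>k. G k * D k) [0..<n]) * gprod F) z"
    by (rule coef_left_invisible[OF finite_perm_z left])
  also have "\<dots> = coef (prod_list (map (\<lambda>k. G k * D k) [0..<n])) z"
    by (rule coef_right_invisible[OF finite_perm_z right])
  finally show ?thesis .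
qed

end

section \<open>Expansion over factorizations\<close>

lemma sign_inv:
  assumes "finite_perm w"
  shows "(- 1 :: 'a::ring_1) ^ perm_length (inv w) = (- 1) ^ perm_length w"
proof -
  obtain ks where "w = wprod ks" using redword_exists[OF assms] by (auto simp: redword_def)
  then show ?thesis by (simp add: inv_wprod sign_wprod)
qed

lemma sign_hat_perm:
  assumes "finite_perm w"
  shows "(- 1 :: 'a::comm_ring_1) ^ perm_length (hat_perm N w) = (- 1) ^ perm_length w"
proof -
  have f: "finite_perm (inv w)" "finite_perm (longest_perm N \<circ> inv w)"
    using assms by (simp_all add: finite_perm_inv finite_perm_comp)
  have "(- 1 :: 'a) ^ perm_length (longest_perm N) * (- 1) ^ perm_length (longest_perm N) = 1"
    by (simp add: power_add[symmetric])
  then show ?thesis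
    unfolding hat_perm_def sign_comp[OF f(2) finite_perm_longest] sign_comp[OF finite_perm_longest f(1)] sign_inv[OF assms]
    by (simp add: ac_simps)
qed

lemma minus_one_powi_diff: "(- 1 :: 'a::field) powi (int a - int b) = (- 1) ^ a * (- 1) ^ b"
proof -
  have "(- 1 :: 'a) powi (int a - int b) = (- 1) ^ a / (- 1) ^ b" by (simp add: power_int_diff)
  also have "\<dots> = (- 1) ^ a * (- 1) ^ b" by (simp add: divide_inverse power_inverse[symmetric])
  finally show ?thesis .
qed

lemma sum_list_concat_pairs:
  "sum_list (map f (concat (map (\<lambda>i. [u i, v i]) is))) = sum_list (map (\<lambda>i. f (u i) + f (v i) :: 'a::monoid_add) is)"
  by (induction "is") (auto simp: add.assoc)

context ranks
begin

lemma H_vv: "H i = Hst (M i - 1) (e i) (e (Suc i)) (vv i) (vv (Suc i))"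
proof -
  have "vr j = (\<lambda>p. vv j (e j - 1 - p))" for j by (simp add: fun_eq_iff vr_def)
  then show ?thesis unfolding H_def by (simp only:) (rule Hst_rev; simp)
qed

lemma stable_H:
  assumes "w permutes {1..M i}"
  shows "stable_grothendieck (M i) w (var_block e (Suc i)) (var_block e i) = (- 1) ^ perm_length w * coef (H i) w"
proof -
  have "Hst (M i - 1) (e i) (e (Suc i)) (nth (var_block e i)) (nth (var_block e (Suc i))) = H i"
    unfolding H_vv by (rule Hst_cong) (simp_all add: var_block_nth)
  moreover have "x \<noteq> 0" if "x \<in> set (var_block e (Suc i))" for x
    using that by (auto simp: var_block_def)
  ultimately show ?thesis using stable_grothendieck_coef[OF assms, of "var_block e (Suc i)" "var_block e i"] by simp
qed

lemma H_letters:
  obtains L where "H i = gprod L" "\<And>x. x \<in> set L \<Longrightarrow> fst x + 2 \<le> M i \<and> fst (snd x) = 1"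
proof -
  obtain L where L: "H i = gprod L" "unit_letters L 0 (Suc (M i - 1))" unfolding H_def by (rule Hst_word)
  show thesis by (rule that[OF L(1)]) (use L(2) in \<open>force simp: unit_letters_def\<close>)
qed

lemma H_expand: "H i = (\<Sum>w\<in>{w. w permutes {1..M i}}. Poly_Mapping.single (to_hperm w) (coef (H i) w))"
proof -
  obtain L where "H i = gprod L" "\<And>x. x \<in> set L \<Longrightarrow> fst x + 2 \<le> M i \<and> fst (snd x) = 1" by (rule H_letters) blast
  then show ?thesis using gprod_expand[of L "M i"] by simp
qed

lemma coef_H_id: "coef (H i) id = 1"
proof -
  obtain L where L: "H i = gprod L" "\<And>x. x \<in> set L \<Longrightarrow> fst x + 2 \<le> M i \<and> fst (snd x) = 1" by (rule H_letters) blast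
  have "coef (1 * gprod L) id = coef 1 id"
    by (rule coef_right_invisible) (use L(2) in auto)
  then show ?thesis by (simp add: L(1) coef_1)
qed

text \<open>The last delta is the identity; with it all n steps have the same shape.\<close>

definition hecke_word :: "(nat \<Rightarrow> nat) list \<Rightarrow> nat \<Rightarrow> hperm" where
  "hecke_word ws m = sum_list (map (\<lambda>i. to_hperm (ws ! i) + to_hperm (delta (Suc i))) [0..<m])"

lemma hecke_word_simps: "hecke_word ws 0 = 0"
  "hecke_word ws (Suc m) = hecke_word ws m + to_hperm (ws ! m) + to_hperm (delta (Suc m))"
  by (simp_all add: hecke_word_def add.assoc)

lemma delta_n: "delta n = id"
  by (simp add: delta_def bswap_trivial)

lemma KMS_factorizations_eq:
  assumes "n \<ge> 1"
  shows "KMS_factorizations n r = {ws \<in> choices (\<lambda>i. {w. w permutes {1..M i}}) n. of_hperm (hecke_word ws n) = z}"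
proof -
  obtain m where n: "n = Suc m" using assms by (cases n) auto
  have c: "ws \<in> choices (\<lambda>i. {w. w permutes {1..M i}}) n \<longleftrightarrow>
      length ws = n \<and> (\<forall>i\<in>{1..n}. (ws ! (i - 1)) permutes {1..e (i - 1) + e i})" for ws
  proof -
    have "(\<forall>i\<in>{1..n}. (ws ! (i - 1)) permutes {1..e (i - 1) + e i}) \<longleftrightarrow> (\<forall>i<n. (ws ! i) permutes {1..M i})"
      unfolding M_def
    proof (intro iffI allI impI ballI)
      fix i assume "\<forall>i\<in>{1..n}. (ws ! (i - 1)) permutes {1..e (i - 1) + e i}" "i < n"
      then show "(ws ! i) permutes {1..e i + e (Suc i)}" by (metis Suc_le_eq atLeastAtMost_iff diff_Suc_1 le_add1 plus_1_eq_Suc)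
    next
      fix i assume "\<forall>i<n. (ws ! i) permutes {1..e i + e (Suc i)}" "i \<in> {1..n}"
      then show "(ws ! (i - 1)) permutes {1..e (i - 1) + e i}" by (cases i) auto
    qed
    then show ?thesis by (simp add: choices_def)
  qed
  have a: "abs_hecke_prod (concat (map (\<lambda>j. [ws ! (j - 1), delta_perm n r j]) [1..<n]) @ [ws ! (n - 1)]) = of_hperm (hecke_word ws n)"
    if ws: "ws \<in> choices (\<lambda>i. {w. w permutes {1..M i}}) n" for ws
  proof -
    have fp: "finite_perm (ws ! i)" if "i < n" for i using ws that by (auto simp: choices_def finite_perm_def)
    have "map (\<lambda>j. [ws ! (j - 1), delta_perm n r j]) [1..<n] = map (\<lambda>i. [ws ! i, delta (Suc i)]) [0..<m]"
    proof -
      have "delta_perm n r (Suc i) = delta (Suc i)" if "i < m" for i using that n by (intro delta_perm_eq) auto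
      moreover have "[1..<n] = map Suc [0..<m]" using n by (simp only: map_Suc_upt One_nat_def)
      ultimately show ?thesis by simp
    qed
    then have l: "concat (map (\<lambda>j. [ws ! (j - 1), delta_perm n r j]) [1..<n]) @ [ws ! (n - 1)] =
        concat (map (\<lambda>i. [ws ! i, delta (Suc i)]) [0..<m]) @ [ws ! m]" using n by simp
    have d: "to_hperm (delta n) = 0" by (simp only: delta_n zero_hperm_def)
    have fp': "finite_perm (ws ! i)" if "i \<le> m" for i using fp[of i] n that by simp
    have "abs_hecke_prod (concat (map (\<lambda>i. [ws ! i, delta (Suc i)]) [0..<m]) @ [ws ! m]) =
        of_hperm (sum_list (map to_hperm (concat (map (\<lambda>i. [ws ! i, delta (Suc i)]) [0..<m]) @ [ws ! m])))"
      by (rule abs_hecke_prod_eq) (use fp' in auto)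
    also have "sum_list (map to_hperm (concat (map (\<lambda>i. [ws ! i, delta (Suc i)]) [0..<m]) @ [ws ! m])) = hecke_word ws n"
      unfolding map_append sum_list_append sum_list_concat_pairs hecke_word_simps(2)[of ws m, folded n] d
      by (simp add: hecke_word_def)
    finally show ?thesis unfolding l .
  qed
  show ?thesis
    unfolding KMS_factorizations_def
  proof (rule Collect_cong)
    fix ws
    show "(length ws = n \<and> (\<forall>i\<in>{1..n}. (ws ! (i - 1)) permutes {1..e (i - 1) + e i}) \<and>
        abs_hecke_prod (concat (map (\<lambda>j. [ws ! (j - 1), delta_perm n r j]) [1..<n]) @ [ws ! (n - 1)]) = z) \<longleftrightarrow>
      ws \<in> choices (\<lambda>i. {w. w permutes {1..M i}}) n \<and> of_hperm (hecke_word ws n) = z"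
      unfolding conj_assoc[symmetric] c[symmetric] by (rule conj_cong[OF refl]) (simp only: a)
  qed
qed

lemma coef_HD_sum:
  assumes "n \<ge> 1"
  shows "coef (prod_list (map (\<lambda>i. H i * D i) [0..<n])) z = (\<Sum>ws\<in>KMS_factorizations n r. \<Prod>i<n. coef (H i) (ws ! i))"
proof -
  let ?C = "choices (\<lambda>i. {w. w permutes {1..M i}}) n"
  have fin: "finite ?C" by (intro finite_choices finite_permutations) simp
  have "prod_list (map (\<lambda>i. H i * D i) [0..<n]) =
      (\<Sum>ws\<in>?C. Poly_Mapping.single (hecke_word ws n) (\<Prod>i<n. coef (H i) (ws ! i)))"
    unfolding D_def hecke_word_def
    by (rule prod_list_expand) (simp_all only: H_expand[symmetric] finite_permutations finite_atLeastAtMost)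
  then have "coef (prod_list (map (\<lambda>i. H i * D i) [0..<n])) z =
      (\<Sum>ws\<in>?C. if of_hperm (hecke_word ws n) = z then \<Prod>i<n. coef (H i) (ws ! i) else 0)"
    by (simp only: coef_sum coef_single[OF finite_perm_z])
  also have "\<dots> = (\<Sum>ws\<in>KMS_factorizations n r. \<Prod>i<n. coef (H i) (ws ! i))"
    unfolding KMS_factorizations_eq[OF assms] using fin by (simp add: sum.inter_filter)
  finally show ?thesis .
qed

subsection \<open>The generic case\<close>

definition dprod :: "nat \<Rightarrow> nat \<Rightarrow> nat \<Rightarrow> nat" where
  "dprod i m = perm_prod (map (\<lambda>k. delta (Suc k)) [i..<m])"

lemma dprod_same: "dprod i i = id"
  by (simp add: dprod_def perm_prod_simps)

lemma dprod_Suc: "i \<le> m \<Longrightarrow> dprod i (Suc m) = dprod i m \<circ> delta (Suc m)"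
  by (simp add: dprod_def perm_prod_simps)

lemma dprod_rec: "i < m \<Longrightarrow> dprod i m = delta (Suc i) \<circ> dprod (Suc i) m"
  by (simp add: dprod_def perm_prod_simps upt_conv_Cons)

lemma dprod_comp: "i \<le> m \<Longrightarrow> dprod 0 i \<circ> dprod i m = dprod 0 m"
  unfolding dprod_def perm_prod_simps(3)[symmetric] map_append[symmetric] using upt_split[of 0 i m] by simp

lemma tail_step: "i < n \<Longrightarrow> tail i = e i + tail (Suc i) \<and> tail (Suc i) = e (Suc i) + tail (Suc (Suc i))"
  using tail_rec[of i] tail_rec[of "Suc i"] by simp

text \<open>On the first \<open>tail (Suc m)\<close> positions delta_{m+1} is increasing with values
  up to \<open>tail m\<close>, where the product of the earlier deltas is increasing by
  induction.\<close>

lemma dprod_increasing: "m \<le> n \<Longrightarrow> p < q \<Longrightarrow> q \<le> tail m \<Longrightarrow> dprod 0 m p < dprod 0 m q"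
proof (induction m arbitrary: p q)
  case 0
  then show "dprod 0 0 p < dprod 0 0 q" by (simp add: dprod_same)
next
  case (Suc m)
  have t: "tail m = e m + tail (Suc m)" "tail (Suc m) = e (Suc m) + tail (Suc (Suc m))" using Suc.prems tail_step[of m] by auto
  have "delta (Suc m) p < delta (Suc m) q" "delta (Suc m) q \<le> tail m"
    using Suc.prems t by (auto simp: delta_def bswap_def)
  then show "dprod 0 (Suc m) p < dprod 0 (Suc m) q" using Suc by (simp add: dprod_Suc)
qed

lemma dprod_permutes: "i \<le> n \<Longrightarrow> dprod i n permutes {1..tail i}"
proof (induction i rule: inc_induct)
  case base
  show "dprod n n permutes {1..tail n}" by (simp only: dprod_same permutes_id)
next
  case (step i)
  have "dprod (Suc i) n permutes {1..tail i}"
    by (rule permutes_interval_mono[OF step.IH]) (use tail_antimono[of i "Suc i"] in simp)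
  moreover have "delta (Suc i) permutes {1..tail i}"
    unfolding delta_def by (rule bswap_permutes) (use tail_step[of i] step in simp)
  ultimately show "dprod i n permutes {1..tail i}" unfolding dprod_rec[OF \<open>i < n\<close>] by (rule permutes_compose)
qed

text \<open>The inverse of delta_{i+1} fixes the first \<open>e (Suc i)\<close> positions and pushes
  the others up to \<open>M i\<close> beyond \<open>tail (Suc i)\<close>, where the inverse of the
  remaining product acts as the identity.\<close>

lemma inv_dprod_increasing: "i \<le> n \<Longrightarrow> 0 < p \<Longrightarrow> p < q \<Longrightarrow> q \<le> M i \<Longrightarrow> inv (dprod i n) p < inv (dprod i n) q"
proof (induction i arbitrary: p q rule: inc_induct)
  case base
  then show "inv (dprod n n) p < inv (dprod n n) q" by (simp add: dprod_same)
next
  case (step i)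
  let ?I = "inv (dprod (Suc i) n)" and ?t = "tail (Suc (Suc i))"
  have pm: "dprod (Suc i) n permutes {1..tail (Suc i)}" using step by (intro dprod_permutes) simp
  have t: "tail (Suc i) = e (Suc i) + ?t" using tail_step[of i] step by simp
  have i: "inv (dprod i n) = ?I \<circ> bswap (e (Suc i)) (e i) ?t"
    unfolding dprod_rec[OF \<open>i < n\<close>]
    using o_inv_distrib[OF bswap_bij permutes_bij[OF pm]] by (simp add: delta_def inv_bswap)
  have low: "?I l \<le> tail (Suc i)" if "0 < l" "l \<le> tail (Suc i)" for l
    using permutes_in_image[OF permutes_inv[OF pm], of l] that by simp
  have high: "?I l = l" if "tail (Suc i) < l" for l
    using permutes_not_in[OF permutes_inv[OF pm], of l] that by simp
  have b: "bswap (e (Suc i)) (e i) ?t l = (if l \<le> e (Suc i) then l else l + ?t)" if "l \<le> M i" for l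
    using that by (auto simp: bswap_def M_def)
  show "inv (dprod i n) p < inv (dprod i n) q"
  proof (cases "q \<le> e (Suc i)")
    case True
    then have "?I p < ?I q" using step.prems by (intro step.IH) (simp_all add: M_def)
    then show ?thesis unfolding i comp_def using b[of p] b[of q] step.prems True by simp
  next
    case False
    then have q: "inv (dprod i n) q = q + ?t" unfolding i comp_def using b[of q] step.prems high[of "q + ?t"] t by simp
    show ?thesis
    proof (cases "p \<le> e (Suc i)")
      case True
      then show ?thesis using q unfolding i comp_def using b[of p] low[of p] step.prems t False by simp
    next
      case p: False
      then show ?thesis using q unfolding i comp_def using b[of p] high[of "p + ?t"] step.prems t by simp
    qed
  qed
qed

text \<open>Each delta meets an increasing window, so the Demazure and the ordinary product
  agree.\<close>

lemma hecke_word_id: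
  assumes "\<And>i. i < m \<Longrightarrow> ws ! i = id" "m \<le> n"
  shows "of_hperm (hecke_word ws m) = dprod 0 m"
  using assms
proof (induction m)
  case 0
  then show ?case by (simp add: hecke_word_simps dprod_same)
next
  case (Suc m)
  let ?b = "blk (e (Suc m)) (tail (Suc (Suc m))) (e m)"
  have IH: "of_hperm (hecke_word ws m) = dprod 0 m" by (rule Suc.IH) (use Suc.prems in auto)
  have fin: "finite_perm (dprod 0 m)" unfolding IH[symmetric] by simp
  have "hecke_word ws (Suc m) = hecke_word ws m + to_hperm (dem ?b)"
  proof -
    have "to_hperm (ws ! m) = 0" using Suc.prems(1)[of m] by (simp only: zero_hperm_def lessI)
    then show ?thesis unfolding dem_blk hecke_word_simps by (simp add: delta_def)
  qed
  also have "\<dots> = to_hperm (act ?b (dprod 0 m))" unfolding add_to_hperm_dem IH ..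
  also have "act ?b (dprod 0 m) = dprod 0 m \<circ> delta (Suc m)"
    unfolding delta_def diff_Suc_1
    by (rule act_blk) (use Suc.prems tail_step[of m] in \<open>auto intro!: dprod_increasing\<close>)
  finally have w: "hecke_word ws (Suc m) = to_hperm (dprod 0 m \<circ> delta (Suc m))" .
  show "of_hperm (hecke_word ws (Suc m)) = dprod 0 (Suc m)"
    unfolding w dprod_Suc[OF le0] by (intro of_to_hperm finite_perm_comp fin finite_perm_delta)
qed

text \<open>Dropping the factors \<open>ws ! i\<close> and replacing Demazure by ordinary products
  can only raise the rank function.\<close>

lemma rk_le_hecke_word: "rk_le (of_hperm (hecke_word ws m)) (dprod 0 m)"
proof (induction m)
  case 0
  show ?case by (simp add: hecke_word_simps dprod_same rk_le_refl)
next
  case (Suc m)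
  show ?case
    using rk_le_add(2)[OF rk_le_add(1)[OF Suc], of "to_hperm (ws ! m)" "to_hperm (delta (Suc m))"]
    by (simp only: hecke_word_simps dprod_Suc le0 of_to_hperm finite_perm_delta)
qed

text \<open>
  A single letter of \<open>ws ! i\<close> inserted into \<open>\<delta>\<^sub>1 \<cdots> \<delta>\<^sub>n\<close> already makes some value of the rank
  function smaller.
\<close>

lemma hecke_word_not_id:
  assumes ws: "ws \<in> choices (\<lambda>i. {w. w permutes {1..M i}}) n" and i: "i < n" "ws ! i \<noteq> id"
  shows "of_hperm (hecke_word ws n) \<noteq> dprod 0 n"
proof
  assume eq: "of_hperm (hecke_word ws n) = dprod 0 n"
  have w: "(ws ! i) permutes {1..M i}" using ws i by (auto simp: choices_def)
  then have fw: "finite_perm (ws ! i)" by (auto simp: finite_perm_def)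
  obtain k where k: "k + 2 \<le> M i" "rk_le (of_hperm (hecke_word ws i + to_hperm (ws ! i))) (dprod 0 i \<circ> adj k)"
    by (rule rk_le_add_letter[OF rk_le_hecke_word[of ws i], of "to_hperm (ws ! i)" "M i"]) (use w fw i in auto)
  have "rk_le (of_hperm (hecke_word ws m)) (dprod 0 i \<circ> adj k \<circ> dprod i m)" if "Suc i \<le> m" for m
    using that
  proof (induction m rule: dec_induct)
    case base
    show ?case using rk_le_add(2)[OF k(2), of "to_hperm (delta (Suc i))"]
      by (simp only: hecke_word_simps dprod_Suc dprod_same order_refl of_to_hperm finite_perm_delta id_o)
  next
    case (step m)
    have "i \<le> m" using step by simp
    then show ?case
      using rk_le_add(2)[OF rk_le_add(1)[OF step.IH], of "to_hperm (ws ! m)" "to_hperm (delta (Suc m))"]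
      by (simp only: hecke_word_simps dprod_Suc of_to_hperm finite_perm_delta comp_assoc)
  qed
  from this[of n] have "rk_le (dprod 0 i \<circ> dprod i n) (dprod 0 i \<circ> adj k \<circ> dprod i n)"
    using i unfolding eq by (simp only: dprod_comp Suc_le_eq less_imp_le)
  \<comment> \<open>The product before the letter k and the inverse of the product after it both
    ascend at k, so the insertion lowers some entry of the rank function strictly.\<close>
  moreover have "\<not> rk_le (dprod 0 i \<circ> dprod i n) (dprod 0 i \<circ> adj k \<circ> dprod i n)"
  proof (rule not_rk_le_insert)
    have M: "M i \<le> tail i" using tail_step[of i] i by (simp add: M_def)
    show "dprod 0 i (Suc k) < dprod 0 i (Suc (Suc k))" using k i M by (intro dprod_increasing) auto
    show "bij (dprod i n)" using i by (intro permutes_bij[OF dprod_permutes]) simp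
    show "inv (dprod i n) (Suc k) < inv (dprod i n) (Suc (Suc k))" using k i by (intro inv_dprod_increasing) auto
    show "inv (dprod i n) (Suc k) > 0"
      using permutes_in_image[OF permutes_inv[OF dprod_permutes[of i]], of "Suc k"] i k M by simp
  qed
  ultimately show False by blast
qed

lemma coef_HD_generic:
  assumes "n \<ge> 1" "z = perm_prod (map delta [1..<n])"
  shows "coef (prod_list (map (\<lambda>i. H i * D i) [0..<n])) z = 1"
proof -
  have z: "z = dprod 0 n"
  proof -
    have "map Suc [0..<n] = [1..<n] @ [n]" using assms(1) by (simp add: map_Suc_upt)
    then have "map delta (map Suc [0..<n]) = map delta [1..<n] @ [delta n]" by simp
    then have "map (\<lambda>k. delta (Suc k)) [0..<n] = map delta [1..<n] @ [delta n]" by (simp only: map_map comp_def)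
    then show ?thesis using assms(2) by (simp add: dprod_def perm_prod_simps delta_n)
  qed
  have "KMS_factorizations n r = {replicate n id}"
  proof (intro equalityI subsetI)
    fix ws assume "ws \<in> KMS_factorizations n r"
    then have ws: "ws \<in> choices (\<lambda>i. {w. w permutes {1..M i}}) n" "of_hperm (hecke_word ws n) = dprod 0 n"
      using KMS_factorizations_eq[OF assms(1)] z by auto
    then have "ws ! i = id" if "i < n" for i using hecke_word_not_id that by blast
    then show "ws \<in> {replicate n id}" using ws(1) by (auto simp: choices_def intro: nth_equalityI)
  next
    fix ws assume "ws \<in> {replicate n (id :: nat \<Rightarrow> nat)}"
    then show "ws \<in> KMS_factorizations n r"
      unfolding KMS_factorizations_eq[OF assms(1)] using hecke_word_id[of n ws] z
      by (auto simp: choices_def permutes_id)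
  qed
  then show ?thesis unfolding coef_HD_sum[OF assms(1)] by (simp add: coef_H_id)
qed

section \<open>The quotient of Grothendieck polynomials\<close>

lemma grothendieck_z:
  "grothendieck_at N (zel_perm_hat n r) (all_vars_rev n e) (all_vars n e) =
    (- 1) ^ perm_length z * (\<Prod>i<n. kap i) * coef (prod_list (map (\<lambda>i. H i * D i) [0..<n])) z"
proof -
  have "zel_perm_hat n r = hat_perm N z" by (simp add: zel_perm_hat_def hat_perm_def Let_def)
  then show ?thesis
    using grothendieck_at_coef[OF hat_perm_permutes[OF z_permutes], of "all_vars_rev n e" "all_vars n e"] a_rev_nonzero
    by (simp add: sign_hat_perm coef_tri_z coef_HD)
qed

lemma kap_nonzero: "i < n \<Longrightarrow> kap i \<noteq> 0"
  unfolding kap_def by (auto simp: xbox_nonzero)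

text \<open>The lengths enter twice, through the stable polynomials and through the exponent, and
  cancel; only the sign of d survives.\<close>

lemma KMS_summand:
  assumes "ws \<in> KMS_factorizations n r"
  shows "(- 1) powi (int (\<Sum>i=1..n. perm_length (ws ! (i - 1))) - int d) *
      (\<Prod>i=1..n. stable_grothendieck (e (i - 1) + e i) (ws ! (i - 1)) (var_block e i) (var_block e (i - 1))) =
    (- 1) ^ d * (\<Prod>i<n. coef (H i) (ws ! i))"
proof -
  have w: "(ws ! i) permutes {1..M i}" if "i < n" for i
  proof -
    have "\<forall>i\<in>{1..n}. (ws ! (i - 1)) permutes {1..e (i - 1) + e i}"
      using assms unfolding KMS_factorizations_def by blast
    from bspec[OF this, of "Suc i"] that have "(ws ! i) permutes {1..e i + e (Suc i)}" by simp
    then show ?thesis by (simp add: M_def)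
  qed
  have "(\<Prod>i=1..n. stable_grothendieck (e (i - 1) + e i) (ws ! (i - 1)) (var_block e i) (var_block e (i - 1))) =
      (\<Prod>i<n. stable_grothendieck (M i) (ws ! i) (var_block e (Suc i)) (var_block e i))"
    by (simp add: prod.atLeast1_atMost_eq M_def)
  also have "\<dots> = (\<Prod>i<n. (- 1) ^ perm_length (ws ! i) * coef (H i) (ws ! i))"
    by (intro prod.cong refl stable_H w) simp
  also have "\<dots> = (- 1) ^ (\<Sum>i<n. perm_length (ws ! i)) * (\<Prod>i<n. coef (H i) (ws ! i))"
    by (simp add: prod.distrib power_sum)
  finally have P: "(\<Prod>i=1..n. stable_grothendieck (e (i - 1) + e i) (ws ! (i - 1)) (var_block e i) (var_block e (i - 1))) =
      (- 1) ^ (\<Sum>i<n. perm_length (ws ! i)) * (\<Prod>i<n. coef (H i) (ws ! i))" .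
  have l: "(\<Sum>i=1..n. perm_length (ws ! (i - 1))) = (\<Sum>i<n. perm_length (ws ! i))"
    by (simp add: sum.atLeast1_atMost_eq)
  have sq: "(- 1 :: ratfun) ^ k * (- 1) ^ k = 1" for k by (simp add: power_add[symmetric])
  have sw: "x * y * (x * c) = (x * x) * (y * c)" for x y c :: ratfun by (simp only: ac_simps)
  show ?thesis unfolding P l minus_one_powi_diff by (subst sw) (simp only: sq mult_1_left)
qed

end

theorem theorem8p1:
  fixes n :: nat and r :: "nat \<Rightarrow> nat \<Rightarrow> nat" and e :: "nat \<Rightarrow> nat" and N :: nat
  assumes "n \<ge> 1"
    and "rank_conditions n r"
    and "e = dim_vec r"
    and "N = total_dim n e"
  shows "grothendieck_at N (zel_perm_hat n (generic_rank e)) (all_vars_rev n e) (all_vars n e) \<noteq> 0 \<and>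
         grothendieck_at N (zel_perm_hat n r) (all_vars_rev n e) (all_vars n e) /
         grothendieck_at N (zel_perm_hat n (generic_rank e)) (all_vars_rev n e) (all_vars n e) =
         (\<Sum>ws\<in>KMS_factorizations n r.
            (- 1) powi (int (\<Sum>i=1..n. perm_length (ws ! (i - 1))) - int (rank_codim n r)) *
            (\<Prod>i=1..n. stable_grothendieck (e (i - 1) + e i) (ws ! (i - 1))
                          (var_block e i) (var_block e (i - 1))))"
proof -
  let ?g = "generic_rank e"
  interpret A: ranks n r by unfold_locales (rule assms)
  interpret B: ranks n ?g by unfold_locales (rule rank_conditions_generic)
  have e: "A.e = e" "B.e = e" using assms(3) by (simp_all add: dim_vec_generic)
  \<comment> \<open>The parity that z(r) shares with its generic counterpart.\<close>
  define S :: ratfun where "S = (\<Prod>j\<in>{1..n}. \<Prod>i\<in>{j..<n}. (- 1) ^ (e (Suc i) * e (j - 1)))"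
  define K where "K = (\<Prod>i<n. A.kap i)"
  \<comment> \<open>The forced scalars are built from the dimension vector, which both
    interpretations have in common.\<close>
  have "A.kap i = B.kap i" for i
    unfolding A.kap_def B.kap_def A.xbox_def B.xbox_def A.tail_def B.tail_def A.s_def B.s_def e ..
  then have KB: "(\<Prod>i<n. B.kap i) = K" by (simp add: K_def)
  \<comment> \<open>For generic ranks every summand of the codimension has a zero factor.\<close>
  have "rank_codim n ?g = 0"
    unfolding rank_codim_def using generic_rank_cases[of _ _ e] by (fastforce intro!: sum.neutral)
  then have sB: "(- 1 :: ratfun) ^ perm_length B.z = S" using B.z_sign[where 'a = ratfun] by (simp add: S_def e)
  have sA: "(- 1 :: ratfun) ^ perm_length A.z = (- 1) ^ rank_codim n r * S"
    using A.z_sign[where 'a = ratfun] by (simp add: S_def e)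
  have "B.z = perm_prod (map B.delta [1..<n])"
  proof (rule B.z_delta)
    show "B.R i j = B.R (Suc i) j \<or> B.R i j = B.R i (j - 1)" if "i < j" "j \<le> n" for i j
      using that generic_rank_cases[of i j e] by (simp add: B.R_le)
  qed
  then have c: "coef (prod_list (map (\<lambda>i. B.H i * B.D i) [0..<n])) B.z = 1" by (rule B.coef_HD_generic[OF assms(1)])
  have B: "grothendieck_at N (zel_perm_hat n ?g) (all_vars_rev n e) (all_vars n e) = S * K"
    using B.grothendieck_z unfolding c sB KB e assms(4)[symmetric] by simp
  have A: "grothendieck_at N (zel_perm_hat n r) (all_vars_rev n e) (all_vars n e) =
      S * K * ((- 1) ^ rank_codim n r * (\<Sum>ws\<in>KMS_factorizations n r. \<Prod>i<n. coef (A.H i) (ws ! i)))"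
    using A.grothendieck_z unfolding A.coef_HD_sum[OF assms(1)] e sA K_def[symmetric] assms(4)[symmetric]
    by (simp only: ac_simps)
  have "S * K \<noteq> 0" by (simp add: S_def K_def A.kap_nonzero)
  moreover have "(\<Sum>ws\<in>KMS_factorizations n r.
            (- 1) powi (int (\<Sum>i=1..n. perm_length (ws ! (i - 1))) - int (rank_codim n r)) *
            (\<Prod>i=1..n. stable_grothendieck (e (i - 1) + e i) (ws ! (i - 1))
                          (var_block e i) (var_block e (i - 1)))) =
      (- 1) ^ rank_codim n r * (\<Sum>ws\<in>KMS_factorizations n r. \<Prod>i<n. coef (A.H i) (ws ! i))"
    unfolding sum_distrib_left by (intro sum.cong refl A.KMS_summand[unfolded e])
  ultimately show ?thesis unfolding A B by simp
qed

end
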